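(* Let $k$ be a field complete with respect to a discrete valuation with value group $\mathbb{Z}$, and let $D$ be an NSR central division algebra over $k$ that contains a maximal subfield which is totally ramified and purely inseparable over $k$. Then $D$ contains a maximal subfield which is a totally ramified cyclic extension of $k$.
   Context: A central division algebra $D$ over $k$ is NSR (nicely semiramified) if it contains a maximal subfield that is unramified over $k$ and a maximal subfield that is totally ramified over $k$. A finite field extension $L/k$ is totally ramified if its ramification index equals $[L:k]$ (equivalently the residue field extension is trivial), and unramified if the residue extension is separable of degree $[L:k]$. *)

theory Defs
  imports
    "HOL-Computational_Algebra.Primes"
    "HOL-Algebra.Finite_Extensions"
    "HOL-Algebra.Elementary_Groups"
    "HOL-Algebra.QuotRing"
    "HOL-Algebra.Bij"
begin

text \<open>
  The base field \<open>k\<close> is identified with its image \<open>K\<close> in the algebra, so that all fields in question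
  are subsets of one ambient ring satisfying \<^const>\<open>subfield\<close>. The ambient ring of the definitions
  below need not be commutative.
\<close>

section \<open>Separable, purely inseparable and cyclic extensions\<close>

context ring
begin

text \<open>Polynomials are coefficient lists, leading coefficient first.\<close>

definition poly_deriv :: "'a list \<Rightarrow> 'a list" where
  "poly_deriv p = normalize (map (\<lambda>i. [i] \<cdot> coeff p i) (rev [1..<length p]))"

definition separable_poly :: "'a set \<Rightarrow> 'a list \<Rightarrow> bool" where
  "separable_poly F p \<longleftrightarrow>
     (\<forall>d \<in> carrier (F[X]). d divides\<^bsub>F[X]\<^esub> p \<and> d divides\<^bsub>F[X]\<^esub> poly_deriv p \<longrightarrow> d \<in> Units (F[X]))"

definition separable_extension :: "'a set \<Rightarrow> 'a set \<Rightarrow> bool" where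
  "separable_extension F E \<longleftrightarrow>
     subfield F R \<and> subfield E R \<and> F \<subseteq> E \<and>
     (\<forall>x \<in> E. (algebraic over F) x \<and> separable_poly F (Irr F x))"

text \<open>A prime \<open>p\<close> with \<open>p \<cdot> 1 = 0\<close> is the characteristic; in characteristic \<open>0\<close> only
  the trivial extension is purely inseparable.\<close>

definition purely_inseparable_extension :: "'a set \<Rightarrow> 'a set \<Rightarrow> bool" where
  "purely_inseparable_extension F E \<longleftrightarrow>
     subfield F R \<and> subfield E R \<and> F \<subseteq> E \<and>
     (\<forall>x \<in> E. x \<in> F \<or>
        (\<exists>(p::nat) (m::nat). Factorial_Ring.prime p \<and> [p] \<cdot> \<one> = \<zero> \<and> x [^] (p ^ m) \<in> F))"

definition finite_field_extension :: "'a set \<Rightarrow> 'a set \<Rightarrow> bool" where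
  "finite_field_extension F E \<longleftrightarrow>
     subfield F R \<and> subfield E R \<and> F \<subseteq> E \<and> finite_dimension F E"

definition Gal :: "'a set \<Rightarrow> 'a set \<Rightarrow> ('a \<Rightarrow> 'a) monoid" where
  "Gal F E = BijGroup E
     \<lparr>carrier := {\<sigma> \<in> Bij E. \<sigma> \<in> ring_hom (R\<lparr>carrier := E\<rparr>) (R\<lparr>carrier := E\<rparr>) \<and> (\<forall>x \<in> F. \<sigma> x = x)}\<rparr>"

definition galois_extension :: "'a set \<Rightarrow> 'a set \<Rightarrow> bool" where
  "galois_extension F E \<longleftrightarrow>
     finite_field_extension F E \<and> {x \<in> E. \<forall>\<sigma> \<in> carrier (Gal F E). \<sigma> x = x} = F"

definition cyclic_extension :: "'a set \<Rightarrow> 'a set \<Rightarrow> bool" where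
  "cyclic_extension F E \<longleftrightarrow> galois_extension F E \<and> cyclic_group (Gal F E)"


section \<open>Discrete valuations and ramification\<close>

text \<open>A valuation is an integer-valued function whose value at \<open>\<zero>\<close> is irrelevant;
  \<open>val_ge v m x\<close> renders \<open>v x \<ge> m\<close> under the convention \<open>v \<zero> = \<infinity>\<close>.\<close>

definition val_ge :: "('a \<Rightarrow> int) \<Rightarrow> int \<Rightarrow> 'a \<Rightarrow> bool" where
  "val_ge v m x \<longleftrightarrow> x = \<zero> \<or> m \<le> v x"

definition discrete_valuation :: "'a set \<Rightarrow> ('a \<Rightarrow> int) \<Rightarrow> bool" where
  "discrete_valuation F v \<longleftrightarrow>
     subfield F R \<and>
     v ` (F - {\<zero>}) = UNIV \<and>
     (\<forall>x \<in> F - {\<zero>}. \<forall>y \<in> F - {\<zero>}. v (x \<otimes> y) = v x + v y) \<and>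
     (\<forall>x \<in> F - {\<zero>}. \<forall>y \<in> F - {\<zero>}. val_ge v (min (v x) (v y)) (x \<oplus> y))"

definition complete_discrete_valuation :: "'a set \<Rightarrow> ('a \<Rightarrow> int) \<Rightarrow> bool" where
  "complete_discrete_valuation F v \<longleftrightarrow>
     discrete_valuation F v \<and>
     (\<forall>s :: nat \<Rightarrow> 'a.
        range s \<subseteq> F \<and> (\<forall>m. \<exists>N. \<forall>i\<ge>N. \<forall>j\<ge>N. val_ge v m (s i \<ominus> s j))
        \<longrightarrow> (\<exists>l \<in> F. \<forall>m. \<exists>N. \<forall>i\<ge>N. val_ge v m (s i \<ominus> l)))"

definition valuation_ring :: "'a set \<Rightarrow> ('a \<Rightarrow> int) \<Rightarrow> 'a set" where
  "valuation_ring F v = {x \<in> F. val_ge v 0 x}"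

definition valuation_ideal :: "'a set \<Rightarrow> ('a \<Rightarrow> int) \<Rightarrow> 'a set" where
  "valuation_ideal F v = {x \<in> F. val_ge v 1 x}"

definition residue_field :: "'a set \<Rightarrow> ('a \<Rightarrow> int) \<Rightarrow> 'a set ring" where
  "residue_field F v = R\<lparr>carrier := valuation_ring F v\<rparr> Quot valuation_ideal F v"

text \<open>The residue field of \<open>F\<close> as a subfield of the residue field of \<open>(E, w)\<close>.\<close>

definition residue_image :: "'a set \<Rightarrow> ('a \<Rightarrow> int) \<Rightarrow> 'a set \<Rightarrow> ('a \<Rightarrow> int) \<Rightarrow> 'a set set" where
  "residue_image F v E w = (\<lambda>x. valuation_ideal E w +> x) ` valuation_ring F v"

text \<open>The normalized valuation \<open>w\<close> of \<open>E\<close> prolongs \<open>v\<close> with ramification index \<open>e\<close>. If \<open>v\<close> is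
  complete and \<open>E\<close> is finite over \<open>F\<close>, then exactly one such \<open>w\<close> (up to its values outside
  \<open>E - {\<zero>}\<close>) and one such \<open>e\<close> exist, so that the existential quantifiers below are harmless.\<close>

definition prolongs_with_index ::
    "'a set \<Rightarrow> ('a \<Rightarrow> int) \<Rightarrow> 'a set \<Rightarrow> ('a \<Rightarrow> int) \<Rightarrow> nat \<Rightarrow> bool" where
  "prolongs_with_index F v E w e \<longleftrightarrow>
     discrete_valuation E w \<and> 0 < e \<and> (\<forall>x \<in> F - {\<zero>}. w x = int e * v x)"

definition totally_ramified :: "'a set \<Rightarrow> ('a \<Rightarrow> int) \<Rightarrow> 'a set \<Rightarrow> bool" where
  "totally_ramified F v E \<longleftrightarrow>
     finite_field_extension F E \<and>
     (\<exists>w e. prolongs_with_index F v E w e \<and> dimension e F E)"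

definition unramified :: "'a set \<Rightarrow> ('a \<Rightarrow> int) \<Rightarrow> 'a set \<Rightarrow> bool" where
  "unramified F v E \<longleftrightarrow>
     finite_field_extension F E \<and>
     (\<exists>w e n. prolongs_with_index F v E w e \<and> dimension n F E \<and>
        ring.separable_extension (residue_field E w)
          (residue_image F v E w) (carrier (residue_field E w)) \<and>
        ring.dimension (residue_field E w) n
          (residue_image F v E w) (carrier (residue_field E w)))"


section \<open>Division algebras\<close>

definition maximal_subfield :: "'a set \<Rightarrow> 'a set \<Rightarrow> bool" where
  "maximal_subfield K L \<longleftrightarrow>
     subfield L R \<and> K \<subseteq> L \<and> (\<forall>M. subfield M R \<and> L \<subseteq> M \<longrightarrow> M = L)"

end

locale central_division_algebra = ring D for D (structure) +
  fixes K :: "'a set"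
  assumes subfield_K: "subfield K D"
    and Units_eq: "Units D = carrier D - {\<zero>}"
    and center_eq: "K = {z \<in> carrier D. \<forall>x \<in> carrier D. z \<otimes> x = x \<otimes> z}"
    and finite_dim: "finite_dimension K (carrier D)"

text \<open>NSR: nicely semiramified, for the base field \<open>K\<close> with valuation \<open>v\<close>.\<close>

locale NSR_division_algebra = central_division_algebra +
  fixes v :: "'a \<Rightarrow> int"
  assumes unramified_maximal_subfield: "\<exists>L. maximal_subfield K L \<and> unramified K v L"
    and totally_ramified_maximal_subfield: "\<exists>L. maximal_subfield K L \<and> totally_ramified K v L"

end

theory Submission
  imports Defs
begin

text \<open>
  A uniformizer \<open>t\<close> of the totally ramified purely inseparable maximal subfield \<open>T\<close> generates \<open>T\<close>,
  and \<open>t\<^sup>q \<in> K\<close> for some \<open>q = p\<^sup>M\<close> (unless \<open>T = K\<close>). Conjugation \<open>\<sigma>\<close> by \<open>t\<close> is unipotent on \<open>D\<close>, and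
  \<open>\<sigma> - 1\<close> is a single Jordan block over its kernel \<open>T\<close>. Solving \<open>\<sigma> y - y = c\<close> with \<open>c\<close> of trace \<open>1\<close>, first
  in \<open>D\<close> and then in the successive centralizers, gives commuting \<open>y\<^sub>1, \<dots>, y\<^sub>M\<close> that generate a
  \<open>\<sigma>\<close>-stable maximal subfield \<open>E\<close> with \<open>\<sigma>\<close> generating its Galois group; each \<open>y\<^sub>r\<close> is an Artin-Schreier root
  over the preceding field.

  Total ramification is carried along the maximal subfields \<open>K(y\<^sub>1, \<dots>, y\<^sub>r, s)\<close>, where \<open>s\<close> is \<open>t\<close> to the
  power \<open>p\<^sup>r\<close>: they lead from \<open>T\<close> to \<open>E\<close>. Two consecutive ones are \<open>F(s)\<close> and \<open>F(y)\<close> for a common subfield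
  \<open>F\<close> of index \<open>p\<close>. As \<open>F(s)\<close> is totally ramified over \<open>F\<close>, some \<open>\<eta> = s - g\<close> with \<open>g \<in> F\<close> has value prime to \<open>p\<close>.
  The root \<open>y\<close> may be replaced by \<open>y + d s\<close> with \<open>d \<in> K\<close> of very negative value; then \<open>u = y + d \<eta>\<close> generates
  the same extension of \<open>F\<close>, and \<open>u\<^sup>p - u\<close> has a pole of order prime to \<open>p\<close>, so that \<open>F(y)\<close> is totally ramified
  as well.
\<close>

text \<open>The obstacle is that a cyclic maximal subfield need not be totally ramified: y^p - y may
  have a pole of order divisible by p, or none at all. What can be varied is y: the equation
  \<sigma> y - y = c is unaffected by adding an element that commutes with t, such as d s. But d s
  does not commute with y. Conjugation by s moves y to y + 1, so the p-th power of y + d s has the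
  extra summand d s beside the two p-th powers, and the difference of p-th power and element leaves
  the centre of the current centralizer. A second correction, again commuting with t, has to bring
  it back, because this membership drives the recursion: it gives (ad y)^p = ad y on the current
  centralizer, so that solutions of \<sigma> x - x = z can be projected onto the next centralizer.
  Unipotence comes from the characteristic: (\<sigma> - 1)^(p^M) = \<sigma>^(p^M) - 1, and
  \<sigma>^(p^M) is conjugation by the central element t^(p^M). Fields are handled as commutative
  centralizers, which contain inverses for free, rather than by generators.\<close>

context ring
begin

section \<open>Additive self-maps of a ring and the binomial formula\<close>

definition additive_map :: "('a \<Rightarrow> 'a) \<Rightarrow> bool" where
  "additive_map f \<longleftrightarrow> (\<forall>x \<in> carrier R. f x \<in> carrier R) \<and>
     (\<forall>x \<in> carrier R. \<forall>y \<in> carrier R. f (x \<oplus> y) = f x \<oplus> f y)"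

lemma additive_mapI:
  assumes "\<And>x. x \<in> carrier R \<Longrightarrow> f x \<in> carrier R"
    and "\<And>x y. x \<in> carrier R \<Longrightarrow> y \<in> carrier R \<Longrightarrow> f (x \<oplus> y) = f x \<oplus> f y"
  shows "additive_map f"
  using assms unfolding additive_map_def by blast

lemma additive_map_closed [simp, intro]: "additive_map f \<Longrightarrow> x \<in> carrier R \<Longrightarrow> f x \<in> carrier R"
  unfolding additive_map_def by blast

lemma additive_map_add:
  "additive_map f \<Longrightarrow> x \<in> carrier R \<Longrightarrow> y \<in> carrier R \<Longrightarrow> f (x \<oplus> y) = f x \<oplus> f y"
  unfolding additive_map_def by blast

lemma diff_add_cancel: "x \<in> carrier R \<Longrightarrow> y \<in> carrier R \<Longrightarrow> (x \<ominus> y) \<oplus> y = x"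
  by (simp add: minus_eq a_assoc l_neg)

lemma add_diff_cancel: "x \<in> carrier R \<Longrightarrow> y \<in> carrier R \<Longrightarrow> (x \<oplus> y) \<ominus> y = x"
  by (simp add: minus_eq a_assoc r_neg)

lemma additive_map_zero:
  assumes "additive_map f" shows "f \<zero> = \<zero>"
proof -
  have "f \<zero> \<oplus> f \<zero> = f \<zero> \<oplus> \<zero>"
    using additive_map_add[OF assms, of \<zero> \<zero>] assms by simp
  then show ?thesis
    using assms by (metis add.l_cancel additive_map_closed zero_closed)
qed

lemma additive_map_uminus:
  assumes "additive_map f" "x \<in> carrier R" shows "f (\<ominus> x) = \<ominus> f x"
proof -
  have "f (\<ominus> x) \<oplus> f x = \<zero>"
    using additive_map_add[OF assms(1), of "\<ominus> x" x] assms(2) additive_map_zero[OF assms(1)] by (simp add: l_neg)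
  then show ?thesis
    using assms by (metis additive_map_closed a_inv_closed minus_equality)
qed

lemma additive_map_diff:
  assumes "additive_map f" "x \<in> carrier R" "y \<in> carrier R" shows "f (x \<ominus> y) = f x \<ominus> f y"
  using assms by (simp add: minus_eq additive_map_add additive_map_uminus)

lemma additive_map_add_pow:
  assumes "additive_map f" "x \<in> carrier R" shows "f ([(n::nat)] \<cdot> x) = [n] \<cdot> f x"
  using assms by (induction n) (simp_all add: additive_map_zero additive_map_add)

lemma additive_map_funpow:
  assumes "additive_map f" shows "additive_map (f ^^ n)"
  by (induction n) (use assms in \<open>auto simp: additive_map_def\<close>)

lemma additive_map_finsum:
  assumes "additive_map f" "finite A" "g \<in> A \<rightarrow> carrier R"
  shows "f (finsum R g A) = finsum R (\<lambda>i. f (g i)) A"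
  using assms(2,3)
  by (induction A) (use assms(1) in \<open>simp_all add: additive_map_zero additive_map_add Pi_def\<close>)

lemma additive_map_minus:
  assumes "additive_map f" "additive_map g" shows "additive_map (\<lambda>x. f x \<ominus> g x)"
  by (rule additive_mapI) (use assms in \<open>simp_all add: additive_map_add minus_eq minus_add a_ac\<close>)

lemma funpow_commute_on:
  assumes "additive_map f" "additive_map g"
    and "\<And>x. x \<in> carrier R \<Longrightarrow> f (g x) = g (f x)" "x \<in> carrier R"
  shows "(f ^^ n) (g x) = g ((f ^^ n) x)"
  using assms(4)
proof (induction n)
  case (Suc n)
  then show ?case
    using assms additive_map_funpow[OF assms(1), of n] by simp
qed simp

text \<open>Commuting additive maps are used instead of commuting elements in order to cover
  operators on a noncommutative ring, such as \<open>ad a\<close> and right multiplication by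
  \<open>a\<close>. The induction step is Pascal's rule.\<close>

lemma additive_map_binomial:
  assumes f: "additive_map f" and g: "additive_map g"
    and comm: "\<And>x. x \<in> carrier R \<Longrightarrow> f (g x) = g (f x)" and x: "x \<in> carrier R"
  shows "((\<lambda>x. f x \<oplus> g x) ^^ n) x =
           (\<Oplus>k\<in>{..n}. [(n choose k)] \<cdot> (f ^^ k) ((g ^^ (n - k)) x))"
proof (induction n)
  case (Suc n)
  let ?m = "\<lambda>k l. (f ^^ k) ((g ^^ l) x)"
  have m [simp]: "?m k l \<in> carrier R" for k l
    using additive_map_funpow f g x by blast
  have fm: "f (?m k l) = ?m (Suc k) l" for k l by simp
  have gm: "g (?m k l) = ?m k (Suc l)" for k l
    using funpow_commute_on[OF f g comm, of "(g ^^ l) x" k] additive_map_funpow[OF g] x by auto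
  have closed: "(\<lambda>k. [c k] \<cdot> ?m (a k) (b k)) \<in> A \<rightarrow> carrier R" for c a b :: "nat \<Rightarrow> nat" and A
    by simp
  have "((\<lambda>x. f x \<oplus> g x) ^^ Suc n) x =
      f (\<Oplus>k\<in>{..n}. [(n choose k)] \<cdot> ?m k (n - k)) \<oplus> g (\<Oplus>k\<in>{..n}. [(n choose k)] \<cdot> ?m k (n - k))"
    by (simp add: Suc.IH)
  also have "f (\<Oplus>k\<in>{..n}. [(n choose k)] \<cdot> ?m k (n - k)) = (\<Oplus>k\<in>{..n}. [(n choose k)] \<cdot> ?m (Suc k) (n - k))"
    by (subst additive_map_finsum[OF f]) (auto simp: additive_map_add_pow[OF f])
  also have "g (\<Oplus>k\<in>{..n}. [(n choose k)] \<cdot> ?m k (n - k)) = (\<Oplus>k\<in>{..n}. [(n choose k)] \<cdot> ?m k (Suc n - k))"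
    by (subst additive_map_finsum[OF g])
      (auto simp: additive_map_add_pow[OF g] gm Suc_diff_le simp del: funpow.simps intro!: finsum_cong')
  \<comment> \<open>The added summand has coefficient zero; with it the sum can be reindexed by
    \<open>Suc k\<close>.\<close>
  also have "\<dots> = (\<Oplus>k\<in>{..Suc n}. [(n choose k)] \<cdot> ?m k (Suc n - k))"
    by (subst finsum_Suc) (auto simp: binomial_eq_0 simp del: funpow.simps)
  also have "\<dots> = (\<Oplus>k\<in>{..n}. [(n choose Suc k)] \<cdot> ?m (Suc k) (n - k)) \<oplus> ?m 0 (Suc n)"
    using m[of 0 "Suc n"] by (subst finsum_Suc2) (auto simp del: funpow.simps)
  also have "(\<Oplus>k\<in>{..n}. [(n choose k)] \<cdot> ?m (Suc k) (n - k)) \<oplus> \<dots> =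
     (\<Oplus>k\<in>{..n}. [(Suc n choose Suc k)] \<cdot> ?m (Suc k) (n - k)) \<oplus> ?m 0 (Suc n)"
  proof -
    have "[(Suc n choose Suc k)] \<cdot> ?m (Suc k) (n - k) =
        [(n choose k)] \<cdot> ?m (Suc k) (n - k) \<oplus> [(n choose Suc k)] \<cdot> ?m (Suc k) (n - k)" for k
      using m[of "Suc k" "n - k"] by (simp only: binomial_Suc_Suc add.nat_pow_mult)
    then have "(\<Oplus>k\<in>{..n}. [(Suc n choose Suc k)] \<cdot> ?m (Suc k) (n - k)) =
        (\<Oplus>k\<in>{..n}. [(n choose k)] \<cdot> ?m (Suc k) (n - k)) \<oplus> (\<Oplus>k\<in>{..n}. [(n choose Suc k)] \<cdot> ?m (Suc k) (n - k))"
      by (simp only: finsum_addf[OF closed closed])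
    then show ?thesis
      by (simp only: a_assoc[OF finsum_closed[OF closed] finsum_closed[OF closed] m])
  qed
  also have "\<dots> = (\<Oplus>k\<in>{..Suc n}. [(Suc n choose k)] \<cdot> ?m k (Suc n - k))"
    using m[of 0 "Suc n"] by (subst finsum_Suc2) (auto simp del: funpow.simps)
  finally show ?case .
qed (use x in simp)

lemma funpow_cong_on:
  assumes "additive_map f" "\<And>x. x \<in> carrier R \<Longrightarrow> f x = g x" "x \<in> carrier R"
  shows "(f ^^ n) x = (g ^^ n) x"
proof (induction n)
  case (Suc n)
  have "(f ^^ n) x \<in> carrier R"
    using additive_map_funpow[OF assms(1)] assms(3) by blast
  then show ?case using Suc assms(2) by simp
qed simp

lemma additive_map_l_mult: "a \<in> carrier R \<Longrightarrow> additive_map (\<lambda>x. a \<otimes> x)"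
  by (rule additive_mapI) (simp_all add: r_distr)

lemma additive_map_r_mult: "a \<in> carrier R \<Longrightarrow> additive_map (\<lambda>x. x \<otimes> a)"
  by (rule additive_mapI) (simp_all add: l_distr)

lemma funpow_l_mult:
  assumes "a \<in> carrier R" "x \<in> carrier R"
  shows "((\<lambda>x. a \<otimes> x) ^^ n) x = a [^] n \<otimes> x"
  by (induction n) (use assms in \<open>simp_all add: m_assoc[symmetric] nat_pow_Suc2[symmetric] del: nat_pow_Suc\<close>)

lemma funpow_r_mult:
  assumes "a \<in> carrier R" "x \<in> carrier R"
  shows "((\<lambda>x. x \<otimes> a) ^^ n) x = x \<otimes> a [^] n"
  by (induction n) (use assms in \<open>simp_all add: m_assoc\<close>)

section \<open>Inner derivations and centralizers\<close>

definition ad :: "'a \<Rightarrow> 'a \<Rightarrow> 'a" where "ad a x = a \<otimes> x \<ominus> x \<otimes> a"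

lemma additive_map_ad: "a \<in> carrier R \<Longrightarrow> additive_map (ad a)"
  unfolding ad_def by (intro additive_map_minus additive_map_l_mult additive_map_r_mult)

lemma ad_closed [simp]: "a \<in> carrier R \<Longrightarrow> x \<in> carrier R \<Longrightarrow> ad a x \<in> carrier R"
  by (simp add: ad_def)

lemma ad_eq_zero_iff:
  "a \<in> carrier R \<Longrightarrow> x \<in> carrier R \<Longrightarrow> ad a x = \<zero> \<longleftrightarrow> a \<otimes> x = x \<otimes> a"
  by (simp add: ad_def)

lemma ad_mult:
  "a \<in> carrier R \<Longrightarrow> x \<in> carrier R \<Longrightarrow> y \<in> carrier R \<Longrightarrow>
     ad a (x \<otimes> y) = ad a x \<otimes> y \<oplus> x \<otimes> ad a y"
  unfolding ad_def by algebra

lemma ad_add_left: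
  "a \<in> carrier R \<Longrightarrow> b \<in> carrier R \<Longrightarrow> x \<in> carrier R \<Longrightarrow> ad (a \<oplus> b) x = ad a x \<oplus> ad b x"
  unfolding ad_def by algebra

definition cent :: "'a set \<Rightarrow> 'a set" where
  "cent Y = {x \<in> carrier R. \<forall>y \<in> Y. x \<otimes> y = y \<otimes> x}"

lemma cent_carrier [dest]: "x \<in> cent Y \<Longrightarrow> x \<in> carrier R"
  by (simp add: cent_def)

lemma cent_subset_carrier: "cent Y \<subseteq> carrier R"
  by (auto simp: cent_def)

lemma centD: "x \<in> cent Y \<Longrightarrow> y \<in> Y \<Longrightarrow> x \<otimes> y = y \<otimes> x"
  by (simp add: cent_def)

lemma centI: "x \<in> carrier R \<Longrightarrow> (\<And>y. y \<in> Y \<Longrightarrow> x \<otimes> y = y \<otimes> x) \<Longrightarrow> x \<in> cent Y"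
  by (simp add: cent_def)

lemma cent_antimono: "Z \<subseteq> Y \<Longrightarrow> cent Y \<subseteq> cent Z"
  by (auto simp: cent_def)

lemma subset_cent_cent: "Y \<subseteq> carrier R \<Longrightarrow> Y \<subseteq> cent (cent Y)"
  by (auto simp: cent_def)

lemma cent_insert: "cent (insert y Y) = cent Y \<inter> cent {y}"
  by (auto simp: cent_def)

lemma commute_mult:
  assumes "x \<in> carrier R" "y \<in> carrier R" "z \<in> carrier R" "x \<otimes> z = z \<otimes> x" "y \<otimes> z = z \<otimes> y"
  shows "x \<otimes> y \<otimes> z = z \<otimes> (x \<otimes> y)"
  using assms by (metis m_assoc)

lemma subring_cent:
  assumes "Y \<subseteq> carrier R" shows "subring (cent Y) R"
proof (rule subringI)
  show "\<And>h1 h2. h1 \<in> cent Y \<Longrightarrow> h2 \<in> cent Y \<Longrightarrow> h1 \<otimes> h2 \<in> cent Y"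
    using assms by (intro centI commute_mult) (auto simp: cent_def)
qed (use assms in \<open>auto simp: cent_def l_distr r_distr l_minus r_minus subset_eq\<close>)

lemma subring_pow: "subring H R \<Longrightarrow> x \<in> H \<Longrightarrow> x [^] (n::nat) \<in> H"
  by (induction n) (simp_all add: subringE)

lemma subring_add_pow: "subring H R \<Longrightarrow> x \<in> H \<Longrightarrow> [(n::nat)] \<cdot> x \<in> H"
  by (induction n) (simp_all add: subringE)

lemma subring_minus: "subring H R \<Longrightarrow> x \<in> H \<Longrightarrow> y \<in> H \<Longrightarrow> x \<ominus> y \<in> H"
  by (simp add: subringE a_minus_def)

lemma ad_in_subring: "subring H R \<Longrightarrow> a \<in> H \<Longrightarrow> x \<in> H \<Longrightarrow> ad a x \<in> H"
  by (simp add: ad_def subring_minus subringE)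

lemma pow_commute:
  "x \<in> carrier R \<Longrightarrow> y \<in> carrier R \<Longrightarrow> x \<otimes> y = y \<otimes> x \<Longrightarrow> x [^] (n::nat) \<otimes> y = y \<otimes> x [^] n"
  by (induction n) (simp_all add: commute_mult)

lemma add_pow_mult:
  "x \<in> carrier R \<Longrightarrow> [(m * n :: nat)] \<cdot> x = [m] \<cdot> ([n] \<cdot> x)"
  by (simp add: add.nat_pow_pow mult.commute)

lemma add_pow_eq_mult:
  "x \<in> carrier R \<Longrightarrow> [(n::nat)] \<cdot> x = ([n] \<cdot> \<one>) \<otimes> x"
  by (simp add: add_pow_ldistr)

end

section \<open>Rings of prime characteristic\<close>

locale char_p_ring = ring R for R (structure) +
  fixes p :: nat
  assumes prime_p: "Factorial_Ring.prime p"
    and char_p: "[p] \<cdot> \<one> = \<zero>"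
begin

lemma p_ge_2: "2 \<le> p"
  using prime_p by (rule prime_ge_2_nat)

lemma p_add_pow:
  assumes "x \<in> carrier R" shows "[p] \<cdot> x = \<zero>"
  using add_pow_eq_mult[OF assms, of p] assms by (simp add: char_p)

lemma dvd_add_pow:
  assumes "x \<in> carrier R" "p dvd n" shows "[n] \<cdot> x = \<zero>"
  using assms by (auto simp: add_pow_mult p_add_pow elim!: dvdE)

text \<open>The inner binomial coefficients are divisible by \<open>p\<close>. The Frobenius
  identities of this section are instances for suitable pairs of operators.\<close>

lemma additive_map_frobenius:
  assumes f: "additive_map f" and g: "additive_map g"
    and comm: "\<And>x. x \<in> carrier R \<Longrightarrow> f (g x) = g (f x)" and x: "x \<in> carrier R"
  shows "((\<lambda>x. f x \<oplus> g x) ^^ p) x = (f ^^ p) x \<oplus> (g ^^ p) x"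
proof -
  obtain q where q: "p = Suc (Suc q)"
    using p_ge_2 by (metis add_2_eq_Suc le_Suc_ex)
  let ?t = "\<lambda>k. [(p choose k)] \<cdot> (f ^^ k) ((g ^^ (p - k)) x)"
  have t: "?t k \<in> carrier R" for k
    using additive_map_funpow f g x by (intro add.nat_pow_closed) blast
  have "((\<lambda>x. f x \<oplus> g x) ^^ p) x = (\<Oplus>k\<in>{..Suc (Suc q)}. ?t k)"
    using additive_map_binomial[OF f g comm x, of p] by (simp add: q)
  also have "\<dots> = ?t p \<oplus> ((\<Oplus>k\<in>{..q}. ?t (Suc k)) \<oplus> ?t 0)"
    using t by (subst finsum_Suc, force, subst finsum_Suc2, force) (simp only: q)
  also have "(\<Oplus>k\<in>{..q}. ?t (Suc k)) = (\<Oplus>k\<in>{..q}. \<zero>)"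
  proof (intro finsum_cong' refl)
    fix k assume "k \<in> {..q}"
    then have "p dvd (p choose Suc k)"
      using prime_p q by (intro dvd_choose_prime) auto
    then show "?t (Suc k) = \<zero>"
      using additive_map_funpow f g x by (intro dvd_add_pow) blast+
  qed auto
  finally show ?thesis
    using additive_map_funpow[OF f, of p] additive_map_funpow[OF g, of p] x by (simp add: finsum_zero)
qed

lemma frobenius_add:
  assumes "a \<in> carrier R" "b \<in> carrier R" "a \<otimes> b = b \<otimes> a"
  shows "(a \<oplus> b) [^] p = a [^] p \<oplus> b [^] p"
proof -
  \<comment> \<open>Left multiplications by \<open>a\<close> and \<open>b\<close> commute because
    \<open>a\<close> and \<open>b\<close> do; the operator identity is evaluated at
    \<open>\<one>\<close>.\<close>
  have "((\<lambda>x. a \<otimes> x \<oplus> b \<otimes> x) ^^ p) \<one> = a [^] p \<oplus> b [^] p"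
  proof (subst additive_map_frobenius)
    show "a \<otimes> (b \<otimes> x) = b \<otimes> (a \<otimes> x)" if "x \<in> carrier R" for x
      using assms that by (metis m_assoc)
  qed (use assms in \<open>simp_all add: additive_map_l_mult funpow_l_mult\<close>)
  moreover have "((\<lambda>x. (a \<oplus> b) \<otimes> x) ^^ p) \<one> = ((\<lambda>x. a \<otimes> x \<oplus> b \<otimes> x) ^^ p) \<one>"
    using assms by (intro funpow_cong_on additive_map_l_mult) (auto simp: l_distr)
  ultimately show ?thesis
    using assms(1,2) by (simp add: funpow_l_mult)
qed

text \<open>Additivity for (a - b) + b avoids a p-th power of -1.\<close>

lemma frobenius_minus:
  assumes "a \<in> carrier R" "b \<in> carrier R" "a \<otimes> b = b \<otimes> a"
  shows "(a \<ominus> b) [^] p = a [^] p \<ominus> b [^] p"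
proof -
  have "((a \<ominus> b) \<oplus> b) [^] p = (a \<ominus> b) [^] p \<oplus> b [^] p"
    using assms by (intro frobenius_add) (simp_all add: minus_eq l_distr r_distr l_minus r_minus)
  then show ?thesis
    using assms(1,2) by (simp add: diff_add_cancel add_diff_cancel)
qed

lemma frobenius_power_add:
  assumes "a \<in> carrier R" "b \<in> carrier R" "a \<otimes> b = b \<otimes> a"
  shows "(a \<oplus> b) [^] (p ^ k) = a [^] (p ^ k) \<oplus> b [^] (p ^ k)"
proof (induction k)
  case (Suc k)
  have "a [^] (p ^ k) \<otimes> b [^] (p ^ k) = b [^] (p ^ k) \<otimes> a [^] (p ^ k)"
    using assms by (intro pow_commute) (auto intro: pow_commute[symmetric])
  moreover have "x [^] (p ^ Suc k) = (x [^] (p ^ k)) [^] p" if "x \<in> carrier R" for x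
    using that by (simp add: nat_pow_pow mult.commute)
  ultimately show ?case
    using Suc assms frobenius_add[of "a [^] (p ^ k)" "b [^] (p ^ k)"] by simp
qed (use assms in simp)

text \<open>Left multiplication by \<open>a\<close> is the sum of \<open>ad a\<close> and right
  multiplication by \<open>a\<close>, which commute. Taking p-th powers of these operators and
  cancelling right multiplication by a^p leaves the claim.\<close>

lemma ad_funpow_p:
  assumes "a \<in> carrier R" "x \<in> carrier R"
  shows "(ad a ^^ p) x = ad (a [^] p) x"
proof -
  have "((\<lambda>x. ad a x \<oplus> x \<otimes> a) ^^ p) x = (ad a ^^ p) x \<oplus> x \<otimes> a [^] p"
  proof (subst additive_map_frobenius)
    show "ad a (x \<otimes> a) = ad a x \<otimes> a" if "x \<in> carrier R" for x
      using assms that by (simp add: ad_mult) (simp add: ad_def r_neg minus_eq)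
  qed (use assms in \<open>simp_all add: additive_map_ad additive_map_r_mult funpow_r_mult\<close>)
  moreover have "((\<lambda>x. a \<otimes> x) ^^ p) x = ((\<lambda>x. ad a x \<oplus> x \<otimes> a) ^^ p) x"
    using assms by (intro funpow_cong_on additive_map_l_mult)
      (auto simp: ad_def diff_add_cancel)
  moreover have "(ad a ^^ p) x \<in> carrier R"
    using assms additive_map_funpow[OF additive_map_ad] by blast
  ultimately show ?thesis
    using assms by (simp add: funpow_l_mult ad_def add_diff_cancel)
qed

text \<open>Frobenius for g = (g - 1) + 1 with g = f^(p^k). It makes conjugation by an element with
  a central p-power unipotent.\<close>

lemma funpow_minus_id:
  assumes "additive_map f" "x \<in> carrier R"
  shows "((\<lambda>x. f x \<ominus> x) ^^ (p ^ k)) x = (f ^^ (p ^ k)) x \<ominus> x"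
  using assms(2)
proof (induction k arbitrary: x)
  case (Suc k)
  let ?S = "\<lambda>x. f x \<ominus> x" and ?g = "f ^^ (p ^ k)"
  have id: "additive_map (\<lambda>x. x)" by (rule additive_mapI) auto
  have S: "additive_map ?S" using additive_map_minus[OF assms(1) id] .
  have g: "additive_map ?g" using additive_map_funpow[OF assms(1)] .
  have gS: "additive_map (\<lambda>x. ?g x \<ominus> x)" using additive_map_minus[OF g id] .
  have "(?S ^^ (p ^ Suc k)) x = ((?S ^^ (p ^ k)) ^^ p) x"
    by (simp add: funpow_mult mult.commute)
  also have "\<dots> = ((\<lambda>x. ?g x \<ominus> x) ^^ p) x"
    using Suc by (intro funpow_cong_on additive_map_funpow S) auto
  finally have 1: "(?S ^^ (p ^ Suc k)) x = ((\<lambda>x. ?g x \<ominus> x) ^^ p) x" .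
  have "((\<lambda>x. (?g x \<ominus> x) \<oplus> x) ^^ p) x = ((\<lambda>x. ?g x \<ominus> x) ^^ p) x \<oplus> ((\<lambda>x. x) ^^ p) x"
    using Suc.prems by (intro additive_map_frobenius gS id) auto
  moreover have "((\<lambda>x. x) ^^ n) x = x" for n
    by (induction n) auto
  moreover have "(?g ^^ p) x = ((\<lambda>x. (?g x \<ominus> x) \<oplus> x) ^^ p) x"
    using Suc.prems g by (intro funpow_cong_on g) (auto simp: diff_add_cancel)
  moreover have "(?g ^^ p) x = (f ^^ (p ^ Suc k)) x"
    by (simp add: funpow_mult mult.commute)
  moreover have "((\<lambda>x. ?g x \<ominus> x) ^^ p) x \<in> carrier R"
    using additive_map_funpow[OF gS] Suc.prems by blast
  ultimately show ?case
    using 1 Suc.prems by (simp add: add_diff_cancel)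
qed simp

lemma add_pow_inverse:
  assumes "\<not> p dvd n"
  obtains m :: nat where "\<And>x. x \<in> carrier R \<Longrightarrow> [m] \<cdot> ([n] \<cdot> x) = x"
proof -
  obtain m l where ml: "n * m = Suc (p * l)"
    using bezout_prime[OF prime_p assms] by blast
  have "[m] \<cdot> ([n] \<cdot> x) = x" if "x \<in> carrier R" for x
  proof -
    have "[m] \<cdot> ([n] \<cdot> x) = [(p * l)] \<cdot> x \<oplus> x"
      using ml that by (metis add.nat_pow_Suc add_pow_mult mult.commute)
    then show ?thesis
      using dvd_add_pow[OF that, of "p * l"] that by simp
  qed
  then show thesis by (rule that)
qed

text \<open>Fermat's little theorem as an operator identity: the induction step is Frobenius for
  multiplication by \<open>n\<close> and the identity map.\<close>

lemma add_pow_fermat: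
  assumes "x \<in> carrier R" shows "[(n ^ p :: nat)] \<cdot> x = [n] \<cdot> x"
proof (induction n)
  case 0
  then show ?case using p_ge_2 assms by (simp add: power_0_left)
next
  case (Suc n)
  have iter: "((\<lambda>x. [m] \<cdot> x) ^^ k) x = [(m ^ k)] \<cdot> x" for m k :: nat
  proof (induction k)
    case (Suc k)
    then show ?case
      using add_pow_mult[OF assms, of m "m ^ k"] by simp
  qed (use assms in simp)
  have am: "additive_map (\<lambda>x. [m] \<cdot> x)" for m :: nat
    by (rule additive_mapI) (simp_all add: add.nat_pow_distrib)
  have id: "additive_map (\<lambda>x. x)" by (rule additive_mapI) auto
  have "((\<lambda>x. x) ^^ k) x = x" for k
    by (induction k) auto
  then have "((\<lambda>x. [n] \<cdot> x \<oplus> x) ^^ p) x = [(n ^ p)] \<cdot> x \<oplus> x"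
    using additive_map_frobenius[OF am[of n] id _ assms] iter[where m = n and k = p] by simp
  moreover have "((\<lambda>x. [Suc n] \<cdot> x) ^^ p) x = ((\<lambda>x. [n] \<cdot> x \<oplus> x) ^^ p) x"
    using assms by (intro funpow_cong_on am) auto
  ultimately show ?case
    unfolding iter Suc by (simp only: add.nat_pow_Suc)
qed

lemma add_pow_fermat':
  assumes "x \<in> carrier R" "\<not> p dvd n" shows "[(n ^ (p - 1) :: nat)] \<cdot> x = x"
proof -
  obtain m :: nat where m: "\<And>x. x \<in> carrier R \<Longrightarrow> [m] \<cdot> ([n] \<cdot> x) = x"
    using add_pow_inverse[OF assms(2)] by blast
  have "[(n ^ (p - 1))] \<cdot> x = [m] \<cdot> ([n] \<cdot> ([(n ^ (p - 1))] \<cdot> x))"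
    using m assms by simp
  also have "[n] \<cdot> ([(n ^ (p - 1))] \<cdot> x) = [n] \<cdot> x"
  proof -
    have "n * n ^ (p - 1) = n ^ p"
      using p_ge_2 by (cases p) auto
    then show ?thesis
      using add_pow_fermat[OF assms(1), of n] add_pow_mult[OF assms(1), of n "n ^ (p - 1)"] by argo
  qed
  finally show ?thesis using m assms by simp
qed

lemma not_dvd_fact: "k < p \<Longrightarrow> \<not> p dvd fact k"
  using prime_dvd_fact_iff[OF prime_p, of k] by simp

end

section \<open>Left spans and nilpotent maps\<close>

context ring
begin

text \<open>Recursion through \<open>line_extension\<close> matches the introduction rule of
  \<open>dimension\<close>, so that independence of each vector from its predecessors already gives
  the dimension.\<close>

primrec fspan :: "'a set \<Rightarrow> (nat \<Rightarrow> 'a) \<Rightarrow> nat \<Rightarrow> 'a set" where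
  "fspan F b 0 = {\<zero>}"
| "fspan F b (Suc d) = line_extension F (b d) (fspan F b d)"

lemma fspan_Suc_iff:
  "x \<in> fspan F b (Suc d) \<longleftrightarrow> (\<exists>a\<in>F. \<exists>y\<in>fspan F b d. x = a \<otimes> b d \<oplus> y)"
  by (simp add: line_extension_mem_iff)

lemma dimension_fspan:
  assumes "\<And>i. i < d \<Longrightarrow> b i \<in> carrier R" "\<And>i. i < d \<Longrightarrow> b i \<notin> fspan F b i"
  shows "dimension d F (fspan F b d)"
  using assms by (induction d) (auto intro: Suc_dim)

context
  fixes F assumes F: "subring F R"
begin

lemma fspan_subset_carrier:
  "(\<And>i. i < d \<Longrightarrow> b i \<in> carrier R) \<Longrightarrow> fspan F b d \<subseteq> carrier R"
  by (induction d) (use subringE(1)[OF F] in \<open>auto simp: line_extension_in_carrier\<close>)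

lemma fspan_add:
  assumes "\<And>i. i < d \<Longrightarrow> b i \<in> carrier R" "x \<in> fspan F b d" "y \<in> fspan F b d"
  shows "x \<oplus> y \<in> fspan F b d"
  using assms
proof (induction d arbitrary: x y)
  case (Suc d)
  obtain a a' u u' where *: "a \<in> F" "a' \<in> F" "u \<in> fspan F b d" "u' \<in> fspan F b d"
    "x = a \<otimes> b d \<oplus> u" "y = a' \<otimes> b d \<oplus> u'"
    using Suc.prems(2,3) by (auto simp: line_extension_mem_iff)
  have c: "a \<in> carrier R" "a' \<in> carrier R" "u \<in> carrier R" "u' \<in> carrier R" "b d \<in> carrier R"
    using * subringE(1)[OF F] fspan_subset_carrier[of d b] Suc.prems(1) by auto
  have "x \<oplus> y = (a \<oplus> a') \<otimes> b d \<oplus> (u \<oplus> u')"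
    using c unfolding * by (simp add: l_distr a_ac)
  moreover have "a \<oplus> a' \<in> F" "u \<oplus> u' \<in> fspan F b d"
    using * Suc subringE(7)[OF F] by auto
  ultimately show ?case
    unfolding fspan_Suc_iff by blast
qed simp

lemma fspan_smult:
  assumes "\<And>i. i < d \<Longrightarrow> b i \<in> carrier R" "c \<in> F" "x \<in> fspan F b d"
  shows "c \<otimes> x \<in> fspan F b d"
  using assms
proof (induction d arbitrary: x)
  case 0
  then show ?case using subringE(1)[OF F] by auto
next
  case (Suc d)
  obtain a u where *: "a \<in> F" "u \<in> fspan F b d" "x = a \<otimes> b d \<oplus> u"
    using Suc.prems(3) by (auto simp: line_extension_mem_iff)
  have k: "a \<in> carrier R" "u \<in> carrier R" "b d \<in> carrier R" "c \<in> carrier R"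
    using * subringE(1)[OF F] fspan_subset_carrier[of d b] Suc.prems(1,2) by auto
  have "c \<otimes> x = (c \<otimes> a) \<otimes> b d \<oplus> c \<otimes> u"
    using k unfolding * by (simp add: r_distr m_assoc)
  moreover have "c \<otimes> a \<in> F" "c \<otimes> u \<in> fspan F b d"
    using * Suc subringE(6)[OF F] by auto
  ultimately show ?case
    unfolding fspan_Suc_iff by blast
qed

lemma fspan_zero: "(\<And>i. i < d \<Longrightarrow> b i \<in> carrier R) \<Longrightarrow> \<zero> \<in> fspan F b d"
proof (induction d)
  case (Suc d)
  then have "\<zero> = \<zero> \<otimes> b d \<oplus> \<zero>" "\<zero> \<in> fspan F b d" by auto
  then show ?case
    unfolding fspan_Suc_iff using subringE(2)[OF F] by blast
qed simp

lemma fspan_Suc_mono: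
  assumes "\<And>i. i < Suc d \<Longrightarrow> b i \<in> carrier R" shows "fspan F b d \<subseteq> fspan F b (Suc d)"
proof
  fix x assume x: "x \<in> fspan F b d"
  then have "x = \<zero> \<otimes> b d \<oplus> x"
    using assms fspan_subset_carrier[of d b] by auto
  then show "x \<in> fspan F b (Suc d)"
    unfolding fspan_Suc_iff using x subringE(2)[OF F] by blast
qed

lemma fspan_subset:
  assumes "subring B R" "F \<subseteq> B" "\<And>i. i < d \<Longrightarrow> b i \<in> B" shows "fspan F b d \<subseteq> B"
  using assms(3)
proof (induction d)
  case (Suc d)
  show ?case
  proof
    fix x assume "x \<in> fspan F b (Suc d)"
    then obtain a y where "a \<in> F" "y \<in> fspan F b d" "x = a \<otimes> b d \<oplus> y"
      unfolding fspan_Suc_iff by blast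
    moreover from this have "y \<in> B"
      using Suc.IH Suc.prems by auto
    ultimately show "x \<in> B"
      using Suc.prems[of d] assms(2) subringE(6,7)[OF assms(1)] by auto
  qed
qed (use subringE(2)[OF assms(1)] in simp)

end

text \<open>A nilpotent \<open>F\<close>-linear map with kernel \<open>F\<close> is a single Jordan block.\<close>

lemma nilpotent_basis:
  assumes F: "subfield F R" and B: "subring B R" and F_B: "F \<subseteq> B"
    and L: "additive_map L" and L_B: "\<And>x. x \<in> B \<Longrightarrow> L x \<in> B"
    and lin: "\<And>a x. a \<in> F \<Longrightarrow> x \<in> carrier R \<Longrightarrow> L (a \<otimes> x) = a \<otimes> L x"
    and ker: "\<And>x. x \<in> B \<Longrightarrow> L x = \<zero> \<longleftrightarrow> x \<in> F"
    and b: "\<And>k. k < m \<Longrightarrow> b k \<in> B" "\<And>k. k < m \<Longrightarrow> (L ^^ k) (b k) \<in> F - {\<zero>}"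
  shows "d \<le> m \<Longrightarrow> x \<in> B \<Longrightarrow> (L ^^ d) x = \<zero> \<Longrightarrow> x \<in> fspan F b d"
    and "d \<le> m \<Longrightarrow> x \<in> fspan F b d \<Longrightarrow> (L ^^ d) x = \<zero>"
    and "d \<le> m \<Longrightarrow> dimension d F (fspan F b d)"
proof -
  note sub = subringE[OF B] and F' = subfieldE(1)[OF F]
  have FC: "F \<subseteq> carrier R" using subfieldE(3)[OF F] .
  have bC: "b k \<in> carrier R" if "k < m" for k
    using b(1)[OF that] sub(1) by blast
  have am: "additive_map (L ^^ k)" for k
    using additive_map_funpow[OF L] .
  have lin': "(L ^^ k) (a \<otimes> x) = a \<otimes> (L ^^ k) x" if "a \<in> F" "x \<in> carrier R" for a x k
  proof (induction k)
    case (Suc k)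
    then show ?case using lin[OF that(1)] am[of k] that(2) by simp
  qed simp
  have pow_B: "(L ^^ k) x \<in> B" if "x \<in> B" for x k
    by (induction k) (use that L_B in auto)
  show 1: "x \<in> fspan F b d" if "d \<le> m" "x \<in> B" "(L ^^ d) x = \<zero>" for d x
    using that
  proof (induction d arbitrary: x)
    case (Suc d)
    let ?c = "(L ^^ d) (b d)" and ?y = "(L ^^ d) x"
    have y: "?y \<in> F"
      using ker[of ?y] Suc.prems pow_B by simp
    have c: "?c \<in> F - {\<zero>}" using b(2) Suc.prems by simp
    \<comment> \<open>Chosen so that \<open>a \<otimes> b d\<close> and \<open>x\<close> have the
      same image under \<open>L ^^ d\<close>; their difference is killed one step earlier.\<close>
    define a where "a = ?y \<otimes> inv ?c"
    have ic: "inv ?c \<in> F" "inv ?c \<otimes> ?c = \<one>"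
      using subfield_m_inv[OF F c] by auto
    have a: "a \<in> F" "a \<otimes> ?c = ?y"
      using y ic c FC subringE(6)[OF F'] by (auto simp: a_def m_assoc subset_eq)
    have xC: "x \<in> carrier R" "a \<in> carrier R" "b d \<in> carrier R"
      using Suc.prems sub(1) a FC bC by auto
    have "x \<ominus> a \<otimes> b d \<in> fspan F b d"
    proof (rule Suc.IH)
      show "x \<ominus> a \<otimes> b d \<in> B"
        using Suc.prems a F_B b(1)[of d] by (intro subring_minus[OF B] sub(6)) auto
      show "(L ^^ d) (x \<ominus> a \<otimes> b d) = \<zero>"
        using a(2) xC lin'[OF a(1)] additive_map_diff[OF am] additive_map_closed[OF am] by simp
    qed (use Suc.prems in simp)
    moreover have "x = a \<otimes> b d \<oplus> (x \<ominus> a \<otimes> b d)"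
      using xC diff_add_cancel[of x "a \<otimes> b d"] by (simp add: a_comm)
    ultimately show ?case
      unfolding fspan_Suc_iff using a(1) by blast
  qed simp
  show 2: "(L ^^ d) x = \<zero>" if "d \<le> m" "x \<in> fspan F b d" for d x
    using that
  proof (induction d arbitrary: x)
    case (Suc d)
    obtain a y where *: "a \<in> F" "y \<in> fspan F b d" "x = a \<otimes> b d \<oplus> y"
      using Suc.prems(2) unfolding fspan_Suc_iff by blast
    have k: "a \<in> carrier R" "b d \<in> carrier R" "y \<in> carrier R"
      using * FC bC fspan_subset_carrier[OF F', of d b] Suc.prems(1) by auto
    have "(L ^^ d) x = a \<otimes> (L ^^ d) (b d)"
      using * Suc k lin' am by (simp add: additive_map_add additive_map_closed)
    then have "(L ^^ d) x \<in> F"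
      using * b(2)[of d] Suc.prems subringE(6)[OF F'] by auto
    then show ?case using ker[of "(L ^^ d) x"] F_B by auto
  qed simp
  show "dimension d F (fspan F b d)" if "d \<le> m"
  proof (rule dimension_fspan)
    \<comment> \<open>\<open>L ^^ i\<close> kills the span of the first \<open>i\<close> vectors but
      not \<open>b i\<close>.\<close>
    show "b i \<notin> fspan F b i" if "i < d" for i
      using 2[of i "b i"] b(2)[of i] that \<open>d \<le> m\<close> by auto
  qed (use bC that in auto)
qed

text \<open>\<open>L\<close> is a derivation twisted by \<open>r\<close>, with \<open>y\<close> as
  the variable. It is applied to \<open>ad q\<close> with \<open>r\<close> the identity, and to
  \<open>dl s\<close> with \<open>r\<close> the conjugation by \<open>s\<close>.\<close>

lemma funpow_power_fact:
  assumes L: "additive_map L" and r: "additive_map r" and y: "y \<in> carrier R"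
    and comm: "\<And>x. x \<in> carrier R \<Longrightarrow> L (r x) = r (L x)"
    and prod: "\<And>x. x \<in> carrier R \<Longrightarrow> L (y \<otimes> x) = y \<otimes> L x \<oplus> r x"
    and one: "r \<one> = \<one>" "L \<one> = \<zero>"
  shows "(L ^^ k) (y [^] k) = [(fact k :: nat)] \<cdot> \<one>"
proof -
  have am: "additive_map (L ^^ k)" for k
    using additive_map_funpow[OF L] .
  have comm': "(L ^^ m) (r x) = r ((L ^^ m) x)" if "x \<in> carrier R" for m x
    using funpow_commute_on[OF L r comm that] .
  have step: "(L ^^ Suc m) (y \<otimes> x) = y \<otimes> (L ^^ Suc m) x \<oplus> [Suc m] \<cdot> r ((L ^^ m) x)"
    if x: "x \<in> carrier R" for m x
  proof (induction m)
    case 0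
    then show ?case using prod x r by simp
  next
    case (Suc m)
    have c: "(L ^^ k) x \<in> carrier R" for k using am x by blast
    have "(L ^^ Suc (Suc m)) (y \<otimes> x) = L (y \<otimes> (L ^^ Suc m) x \<oplus> [Suc m] \<cdot> r ((L ^^ m) x))"
      using Suc by simp
    also have "\<dots> = (y \<otimes> (L ^^ Suc (Suc m)) x \<oplus> r ((L ^^ Suc m) x)) \<oplus> [Suc m] \<cdot> r ((L ^^ Suc m) x)"
      using c[of m] c[of "Suc m"] y r L comm[of "(L ^^ m) x"] prod[of "(L ^^ Suc m) x"]
      by (simp add: additive_map_add[OF L] additive_map_add_pow[OF L] del: add.nat_pow_Suc)
    also have "\<dots> = y \<otimes> (L ^^ Suc (Suc m)) x \<oplus> [Suc (Suc m)] \<cdot> r ((L ^^ Suc m) x)"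
      using c[of "Suc m"] c[of "Suc (Suc m)"] y r
      by (simp add: a_ac add.nat_pow_Suc[where n = "Suc m"] del: add.nat_pow_Suc funpow.simps)
    finally show ?case .
  qed
  show ?thesis
  proof (induction k)
    case (Suc k)
    have "L ((L ^^ k) (y [^] k)) = \<zero>"
      using Suc additive_map_add_pow[OF L, of \<one>] one by simp
    then have "(L ^^ Suc k) (y \<otimes> y [^] k) = [Suc k] \<cdot> r ([(fact k :: nat)] \<cdot> \<one>)"
      using step[of "y [^] k" k] Suc y additive_map_closed[OF r] by simp
    also have "\<dots> = [(Suc k * fact k :: nat)] \<cdot> \<one>"
      by (simp only: additive_map_add_pow[OF r one_closed] one add_pow_mult[OF one_closed])
    finally show ?case
      using y by (simp only: nat_pow_Suc2 fact_Suc of_nat_id)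
  qed simp
qed

end

section \<open>Division rings of prime characteristic\<close>

locale char_p_division_ring = char_p_ring +
  assumes Units_eq: "Units R = carrier R - {\<zero>}"
begin

lemma one_not_zero [simp]: "\<one> \<noteq> \<zero>"
  using Units_one_closed Units_eq by blast

lemma inv_nonzero:
  assumes "x \<in> carrier R" "x \<noteq> \<zero>"
  shows "inv x \<in> carrier R" "x \<otimes> inv x = \<one>" "inv x \<otimes> x = \<one>" "inv x \<noteq> \<zero>"
proof -
  have x: "x \<in> Units R" using assms Units_eq by blast
  show "inv x \<in> carrier R" "x \<otimes> inv x = \<one>" "inv x \<otimes> x = \<one>"
    using x by simp_all
  then show "inv x \<noteq> \<zero>" using assms by force
qed

lemma integral:
  assumes "x \<in> carrier R" "y \<in> carrier R" "x \<otimes> y = \<zero>" shows "x = \<zero> \<or> y = \<zero>"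
proof (rule disjCI)
  assume "y \<noteq> \<zero>"
  note inv = inv_nonzero[OF assms(2) this]
  have "x \<otimes> (y \<otimes> inv y) = x \<otimes> y \<otimes> inv y"
    using assms(1,2) inv by (simp only: m_assoc)
  then show "x = \<zero>" using assms inv by simp
qed

lemma pow_nonzero: "x \<in> carrier R \<Longrightarrow> x \<noteq> \<zero> \<Longrightarrow> x [^] (n::nat) \<noteq> \<zero>"
  by (induction n) (auto dest: integral[rotated 2])

lemma add_pow_nonzero:
  assumes "x \<in> carrier R" "x \<noteq> \<zero>" "\<not> p dvd n" shows "[n] \<cdot> x \<noteq> \<zero>"
  using add_pow_inverse[OF assms(3)] assms(1,2) by (metis add.nat_pow_one)

lemma cent_inv:
  assumes "Y \<subseteq> carrier R" "x \<in> cent Y" "x \<noteq> \<zero>" shows "inv x \<in> cent Y"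
proof (rule centI)
  have x: "x \<in> carrier R" using assms by blast
  note inv = inv_nonzero[OF x assms(3)]
  show "inv x \<in> carrier R" by (rule inv)
  fix y assume y: "y \<in> Y"
  then have yC: "y \<in> carrier R" using assms by blast
  have "inv x \<otimes> y = inv x \<otimes> (y \<otimes> x) \<otimes> inv x"
    using x yC inv by (simp add: m_assoc)
  also have "\<dots> = inv x \<otimes> (x \<otimes> y) \<otimes> inv x"
    using centD[OF assms(2) y] by simp
  also have "\<dots> = y \<otimes> inv x"
    using x yC inv by (simp add: m_assoc[symmetric])
  finally show "inv x \<otimes> y = y \<otimes> inv x" .
qed

text \<open>In a division ring a centralizer contains the inverses of its nonzero elements, so only
  commutativity is missing for a field.\<close>

lemma subfield_cent:
  assumes Y: "Y \<subseteq> carrier R" and comm: "\<And>a b. a \<in> cent Y \<Longrightarrow> b \<in> cent Y \<Longrightarrow> a \<otimes> b = b \<otimes> a"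
  shows "subfield (cent Y) R"
proof (rule subfieldI)
  show "subcring (cent Y) R"
    using subring_cent[OF Y] comm by (rule subcringI)
  show "Units (R\<lparr>carrier := cent Y\<rparr>) = cent Y - {\<zero>}"
  proof (intro equalityI subsetI)
    fix x assume "x \<in> Units (R\<lparr>carrier := cent Y\<rparr>)"
    then obtain y where "x \<in> cent Y" "y \<in> cent Y" "x \<otimes> y = \<one>"
      by (auto simp: Units_def)
    moreover from this have "x \<noteq> \<zero>"
      using l_null[of y] cent_carrier[of y Y] one_not_zero by metis
    ultimately show "x \<in> cent Y - {\<zero>}" by blast
  next
    fix x assume x: "x \<in> cent Y - {\<zero>}"
    then show "x \<in> Units (R\<lparr>carrier := cent Y\<rparr>)"
      using cent_inv[OF Y, of x] inv_nonzero[of x] cent_carrier[of x Y] by (auto simp: Units_def)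
  qed
qed

text \<open>A commuting set lies in its centralizer, hence so does its double centralizer, which is
  therefore commutative. It stands in for the subfield generated by \<open>Y\<close>.\<close>

lemma subfield_bicommutant:
  assumes Y: "Y \<subseteq> carrier R" and comm: "\<And>a b. a \<in> Y \<Longrightarrow> b \<in> Y \<Longrightarrow> a \<otimes> b = b \<otimes> a"
  shows "subfield (cent (cent Y)) R"
proof (rule subfield_cent[OF cent_subset_carrier])
  have "Y \<subseteq> cent Y" using Y comm by (auto simp: cent_def)
  then have "cent (cent Y) \<subseteq> cent Y" by (rule cent_antimono)
  then show "a \<otimes> b = b \<otimes> a" if "a \<in> cent (cent Y)" "b \<in> cent (cent Y)" for a b
    using that centD by blast
qed

subsection \<open>Conjugation\<close>

definition conj :: "'a \<Rightarrow> 'a \<Rightarrow> 'a" where "conj s x = s \<otimes> x \<otimes> inv s"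

text \<open>For \<open>s\<close> = \<open>t\<close> this is the operator \<sigma> - 1 of the
  overview.\<close>

definition dl :: "'a \<Rightarrow> 'a \<Rightarrow> 'a" where "dl s x = conj s x \<ominus> x"

context
  fixes s assumes s [simp]: "s \<in> carrier R" and s_nz [simp]: "s \<noteq> \<zero>"
begin

lemmas inv_s [simp] = inv_nonzero[OF s s_nz]

lemma conj_closed [simp]: "x \<in> carrier R \<Longrightarrow> conj s x \<in> carrier R"
  by (simp add: conj_def)

lemma additive_map_conj: "additive_map (conj s)"
  by (rule additive_mapI) (simp_all add: conj_def l_distr r_distr)

lemma conj_mult:
  assumes "x \<in> carrier R" "y \<in> carrier R" shows "conj s (x \<otimes> y) = conj s x \<otimes> conj s y"
proof -
  have "conj s x \<otimes> conj s y = s \<otimes> x \<otimes> (inv s \<otimes> s) \<otimes> y \<otimes> inv s"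
    unfolding conj_def using assms by (simp add: m_assoc del: inv_s(3))
  then show ?thesis
    using assms by (simp add: conj_def m_assoc)
qed

lemma conj_one: "conj s \<one> = \<one>"
  by (simp add: conj_def)

lemma conj_eq_iff:
  assumes "x \<in> carrier R" "y \<in> carrier R" shows "conj s x = y \<longleftrightarrow> s \<otimes> x = y \<otimes> s"
proof
  assume "conj s x = y"
  then have "y \<otimes> s = s \<otimes> x \<otimes> (inv s \<otimes> s)"
    using assms by (simp add: conj_def m_assoc del: inv_s(3) flip: \<open>conj s x = y\<close>)
  then show "s \<otimes> x = y \<otimes> s" using assms by simp
next
  assume "s \<otimes> x = y \<otimes> s"
  then show "conj s x = y" using assms by (simp add: conj_def m_assoc)
qed

lemma conj_fixed_iff: "x \<in> carrier R \<Longrightarrow> conj s x = x \<longleftrightarrow> s \<otimes> x = x \<otimes> s"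
  by (rule conj_eq_iff)

lemma conj_pow: "x \<in> carrier R \<Longrightarrow> conj s (x [^] (n::nat)) = conj s x [^] n"
  by (induction n) (simp_all add: conj_one conj_mult)

lemma conj_conj:
  assumes "t \<in> carrier R" "t \<noteq> \<zero>" "x \<in> carrier R"
  shows "conj s (conj t x) = conj (s \<otimes> t) x"
proof -
  have "inv (s \<otimes> t) = inv t \<otimes> inv s"
  proof (rule inv_char)
    note t = inv_nonzero[OF assms(1,2)]
    show "s \<otimes> t \<otimes> (inv t \<otimes> inv s) = \<one>" "inv t \<otimes> inv s \<otimes> (s \<otimes> t) = \<one>"
      using assms t r_one l_one by (simp_all only: m_assoc[symmetric] m_closed inv_s s)
        (simp_all add: m_assoc assms(1) t flip: m_assoc[of _ t] m_assoc[of _ "inv s" s])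
  qed (use assms inv_nonzero[of t] in auto)
  then show ?thesis
    using assms inv_nonzero[of t] by (simp add: conj_def m_assoc)
qed

lemma funpow_conj:
  assumes "x \<in> carrier R" shows "(conj s ^^ n) x = conj (s [^] n) x"
proof (induction n)
  case 0
  have "inv \<one> = \<one>" by simp
  then show ?case using assms by (simp add: conj_def)
next
  case (Suc n)
  then show ?case
    using conj_conj[of "s [^] n" x] assms pow_nonzero[of s n]
    by (simp add: nat_pow_Suc2[symmetric] del: nat_pow_Suc)
qed

lemma additive_map_dl: "additive_map (dl s)"
proof -
  have "additive_map (\<lambda>x. x)" by (rule additive_mapI) auto
  from additive_map_minus[OF additive_map_conj this] show ?thesis
    unfolding dl_def .
qed

lemma dl_closed [simp]: "x \<in> carrier R \<Longrightarrow> dl s x \<in> carrier R"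
  by (simp add: dl_def)

lemma dl_eq_zero_iff: "x \<in> carrier R \<Longrightarrow> dl s x = \<zero> \<longleftrightarrow> s \<otimes> x = x \<otimes> s"
  using conj_fixed_iff by (auto simp: dl_def)

lemma conj_eq_add_dl: "x \<in> carrier R \<Longrightarrow> conj s x = x \<oplus> dl s x"
  using diff_add_cancel[of "conj s x" x] by (simp add: dl_def a_comm)

lemma dl_conj: "x \<in> carrier R \<Longrightarrow> dl s (conj s x) = conj s (dl s x)"
  using additive_map_diff[OF additive_map_conj] by (simp add: dl_def)

lemma dl_mult:
  assumes "x \<in> carrier R" "y \<in> carrier R"
  shows "dl s (x \<otimes> y) = x \<otimes> dl s y \<oplus> dl s x \<otimes> conj s y"
proof -
  have "x \<otimes> dl s y \<oplus> dl s x \<otimes> conj s y = (x \<otimes> conj s y \<ominus> x \<otimes> y) \<oplus> (conj s x \<otimes> conj s y \<ominus> x \<otimes> conj s y)"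
    using assms by (simp add: dl_def minus_eq l_distr r_distr l_minus r_minus)
  also have "\<dots> = conj s x \<otimes> conj s y \<ominus> x \<otimes> y"
    using assms conj_closed[of x] conj_closed[of y] by algebra
  finally show ?thesis using assms by (simp add: dl_def conj_mult)
qed

lemma dl_lin:
  assumes "a \<in> carrier R" "x \<in> carrier R" "s \<otimes> a = a \<otimes> s"
  shows "dl s (a \<otimes> x) = a \<otimes> dl s x"
  using dl_mult[OF assms(1,2)] dl_eq_zero_iff[OF assms(1)] assms by simp

lemma funpow_dl_lin:
  assumes "a \<in> carrier R" "x \<in> carrier R" "s \<otimes> a = a \<otimes> s"
  shows "(dl s ^^ k) (a \<otimes> x) = a \<otimes> (dl s ^^ k) x"
proof (induction k)
  case (Suc k)
  then show ?case
    using dl_lin[OF assms(1) _ assms(3)] additive_map_funpow[OF additive_map_dl, of k] assms by simp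
qed simp

text \<open>Powers of a conjugation are conjugations by powers, so \<open>funpow_minus_id\<close>
  turns vanishing of a p^k-th iterate into commuting with s^(p^k).\<close>

lemma funpow_dl_pk:
  assumes "x \<in> carrier R" shows "(dl s ^^ (p ^ k)) x = dl (s [^] (p ^ k)) x"
proof -
  have "dl s = (\<lambda>x. conj s x \<ominus> x)" by (auto simp: dl_def)
  then show ?thesis
    using funpow_minus_id[OF additive_map_conj assms, of k] assms
    by (simp add: funpow_conj dl_def)
qed

lemma funpow_dl_power:
  assumes "y \<in> carrier R" "dl s y = \<one>"
  shows "(dl s ^^ k) (y [^] k) = [(fact k :: nat)] \<cdot> \<one>"
  by (rule funpow_power_fact[where r = "conj s"])
    (use assms in \<open>auto simp: additive_map_dl additive_map_conj dl_conj dl_mult conj_one dl_eq_zero_iff\<close>)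

text \<open>If \<open>Suc k\<close> iterations kill \<open>z\<close>, subtract a multiple of a
  member of the chain of \<open>v\<close> that has the same \<open>k\<close>-th iterate. The
  multiple is itself an image, and the rest is killed by \<open>k\<close> iterations. So a chain of
  length \<open>N\<close> down to \<open>\<one>\<close> solves \<open>dl s z' = z\<close> for every
  \<open>z\<close> of \<open>B\<close> killed by \<open>N\<close> iterations.\<close>

lemma dl_image:
  assumes B: "subring B R" and dl_B: "\<And>x. x \<in> B \<Longrightarrow> dl s x \<in> B"
    and v: "v \<in> B" "(dl s ^^ N) v = \<one>"
  shows "z \<in> B \<Longrightarrow> (dl s ^^ k) z = \<zero> \<Longrightarrow> k \<le> N \<Longrightarrow> \<exists>z' \<in> B. dl s z' = z"
proof (induction k arbitrary: z)
  case 0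
  have "dl s \<zero> = \<zero>" using additive_map_zero[OF additive_map_dl] .
  then show ?case using 0 subringE(2)[OF B] by auto
next
  case (Suc k)
  have BC: "x \<in> B \<Longrightarrow> x \<in> carrier R" for x using subringE(1)[OF B] by blast
  have pow_B: "(dl s ^^ k) x \<in> B" if "x \<in> B" for x k
    by (induction k) (use that dl_B in auto)
  \<comment> \<open>\<open>t\<close> commutes with \<open>s\<close>, so \<open>dl s\<close> is
    linear in this left factor. \<open>w\<close> reaches \<open>\<one>\<close> after
    \<open>k\<close> steps, and \<open>w'\<close> is one step above \<open>w\<close>, which needs
    \<open>Suc k \<le> N\<close>.\<close>
  define t where "t = (dl s ^^ k) z"
  define w where "w = (dl s ^^ (N - k)) v"
  define w' where "w' = (dl s ^^ (N - Suc k)) v"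
  have B': "t \<in> B" "w \<in> B" "w' \<in> B"
    using pow_B Suc.prems v by (auto simp: t_def w_def w'_def)
  note C = B'[THEN BC] Suc.prems(1)[THEN BC]
  have st: "s \<otimes> t = t \<otimes> s"
    using Suc.prems(2) C dl_eq_zero_iff[of t] by (simp add: t_def)
  have w1: "(dl s ^^ k) w = \<one>"
    using v(2) Suc.prems(3) by (simp add: w_def flip: funpow_add[unfolded comp_def, THEN fun_cong])
  have w2: "dl s w' = w"
    using Suc.prems(3) by (simp add: w_def w'_def Suc_diff_Suc flip: funpow.simps(2)[unfolded comp_def, THEN fun_cong])
  have "\<exists>z' \<in> B. dl s z' = z \<ominus> t \<otimes> w"
  proof (rule Suc.IH)
    show "z \<ominus> t \<otimes> w \<in> B"
      using Suc.prems B' by (intro subring_minus[OF B] subringE(6)[OF B])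
    have "(dl s ^^ k) (z \<ominus> t \<otimes> w) = (dl s ^^ k) z \<ominus> t \<otimes> (dl s ^^ k) w"
      using C additive_map_diff[OF additive_map_funpow[OF additive_map_dl]] funpow_dl_lin[OF _ _ st]
      by simp
    then show "(dl s ^^ k) (z \<ominus> t \<otimes> w) = \<zero>"
      using C w1 by (simp add: t_def[symmetric])
  qed (use Suc.prems in simp)
  then obtain z' where z': "z' \<in> B" "dl s z' = z \<ominus> t \<otimes> w" by blast
  have "dl s (z' \<oplus> t \<otimes> w') = z"
    using z' BC C dl_lin[OF _ _ st, of w'] w2
    by (simp add: additive_map_add[OF additive_map_dl] diff_add_cancel)
  moreover have "z' \<oplus> t \<otimes> w' \<in> B"
    using z' B' by (intro subringE(6,7)[OF B])
  ultimately show ?case by blast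
qed

end

subsection \<open>Weights under an inner derivation\<close>

definition weight :: "'a \<Rightarrow> nat \<Rightarrow> 'a \<Rightarrow> bool" where
  "weight a i h \<longleftrightarrow> h \<in> carrier R \<and> ad a h = [i] \<cdot> h"

text \<open>The projection onto the weights divisible by \<open>p\<close>; it maps onto the centralizer of \<open>a\<close> wherever
  \<open>ad a\<close> is its own \<open>p\<close>-th power.\<close>

definition wproj :: "'a \<Rightarrow> 'a \<Rightarrow> 'a" where
  "wproj a x = x \<ominus> (ad a ^^ (p - 1)) x"

context
  fixes a assumes a [simp]: "a \<in> carrier R"
begin

lemma additive_map_wproj: "additive_map (wproj a)"
proof -
  have "additive_map (\<lambda>x. x)" by (rule additive_mapI) auto
  from additive_map_minus[OF this additive_map_funpow[OF additive_map_ad[OF a], of "p - 1"]] show ?thesis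
    unfolding wproj_def .
qed

lemma weight_funpow: "weight a i h \<Longrightarrow> (ad a ^^ k) h = [(i ^ k)] \<cdot> h"
proof (induction k)
  case (Suc k)
  then have "(ad a ^^ Suc k) h = [(i ^ k)] \<cdot> ([i] \<cdot> h)"
    using additive_map_add_pow[OF additive_map_ad[OF a], of h] by (simp add: weight_def)
  then show ?case
    using Suc.prems by (simp add: weight_def add.nat_pow_pow)
qed (simp add: weight_def)

text \<open>By Fermat, i^(p - 1) acts as 0 or 1 according to whether \<open>p\<close> divides
  \<open>i\<close>.\<close>

lemma wproj_weight:
  assumes "weight a i h" shows "wproj a h = (if p dvd i then h else \<zero>)"
proof -
  have h: "h \<in> carrier R" using assms by (simp add: weight_def)
  show ?thesis
  proof (cases "p dvd i")
    case True
    then have "p dvd i ^ (p - 1)" using p_ge_2 by (simp add: dvd_power_le dvd_trans)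
    then show ?thesis
      using True h weight_funpow[OF assms, of "p - 1"] dvd_add_pow[OF h]
      by (simp add: wproj_def minus_eq)
  next
    case False
    then show ?thesis
      using h weight_funpow[OF assms, of "p - 1"] add_pow_fermat'[OF h False]
      by (simp add: wproj_def)
  qed
qed

lemma weight_0_iff: "weight a 0 h \<longleftrightarrow> h \<in> carrier R \<and> a \<otimes> h = h \<otimes> a"
  using ad_eq_zero_iff[OF a] by (auto simp: weight_def)

lemma weight_mult:
  assumes "weight a i x" "weight a k y" shows "weight a (i + k) (x \<otimes> y)"
  using assms ad_mult[OF a, of x y]
  by (simp add: weight_def add_pow_ldistr add_pow_rdistr add.nat_pow_mult)

lemma weight_power:
  assumes "weight a i x" shows "weight a (k * i) (x [^] k)"
proof (induction k)
  case 0
  show ?case by (simp add: weight_0_iff)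
next
  case (Suc k)
  then show ?case using weight_mult[OF Suc assms] by (simp add: add.commute)
qed

text \<open>The mixed terms of a \<open>k\<close>-th power of y + z have this form; for
  \<open>k\<close> = \<open>p\<close> no weight occurring here is divisible by \<open>p\<close>, so
  \<open>wproj\<close> kills them.\<close>

inductive_set wsum :: "nat \<Rightarrow> 'a set" for k where
  zero: "\<zero> \<in> wsum k"
| add: "weight a i h \<Longrightarrow> 0 < i \<Longrightarrow> i < k \<Longrightarrow> x \<in> wsum k \<Longrightarrow> h \<oplus> x \<in> wsum k"

lemma wsum_carrier: "x \<in> wsum k \<Longrightarrow> x \<in> carrier R"
  by (induction rule: wsum.induct) (auto simp: weight_def)

lemma wsum_add: "x \<in> wsum k \<Longrightarrow> y \<in> wsum k \<Longrightarrow> x \<oplus> y \<in> wsum k"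
proof (induction rule: wsum.induct)
  case zero
  then show ?case using wsum_carrier by simp
next
  case (add i h x)
  then have "h \<oplus> x \<oplus> y = h \<oplus> (x \<oplus> y)"
    using wsum_carrier by (simp add: weight_def a_assoc)
  then show ?case using add wsum.add by simp
qed

lemma wsum_mult:
  assumes x: "x \<in> wsum k" and y: "weight a i y" and i: "i \<le> 1"
  shows "y \<otimes> x \<in> wsum (Suc k)"
  using x
proof (induction rule: wsum.induct)
  case zero
  then show ?case using y wsum.zero by (simp add: weight_def)
next
  case (add l h x)
  have "y \<otimes> (h \<oplus> x) = y \<otimes> h \<oplus> y \<otimes> x"
    using add wsum_carrier y by (simp add: weight_def r_distr)
  then show ?case
    using wsum.add[OF weight_mult[OF y add.hyps(1)], of "Suc k"] add i by auto
qed

lemma wproj_wsum: "x \<in> wsum p \<Longrightarrow> wproj a x = \<zero>"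
proof (induction rule: wsum.induct)
  case zero
  then show ?case using additive_map_zero[OF additive_map_wproj] .
next
  case (add i h x)
  then have "\<not> p dvd i" by (auto dest: dvd_imp_le)
  then show ?case
    using add wproj_weight[OF add.hyps(1)] wsum_carrier[OF add.hyps(4)] additive_map_add[OF additive_map_wproj]
    by (simp add: weight_def)
qed

text \<open>The weight of a word in \<open>y\<close> and \<open>z\<close> is its number of letters
  \<open>z\<close>, so only the two pure powers fall outside \<open>wsum\<close>.\<close>

lemma power_add_weights:
  assumes y: "weight a 0 y" and z: "weight a 1 z"
  shows "\<exists>h \<in> wsum (Suc k). (y \<oplus> z) [^] Suc k = y [^] Suc k \<oplus> z [^] Suc k \<oplus> h"
proof (induction k)
  case 0
  show ?case
    using y z by (intro bexI[OF _ wsum.zero]) (simp_all add: weight_def)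
next
  case (Suc k)
  let ?n = "Suc k"
  obtain h where h: "h \<in> wsum ?n" "(y \<oplus> z) [^] ?n = y [^] ?n \<oplus> z [^] ?n \<oplus> h"
    using Suc by blast
  have c [simp]: "y \<in> carrier R" "z \<in> carrier R" "h \<in> carrier R"
    using y z h wsum_carrier by (auto simp: weight_def)
  have yn: "weight a 0 (y [^] ?n)" and zn: "weight a ?n (z [^] ?n)"
    using weight_power[OF y, of ?n] weight_power[OF z, of ?n] by simp_all
  define r where "r = y \<otimes> z [^] ?n \<oplus> (z \<otimes> y [^] ?n \<oplus> (y \<otimes> h \<oplus> z \<otimes> h))"
  have "y \<otimes> h \<oplus> z \<otimes> h \<in> wsum (Suc ?n)"
    using wsum_mult[OF h(1) y] wsum_mult[OF h(1) z] by (intro wsum_add) auto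
  then have r: "r \<in> wsum (Suc ?n)"
    unfolding r_def using weight_mult[OF y zn] weight_mult[OF z yn]
    by (intro wsum.add[of _ "y \<otimes> z [^] ?n"] wsum.add[of _ "z \<otimes> y [^] ?n"]) auto
  have "(y \<oplus> z) [^] Suc ?n = (y \<oplus> z) \<otimes> (y [^] ?n \<oplus> z [^] ?n \<oplus> h)"
    by (subst nat_pow_Suc2) (use h in auto)
  also have "\<dots> = y \<otimes> y [^] ?n \<oplus> z \<otimes> z [^] ?n \<oplus> r"
    using c nat_pow_closed[of y ?n] nat_pow_closed[of z ?n] unfolding r_def
    by (simp add: l_distr r_distr a_ac del: nat_pow_Suc)
  also have "\<dots> = y [^] Suc ?n \<oplus> z [^] Suc ?n \<oplus> r"
    by (subst (2 4) nat_pow_Suc2) auto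
  finally show ?case using r by blast
qed

end

text \<open>The case of Jacobson's formula for \<open>p\<close>-th powers in which the commutator of the two summands
  is a multiple of one of them.\<close>

lemma frobenius_twisted:
  assumes y: "y \<in> carrier R" and z: "z \<in> carrier R" "z \<noteq> \<zero>"
    and tw: "z \<otimes> y = (y \<oplus> \<one>) \<otimes> z"
  shows "(y \<oplus> z) [^] p = y [^] p \<oplus> z [^] p \<oplus> z"
proof -
  \<comment> \<open>With this sign \<open>y\<close> has weight 0 and \<open>z\<close> has weight
    1.\<close>
  define a where "a = \<ominus> y"
  have a: "a \<in> carrier R" using y by (simp add: a_def)
  have ady: "ad a y = \<zero>" using y by (simp add: a_def ad_def l_minus r_minus minus_eq l_neg)
  have adz: "ad a z = z"
  proof -
    have "ad a z = z \<otimes> y \<ominus> y \<otimes> z"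
      using y z by (simp add: a_def ad_def l_minus r_minus minus_eq a_comm)
    also have "\<dots> = z"
      unfolding tw using y z by (simp add: l_distr a_comm[of "y \<otimes> z"] add_diff_cancel)
    finally show ?thesis .
  qed
  have wy: "weight a 0 y" and wz: "weight a 1 z"
    using y z ady adz by (auto simp: weight_def)
  define u where "u = y \<oplus> z"
  have u: "u \<in> carrier R" using y z by (simp add: u_def)
  obtain h where h: "h \<in> wsum a p" "u [^] p = y [^] p \<oplus> z [^] p \<oplus> h"
    using power_add_weights[OF a wy wz, of "p - 1"] p_ge_2 by (auto simp: u_def)
  have hC: "h \<in> carrier R" using wsum_carrier[OF a h(1)] .
  \<comment> \<open>Conjugation by \<open>z\<close> moves \<open>u\<close> to u + 1 and thus fixes
    u^p - u. This element also commutes with \<open>u\<close>, hence with y = u - z, and so has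
    weight 0.\<close>
  have "conj z u = u \<oplus> \<one>"
    using conj_eq_iff[OF z u] tw y z by (simp add: u_def l_distr r_distr a_ac)
  then have "conj z (u [^] p \<ominus> u) = (u \<oplus> \<one>) [^] p \<ominus> (u \<oplus> \<one>)"
    using additive_map_diff[OF additive_map_conj[OF z]] conj_pow[OF z] u by simp
  also have "\<dots> = (u [^] p \<oplus> \<one>) \<ominus> (u \<oplus> \<one>)"
    using frobenius_add[OF u one_closed] u by simp
  also have "\<dots> = u [^] p \<ominus> u"
    using u nat_pow_closed[OF u, of p] one_closed by algebra
  finally have gz: "z \<otimes> (u [^] p \<ominus> u) = (u [^] p \<ominus> u) \<otimes> z"
    using conj_fixed_iff[OF z] u by simp
  have gu: "u \<otimes> (u [^] p \<ominus> u) = (u [^] p \<ominus> u) \<otimes> u"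
    using u pow_commute[OF u u, of p] by (simp add: minus_eq l_distr r_distr l_minus r_minus)
  have "a = \<ominus> (u \<ominus> z)"
    using y z by (simp add: a_def u_def add_diff_cancel)
  moreover have "\<ominus> (u \<ominus> z) \<otimes> g = g \<otimes> \<ominus> (u \<ominus> z)"
    if "g \<in> carrier R" "z \<otimes> g = g \<otimes> z" "u \<otimes> g = g \<otimes> u" for g
    using that u z(1) by (simp add: minus_eq l_distr r_distr l_minus r_minus)
  ultimately have "a \<otimes> (u [^] p \<ominus> u) = (u [^] p \<ominus> u) \<otimes> a"
    using gz gu u by simp
  then have "weight a 0 (u [^] p \<ominus> u)"
    using weight_0_iff[OF a] u by simp
  \<comment> \<open>An element of weight 0 is its own projection. On the other side the mixed terms
    and \<open>z\<close> vanish, while z^p, of weight \<open>p\<close>, survives.\<close>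
  then have "u [^] p \<ominus> u = wproj a (u [^] p \<ominus> u)"
    using wproj_weight[OF a] by simp
  also have "\<dots> = wproj a (y [^] p) \<oplus> wproj a (z [^] p) \<oplus> wproj a h \<ominus> (wproj a y \<oplus> wproj a z)"
    using y z hC additive_map_wproj[OF a] unfolding h(2) unfolding u_def
    by (simp add: additive_map_add additive_map_diff)
  also have "\<dots> = y [^] p \<oplus> z [^] p \<ominus> y"
    using wproj_weight[OF a weight_power[OF a wy, of p]] wproj_weight[OF a weight_power[OF a wz, of p]]
      wproj_weight[OF a wy] wproj_weight[OF a wz] wproj_wsum[OF a h(1)] y z p_ge_2
    by simp
  finally have "u [^] p = y [^] p \<oplus> z [^] p \<ominus> y \<oplus> u"
    using u diff_add_cancel[of "u [^] p" u] by simp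
  also have "\<dots> = y [^] p \<oplus> z [^] p \<oplus> z"
    unfolding u_def using y z nat_pow_closed[OF y, of p] nat_pow_closed[OF z(1), of p] by algebra
  finally show ?thesis unfolding u_def .
qed

end

subsection \<open>Discrete valuations\<close>

context ring
begin

context
  fixes F w assumes w: "discrete_valuation F w"
begin

lemma dval_subfield: "subfield F R"
  using w by (simp add: discrete_valuation_def)

lemma dval_mult: "x \<in> F - {\<zero>} \<Longrightarrow> y \<in> F - {\<zero>} \<Longrightarrow> w (x \<otimes> y) = w x + w y"
  using w by (simp add: discrete_valuation_def)

lemma dval_surj: "\<exists>x \<in> F - {\<zero>}. w x = k"
proof -
  have "k \<in> w ` (F - {\<zero>})" using w by (simp add: discrete_valuation_def)
  then show ?thesis by blast
qed

lemma dval_add_ge: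
  assumes "x \<in> F" "y \<in> F" "val_ge w k x" "val_ge w k y" shows "val_ge w k (x \<oplus> y)"
proof (cases "x = \<zero> \<or> y = \<zero>")
  case True
  then show ?thesis using assms subfieldE(3)[OF dval_subfield] by auto
next
  case False
  then have "val_ge w (min (w x) (w y)) (x \<oplus> y)"
    using assms w by (simp add: discrete_valuation_def)
  then show ?thesis using assms False by (auto simp: val_ge_def)
qed

lemma dval_one: "w \<one> = 0"
  using dval_mult[of \<one> \<one>] subfieldE(3,6)[OF dval_subfield] subringE(3)[OF subfieldE(1)[OF dval_subfield]]
  by simp

lemma dval_inv: "x \<in> F - {\<zero>} \<Longrightarrow> w (inv x) = - w x"
  using dval_mult[of x "inv x"] subfield_m_inv[OF dval_subfield, of x] dval_one by simp

lemma dval_uminus: "x \<in> F - {\<zero>} \<Longrightarrow> w (\<ominus> x) = w x"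
proof -
  assume x: "x \<in> F - {\<zero>}"
  note sub = subringE[OF subfieldE(1)[OF dval_subfield]]
  have m: "\<ominus> \<one> \<in> F - {\<zero>}" "\<ominus> \<one> \<otimes> \<ominus> \<one> = \<one>"
    using sub(3,5) subfieldE(6)[OF dval_subfield] by (auto simp: l_minus r_minus)
  then have "w (\<ominus> \<one>) = 0" using dval_mult[OF m(1,1)] dval_one by simp
  moreover have "\<ominus> x = \<ominus> \<one> \<otimes> x" using x sub(1) by (auto simp: l_minus)
  ultimately show ?thesis using dval_mult[OF m(1) x] by simp
qed

lemma dval_pow: "x \<in> F - {\<zero>} \<Longrightarrow> x [^] n \<in> F - {\<zero>} \<and> w (x [^] (n::nat)) = int n * w x"
proof (induction n)
  case 0
  then show ?case
    using dval_one subringE(3)[OF subfieldE(1)[OF dval_subfield]] subfieldE(6)[OF dval_subfield] by simp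
next
  case (Suc n)
  then have "x [^] n \<otimes> x \<in> F - {\<zero>}"
    using subringE(6)[OF subfieldE(1)[OF dval_subfield]] subfieldE(5)[OF dval_subfield] by auto
  then show ?case using Suc dval_mult[of "x [^] n" x] by (simp add: algebra_simps)
qed

lemma dval_add_less:
  assumes x: "x \<in> F - {\<zero>}" and y: "y \<in> F" and less: "y = \<zero> \<or> w x < w y"
  shows "x \<oplus> y \<in> F - {\<zero>}" "w (x \<oplus> y) = w x"
proof -
  note sub = subringE[OF subfieldE(1)[OF dval_subfield]]
  have C: "x \<in> carrier R" "y \<in> carrier R" using x y sub(1) by auto
  have xy: "x \<oplus> y \<in> F" using x y sub(7) by blast
  show "x \<oplus> y \<in> F - {\<zero>}"
  proof -
    have "x \<oplus> y \<noteq> \<zero>"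
    proof
      assume "x \<oplus> y = \<zero>"
      then have "y = \<ominus> x" using C minus_equality[of y x] by (simp add: a_comm)
      then show False using less dval_uminus[OF x] x C by auto
    qed
    then show ?thesis using xy by blast
  qed
  then have nz: "x \<oplus> y \<noteq> \<zero>" by blast
  have "val_ge w (w x) (x \<oplus> y)"
    using x y less by (intro dval_add_ge) (auto simp: val_ge_def)
  moreover have "\<not> w x < w (x \<oplus> y)"
  proof
    assume *: "w x < w (x \<oplus> y)"
    have "val_ge w (w x + 1) (\<ominus> y)"
    proof (cases "y = \<zero>")
      case False
      then show ?thesis using less dval_uminus[of y] y by (simp add: val_ge_def)
    qed (simp add: val_ge_def)
    then have "val_ge w (w x + 1) ((x \<oplus> y) \<oplus> \<ominus> y)"
      using * xy sub(5)[OF y] by (rule_tac dval_add_ge) (simp_all add: val_ge_def)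
    moreover have "(x \<oplus> y) \<oplus> \<ominus> y = x"
      using C add_diff_cancel[of x y] by (simp add: minus_eq)
    ultimately show False using x by (auto simp: val_ge_def)
  qed
  ultimately show "w (x \<oplus> y) = w x" using nz by (simp add: val_ge_def)
qed

end

end

section \<open>Totally ramified Artin-Schreier extensions\<close>

text \<open>In \<open>F[u]\<close> with \<open>u\<^sup>p - u = \<gamma>\<close> and \<open>w \<gamma> = - j\<close> prime to \<open>p\<close>, the monomials \<open>a u\<^sup>i\<close> with \<open>i < p\<close>
  receive the distinct values \<open>p w a - i j\<close>; the set \<open>level k\<close> of sums of monomials of value at
  least \<open>k\<close> is the \<open>k\<close>-th step of the filtration of the extended valuation.\<close>

locale artin_schreier_pole = char_p_division_ring +
  fixes F :: "'a set" and w :: "'a \<Rightarrow> int" and u g s :: 'a and j :: int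
  assumes w: "discrete_valuation F w"
    and u [simp]: "u \<in> carrier R" and u_F: "\<And>a. a \<in> F \<Longrightarrow> u \<otimes> a = a \<otimes> u"
    and s: "s \<in> carrier R" "s \<noteq> \<zero>" and s_F: "\<And>a. a \<in> F \<Longrightarrow> s \<otimes> a = a \<otimes> s"
    and dl_u: "dl s u = \<one>"
    and u_p: "u [^] p = g \<oplus> u"
    and g: "g \<in> F" "g \<noteq> \<zero>" "w g = - j" and j: "0 < j" "\<not> int p dvd j"
begin

lemma F: "subfield F R" using dval_subfield[OF w] .

lemmas F_ring = subringE[OF subfieldE(1)[OF F]]

lemma FC [simp, intro]: "a \<in> F \<Longrightarrow> a \<in> carrier R" using F_ring(1) by blast

lemma s_nz [simp]: "s \<in> carrier R" "s \<noteq> \<zero>" using s by auto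

definition coef :: "nat \<Rightarrow> int \<Rightarrow> 'a set" where
  "coef d k = {a \<in> F. a = \<zero> \<or> k \<le> int p * w a - int d * j}"

primrec partial_level :: "nat \<Rightarrow> int \<Rightarrow> 'a set" where
  "partial_level 0 k = {\<zero>}"
| "partial_level (Suc d) k = {a \<otimes> u [^] d \<oplus> y | a y. a \<in> coef d k \<and> y \<in> partial_level d k}"

definition level :: "int \<Rightarrow> 'a set" where "level k = partial_level p k"

lemma coef_add: assumes "a \<in> coef d k" "b \<in> coef d k" shows "a \<oplus> b \<in> coef d k"
proof (cases "a = \<zero> \<or> b = \<zero> \<or> a \<oplus> b = \<zero>")
  case True
  then show ?thesis using assms F_ring(7) by (auto simp: coef_def)
next
  case False
  then have ab: "a \<in> F" "b \<in> F" "k \<le> int p * w a - int d * j" "k \<le> int p * w b - int d * j"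
    using assms by (auto simp: coef_def)
  have "val_ge w (min (w a) (w b)) (a \<oplus> b)"
    using ab by (intro dval_add_ge[OF w]) (auto simp: val_ge_def)
  then have "w a \<le> w (a \<oplus> b) \<or> w b \<le> w (a \<oplus> b)"
    using False by (auto simp: val_ge_def)
  then have "int p * w a \<le> int p * w (a \<oplus> b) \<or> int p * w b \<le> int p * w (a \<oplus> b)"
    by (auto intro: mult_left_mono)
  then have "k \<le> int p * w (a \<oplus> b) - int d * j" using ab by auto
  then show ?thesis using ab F_ring(7) by (auto simp: coef_def)
qed

lemma coef_uminus: "a \<in> coef d k \<Longrightarrow> \<ominus> a \<in> coef d k"
  using F_ring(5) dval_uminus[OF w, of a] by (cases "a = \<zero>") (auto simp: coef_def)

lemma coef_zero: "\<zero> \<in> coef d k"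
  using F_ring(2) by (simp add: coef_def)

lemma coef_antimono: "k \<le> l \<Longrightarrow> a \<in> coef d l \<Longrightarrow> a \<in> coef d k"
  by (auto simp: coef_def)

lemma coef_carrier [dest]: "a \<in> coef d k \<Longrightarrow> a \<in> carrier R"
  by (auto simp: coef_def)

lemma partial_level_carrier: "x \<in> partial_level d k \<Longrightarrow> x \<in> carrier R"
  by (induction d arbitrary: x) auto

lemma partial_level_SucI:
  "a \<in> coef d k \<Longrightarrow> y \<in> partial_level d k \<Longrightarrow> a \<otimes> u [^] d \<oplus> y \<in> partial_level (Suc d) k"
  by auto

lemma partial_level_zero: "\<zero> \<in> partial_level d k"
proof (induction d)
  case (Suc d)
  then show ?case using partial_level_SucI[OF coef_zero, of \<zero> d k] by simp
qed simp

lemma partial_level_add: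
  "x \<in> partial_level d k \<Longrightarrow> y \<in> partial_level d k \<Longrightarrow> x \<oplus> y \<in> partial_level d k"
proof (induction d arbitrary: x y)
  case (Suc d)
  obtain a b x' y' where *: "a \<in> coef d k" "b \<in> coef d k" "x' \<in> partial_level d k" "y' \<in> partial_level d k"
    "x = a \<otimes> u [^] d \<oplus> x'" "y = b \<otimes> u [^] d \<oplus> y'"
    using Suc.prems by auto
  have "x \<oplus> y = (a \<oplus> b) \<otimes> u [^] d \<oplus> (x' \<oplus> y')"
    using * partial_level_carrier coef_carrier by (simp add: l_distr a_ac)
  then show ?case using partial_level_SucI[OF coef_add Suc.IH] * by simp
qed simp

lemma partial_level_uminus: "x \<in> partial_level d k \<Longrightarrow> \<ominus> x \<in> partial_level d k"
proof (induction d arbitrary: x)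
  case (Suc d)
  obtain a x' where *: "a \<in> coef d k" "x' \<in> partial_level d k" "x = a \<otimes> u [^] d \<oplus> x'"
    using Suc.prems by auto
  have "\<ominus> x = (\<ominus> a) \<otimes> u [^] d \<oplus> (\<ominus> x')"
    using * partial_level_carrier coef_carrier by (simp add: l_minus minus_add)
  then show ?case using partial_level_SucI[OF coef_uminus Suc.IH] * by simp
qed simp

lemma partial_level_antimono: "k \<le> l \<Longrightarrow> x \<in> partial_level d l \<Longrightarrow> x \<in> partial_level d k"
proof (induction d arbitrary: x)
  case (Suc d)
  then obtain a x' where *: "a \<in> coef d l" "x' \<in> partial_level d l" "x = a \<otimes> u [^] d \<oplus> x'"
    by auto
  then show ?case
    using partial_level_SucI[OF coef_antimono[OF Suc.prems(1)] Suc.IH[OF Suc.prems(1)]] by blast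
qed simp

lemma partial_level_Suc: "x \<in> partial_level d k \<Longrightarrow> x \<in> partial_level (Suc d) k"
proof -
  assume x: "x \<in> partial_level d k"
  then have "x = \<zero> \<otimes> u [^] d \<oplus> x" using partial_level_carrier by simp
  then show ?thesis using partial_level_SucI[OF coef_zero x] by simp
qed

lemma partial_level_mono: "d \<le> e \<Longrightarrow> x \<in> partial_level d k \<Longrightarrow> x \<in> partial_level e k"
  by (induction e rule: dec_induct) (auto simp del: partial_level.simps intro: partial_level_Suc)

lemma monomial_partial_level:
  assumes "a \<in> coef d k" shows "a \<otimes> u [^] d \<in> partial_level (Suc d) k"
proof -
  have "a \<otimes> u [^] d = a \<otimes> u [^] d \<oplus> \<zero>" using assms by auto
  then show ?thesis using partial_level_SucI[OF assms partial_level_zero] by simp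
qed

lemmas level_carrier = partial_level_carrier[of _ p, folded level_def]
lemmas level_zero = partial_level_zero[of p, folded level_def]
lemmas level_add = partial_level_add[of _ p, folded level_def]
lemmas level_uminus = partial_level_uminus[of _ p, folded level_def]
lemmas level_antimono = partial_level_antimono[of _ _ _ p, folded level_def]

lemma level_minus: "x \<in> level k \<Longrightarrow> y \<in> level k \<Longrightarrow> x \<ominus> y \<in> level k"
  by (simp add: minus_eq level_add level_uminus)

text \<open>Exponents from \<open>p\<close> on are reduced by u^p = g + u: u^i becomes g u^(i - p),
  of the same value because g has value - j, plus u^(i - p + 1), of larger value.\<close>

lemma monomial_level: "a \<in> coef i k \<Longrightarrow> a \<otimes> u [^] i \<in> level k"
proof (induction i arbitrary: a rule: less_induct)
  case (less i)
  show ?case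
  proof (cases "i < p")
    case True
    then show ?thesis
      unfolding level_def using monomial_partial_level[OF less.prems]
      by (intro partial_level_mono[of "Suc i" p]) simp_all
  next
    case False
    define l where "l = i - p"
    have i: "i = p + l" using False by (simp add: l_def)
    have aF: "a \<in> F" and aC: "a \<in> carrier R" using less.prems by (auto simp: coef_def)
    have "a \<otimes> u [^] i = a \<otimes> (u [^] p \<otimes> u [^] l)"
      unfolding i by (simp add: nat_pow_mult)
    also have "\<dots> = (a \<otimes> g) \<otimes> u [^] l \<oplus> a \<otimes> u [^] Suc l"
      unfolding u_p using aC g(1) by (subst nat_pow_Suc2) (simp_all add: l_distr r_distr m_assoc)
    finally have eq: "a \<otimes> u [^] i = (a \<otimes> g) \<otimes> u [^] l \<oplus> a \<otimes> u [^] Suc l" .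
    have "(a \<otimes> g) \<otimes> u [^] l \<in> level k"
    proof (rule less.IH)
      show "l < i" using p_ge_2 i by simp
      show "a \<otimes> g \<in> coef l k"
      proof (cases "a = \<zero>")
        case False
        then have "w (a \<otimes> g) = w a - j"
          using dval_mult[OF w, of a g] aF g by simp
        then have "int p * w (a \<otimes> g) - int l * j = int p * w a - int i * j"
          unfolding i by (simp add: right_diff_distrib distrib_right)
        then show ?thesis
          using less.prems F_ring(6)[OF aF g(1)] False unfolding coef_def by auto
      qed (use coef_zero g(1) in simp)
    qed
    moreover have "a \<otimes> u [^] Suc l \<in> level k"
    proof (rule less.IH)
      show "Suc l < i" using p_ge_2 i by simp
      have "int (Suc l) * j \<le> int i * j"
        using p_ge_2 i j(1) by (intro mult_right_mono) auto
      then show "a \<in> coef (Suc l) k"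
        using less.prems unfolding coef_def by auto
    qed
    ultimately show ?thesis unfolding eq by (rule level_add)
  qed
qed

lemma partial_level_induct:
  assumes x: "x \<in> partial_level d k"
    and zero: "P \<zero>"
    and step: "\<And>a i y. i < d \<Longrightarrow> a \<in> coef i k \<Longrightarrow> y \<in> carrier R \<Longrightarrow> P y \<Longrightarrow> P (a \<otimes> u [^] i \<oplus> y)"
  shows "P x"
  using x step
proof (induction d arbitrary: x)
  case (Suc d)
  then obtain a y where *: "a \<in> coef d k" "y \<in> partial_level d k" "x = a \<otimes> u [^] d \<oplus> y"
    by auto
  have "P y" using * Suc by (metis less_SucI)
  then show ?case using Suc.prems(2)[of d a y] * partial_level_carrier by auto
qed (use zero in simp)

lemma u_pow_F: "a \<in> F \<Longrightarrow> u [^] (i::nat) \<otimes> a = a \<otimes> u [^] i"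
  using pow_commute[OF u _ u_F] by auto

text \<open>Reduction to monomials; their products reach degrees beyond \<open>p\<close>, which is
  why \<open>monomial_level\<close> admits all exponents.\<close>

lemma level_mult: "x \<in> level k \<Longrightarrow> y \<in> level l \<Longrightarrow> x \<otimes> y \<in> level (k + l)"
proof -
  assume x: "x \<in> level k" and y: "y \<in> level l"
  have mono: "a \<otimes> u [^] i \<otimes> y \<in> level (k + l)" if a: "a \<in> coef i k" for a i
    using y unfolding level_def
  proof (rule partial_level_induct)
    have "a \<otimes> u [^] i \<otimes> \<zero> = \<zero>" using a by auto
    then show "a \<otimes> u [^] i \<otimes> \<zero> \<in> partial_level p (k + l)"
      using level_zero by (simp add: level_def)
  next
    fix b m y' assume b: "b \<in> coef m l" and y': "y' \<in> carrier R"
      and IH: "a \<otimes> u [^] i \<otimes> y' \<in> partial_level p (k + l)"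
    have ab: "a \<in> F" "b \<in> F" using a b by (auto simp: coef_def)
    have "a \<otimes> u [^] i \<otimes> (b \<otimes> u [^] m) = a \<otimes> (u [^] i \<otimes> b) \<otimes> u [^] m"
      using ab by (simp add: m_assoc)
    also have "\<dots> = (a \<otimes> b) \<otimes> u [^] (i + m)"
      using ab by (simp add: u_pow_F m_assoc nat_pow_mult)
    also have "\<dots> \<in> level (k + l)"
    proof (rule monomial_level)
      show "a \<otimes> b \<in> coef (i + m) (k + l)"
      proof (cases "a = \<zero> \<or> b = \<zero>")
        case False
        then have "w (a \<otimes> b) = w a + w b"
          using dval_mult[OF w] ab by simp
        then show ?thesis
          using a b F_ring(6)[OF ab] False by (auto simp: coef_def algebra_simps)
      qed (use coef_zero ab in auto)
    qed
    finally have "a \<otimes> u [^] i \<otimes> (b \<otimes> u [^] m) \<in> level (k + l)" .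
    then have "a \<otimes> u [^] i \<otimes> (b \<otimes> u [^] m) \<oplus> a \<otimes> u [^] i \<otimes> y' \<in> level (k + l)"
      using IH unfolding level_def by (rule partial_level_add)
    then show "a \<otimes> u [^] i \<otimes> (b \<otimes> u [^] m \<oplus> y') \<in> partial_level p (k + l)"
      using ab y' by (simp add: r_distr level_def)
  qed
  have yC: "y \<in> carrier R" using level_carrier[OF y] .
  show ?thesis
    using x unfolding level_def[of k]
  proof (rule partial_level_induct)
    show "\<zero> \<otimes> y \<in> level (k + l)" using level_zero yC by simp
  next
    fix a i x' assume "a \<in> coef i k" "x' \<in> carrier R" "x' \<otimes> y \<in> level (k + l)"
    then show "(a \<otimes> u [^] i \<oplus> x') \<otimes> y \<in> level (k + l)"
      using mono[of a i] yC level_add coef_carrier by (simp add: l_distr)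
  qed
qed

text \<open>Two monomials of degrees i < d < p with equal values would give p | (d - i) j, so at
  most one monomial has value exactly \<open>k\<close>.\<close>

lemma partial_level_leading:
  "x \<in> partial_level d k \<Longrightarrow> d \<le> p \<Longrightarrow> x \<in> partial_level d (k + 1) \<or>
     (\<exists>a \<in> F - {\<zero>}. \<exists>i<d. int p * w a - int i * j = k \<and> x \<ominus> a \<otimes> u [^] i \<in> partial_level d (k + 1))"
proof (induction d arbitrary: x)
  case (Suc d)
  obtain a y where *: "a \<in> coef d k" "y \<in> partial_level d k" "x = a \<otimes> u [^] d \<oplus> y"
    using Suc.prems by auto
  have C: "a \<in> carrier R" "y \<in> carrier R" using * partial_level_carrier by auto
  note IH = Suc.IH[OF *(2)]
  show ?case
  proof (cases "a \<in> coef d (k + 1)")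
    case True
    show ?thesis
    proof (cases "y \<in> partial_level d (k + 1)")
      case True
      then show ?thesis using * \<open>a \<in> coef d (k + 1)\<close> by auto
    next
      case False
      then obtain b i where b: "b \<in> F - {\<zero>}" "i < d" "int p * w b - int i * j = k"
        "y \<ominus> b \<otimes> u [^] i \<in> partial_level d (k + 1)"
        using IH Suc.prems by auto
      have "x \<ominus> b \<otimes> u [^] i = a \<otimes> u [^] d \<oplus> (y \<ominus> b \<otimes> u [^] i)"
        using C b(1) * by (simp add: minus_eq a_assoc)
      then have "x \<ominus> b \<otimes> u [^] i \<in> partial_level (Suc d) (k + 1)"
        using True b(4) by auto
      then show ?thesis using b by (intro disjI2) (use less_SucI in blast)
    qed
  next
    case False
    then have a: "a \<in> F - {\<zero>}" "int p * w a - int d * j = k"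
      using *(1) by (auto simp: coef_def)
    have y: "y \<in> partial_level d (k + 1)"
    proof (rule ccontr)
      assume "y \<notin> partial_level d (k + 1)"
      then obtain b i where b: "i < d" "int p * w b - int i * j = k"
        using IH Suc.prems by auto
      have "(int d - int i) * j = int p * (w a - w b)"
        using a(2) b(2) by (simp add: algebra_simps)
      then have "int p dvd (int d - int i) * j" by simp
      moreover have "Factorial_Ring.prime (int p)" using prime_p by simp
      ultimately have "int p dvd int d - int i"
        using j(2) prime_dvd_mult_iff by blast
      then show False
        using b(1) Suc.prems(2) zdvd_imp_le[of "int p" "int d - int i"] by auto
    qed
    have "x \<ominus> a \<otimes> u [^] d = y"
      using C * by (simp add: a_comm[of "a \<otimes> u [^] d"] add_diff_cancel)
    then have "x \<ominus> a \<otimes> u [^] d \<in> partial_level (Suc d) (k + 1)"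
      using y partial_level_Suc by simp
    then show ?thesis using a by blast
  qed
qed simp

lemma funpow_dl_small: "i < d \<Longrightarrow> a \<in> F \<Longrightarrow> (dl s ^^ d) (a \<otimes> u [^] i) = \<zero>"
proof -
  assume "i < d" and a: "a \<in> F"
  then have d: "d = d - Suc i + Suc i" by simp
  have "dl s ([(n::nat)] \<cdot> \<one>) = \<zero>" for n
    using additive_map_add_pow[OF additive_map_dl one_closed] dl_eq_zero_iff[of s \<one>] by simp
  then have "(dl s ^^ Suc i) (u [^] i) = \<zero>"
    using funpow_dl_power[OF s u dl_u, of i] by simp
  then have "(dl s ^^ d) (u [^] i) = \<zero>"
    using additive_map_zero[OF additive_map_funpow[OF additive_map_dl[OF s]]]
    by (subst d, subst funpow_add) (simp del: funpow.simps)
  then show ?thesis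
    using funpow_dl_lin[of s a "u [^] i" d] a s_F by simp
qed

lemma partial_level_dl_zero:
  assumes "x \<in> partial_level d k" shows "(dl s ^^ d) x = \<zero>"
  using assms
proof (rule partial_level_induct)
  show "(dl s ^^ d) \<zero> = \<zero>"
    using additive_map_zero[OF additive_map_funpow[OF additive_map_dl]] by simp
next
  fix a i y assume "i < d" "a \<in> coef i k" "y \<in> carrier R" "(dl s ^^ d) y = \<zero>"
  then show "(dl s ^^ d) (a \<otimes> u [^] i \<oplus> y) = \<zero>"
    using additive_map_add[OF additive_map_funpow[OF additive_map_dl], of s "a \<otimes> u [^] i" y d]
      funpow_dl_small[of i d a] by (auto simp: coef_def)
qed

text \<open>The filtration does not collapse: for \<open>d\<close> > 0 the iterate
  \<open>dl s ^^ d\<close> kills \<open>\<one>\<close> and all lower terms but sends a u^d to d! a,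
  so a = 0. What remains is a constant of positive value, and \<open>\<one>\<close> has value
  0.\<close>

lemma one_notin_partial_level: "d \<le> p \<Longrightarrow> \<one> \<notin> partial_level d 1"
proof (induction d)
  case (Suc d)
  show ?case
  proof
    assume "\<one> \<in> partial_level (Suc d) 1"
    then obtain a y where *: "a \<in> coef d 1" "y \<in> partial_level d 1" "\<one> = a \<otimes> u [^] d \<oplus> y"
      by auto
    have C: "a \<in> F" "a \<in> carrier R" "y \<in> carrier R" using * partial_level_carrier by (auto simp: coef_def)
    show False
    proof (cases "d = 0")
      case True
      then have "a = \<one>" using * C by simp
      then show False using *(1) True dval_one[OF w] by (simp add: coef_def)
    next
      case False
      then obtain d' where d: "d = Suc d'" by (cases d) auto
      have "dl s \<one> = \<zero>" using dl_eq_zero_iff[of s \<one>] by simp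
      then have "(dl s ^^ d) \<one> = \<zero>"
        unfolding d funpow_Suc_right using additive_map_zero[OF additive_map_funpow[OF additive_map_dl]] by simp
      moreover have "(dl s ^^ d) \<one> = (dl s ^^ d) (a \<otimes> u [^] d) \<oplus> (dl s ^^ d) y"
        using *(3) C additive_map_add[OF additive_map_funpow[OF additive_map_dl], of s "a \<otimes> u [^] d" y d]
        by simp
      moreover have "(dl s ^^ d) (a \<otimes> u [^] d) = [(fact d :: nat)] \<cdot> a"
        using funpow_dl_lin[of s a "u [^] d" d] funpow_dl_power[OF s u dl_u, of d] C s_F
        by (simp add: add_pow_rdistr)
      ultimately have "[(fact d :: nat)] \<cdot> a = \<zero>"
        using partial_level_dl_zero[OF *(2)] C by simp
      then have "a = \<zero>"
        using add_pow_nonzero[of a "fact d"] not_dvd_fact[of d] Suc.prems C by auto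
      then have "\<one> = y" using *(3) C by simp
      then show False using *(2) Suc by simp
    qed
  qed
qed simp

lemma one_notin_level: "1 \<le> k \<Longrightarrow> \<one> \<notin> level k"
  using one_notin_partial_level[of p] level_antimono[of 1 k \<one>] by (auto simp: level_def)

lemma u_nz: "u \<noteq> \<zero>"
proof
  assume "u = \<zero>"
  then have "dl s u = \<zero>" using additive_map_zero[OF additive_map_dl] by simp
  then show False using dl_u by simp
qed

text \<open>From u (u^(p - 1) - 1) = g the inverse is g^(-1) (u^(p - 1) - 1), with leading value p j
  - (p - 1) j = j.\<close>

lemma inv_u_level: "inv u \<in> level j"
proof -
  have ig: "inv g \<in> F" "w (inv g) = j" "inv g \<noteq> \<zero>" "inv g \<otimes> g = \<one>"
    using subfield_m_inv[OF F, of g] dval_inv[OF w, of g] g by auto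
  have q: "Suc (p - 1) = p" using p_ge_2 by simp
  have "inv g \<otimes> (u [^] (p - 1) \<ominus> \<one>) \<otimes> u = inv g \<otimes> (u [^] p \<ominus> u)"
    using ig(1) nat_pow_Suc[of u "p - 1"] unfolding q by (simp add: minus_eq l_distr l_minus m_assoc)
  also have "\<dots> = \<one>"
    unfolding u_p using g(1) ig by (simp add: add_diff_cancel)
  finally have *: "inv g \<otimes> (u [^] (p - 1) \<ominus> \<one>) \<otimes> u = \<one>" .
  have "inv u = inv g \<otimes> (u [^] (p - 1) \<ominus> \<one>) \<otimes> u \<otimes> inv u"
    unfolding * using inv_nonzero[OF u u_nz] by simp
  also have "\<dots> = inv g \<otimes> u [^] (p - 1) \<ominus> inv g \<otimes> u [^] (0::nat)"
    using ig(1) inv_nonzero[OF u u_nz] by (simp add: m_assoc minus_eq r_distr r_minus)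
  also have "\<dots> \<in> level j"
  proof (intro level_minus monomial_level)
    have "int (p - 1) * j = int p * j - j" using p_ge_2 by (simp add: of_nat_diff algebra_simps)
    then show "inv g \<in> coef (p - 1) j" using ig by (simp add: coef_def)
    have "1 * j \<le> int p * j" using p_ge_2 j(1) by (intro mult_right_mono) auto
    then show "inv g \<in> coef 0 j" using ig by (simp add: coef_def)
  qed
  finally show ?thesis .
qed

lemma one_level: "\<one> \<in> level 0"
  using monomial_level[of \<one> 0 0] F_ring(3) dval_one[OF w] by (simp add: coef_def)

lemma inv_u_pow_level: "inv u [^] (i::nat) \<in> level (int i * j)"
proof (induction i)
  case (Suc i)
  then show ?case using level_mult[OF Suc inv_u_level] by (simp add: algebra_simps)
qed (use one_level in simp)

text \<open>Otherwise multiplication by the inverse monomial, of opposite value, would put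
  \<open>\<one>\<close> into a positive level.\<close>

lemma monomial_notin_level:
  assumes "a \<in> F - {\<zero>}" "int p * w a - int i * j < k" shows "a \<otimes> u [^] i \<notin> level k"
proof
  assume *: "a \<otimes> u [^] i \<in> level k"
  have ia: "inv a \<in> F" "inv a \<noteq> \<zero>" "w (inv a) = - w a" "a \<otimes> inv a = \<one>"
    using subfield_m_inv[OF F assms(1)] dval_inv[OF w assms(1)] by auto
  have "u [^] i \<otimes> inv u [^] i = \<one>"
  proof (induction i)
    case (Suc i)
    have c: "u [^] i \<in> carrier R" "inv u [^] i \<in> carrier R" "inv u \<in> carrier R"
      using inv_nonzero[OF u u_nz] by auto
    have "inv u [^] Suc i = inv u \<otimes> inv u [^] i"
      using c by (intro nat_pow_Suc2)
    then have "u [^] Suc i \<otimes> inv u [^] Suc i = u [^] i \<otimes> u \<otimes> (inv u \<otimes> inv u [^] i)"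
      by simp
    also have "\<dots> = u [^] i \<otimes> (u \<otimes> inv u) \<otimes> inv u [^] i"
      using c u by (simp only: m_assoc m_closed)
    finally have "u [^] Suc i \<otimes> inv u [^] Suc i = u [^] i \<otimes> (u \<otimes> inv u) \<otimes> inv u [^] i" .
    then show ?case using Suc inv_nonzero[OF u u_nz] by simp
  qed simp
  then have "a \<otimes> u [^] i \<otimes> (inv u [^] i \<otimes> inv a) = a \<otimes> inv a"
    using assms(1) ia(1) inv_nonzero[OF u u_nz] by (metis DiffD1 FC m_assoc m_closed nat_pow_closed r_one u)
  moreover have "inv a \<in> level (- (int p * w a))"
    using monomial_level[of "inv a" 0 "- (int p * w a)"] ia by (simp add: coef_def)
  ultimately have "\<one> \<in> level (k + (int i * j + - (int p * w a)))"
    using level_mult[OF * level_mult[OF inv_u_pow_level, of "inv a" _ i]] ia(4) by metis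
  then show False using one_notin_level assms(2) by simp
qed

context
  fixes T assumes T: "subfield T R" and T_span: "T = fspan F (\<lambda>i. u [^] i) p"
begin

lemma ex_level: "x \<in> T \<Longrightarrow> \<exists>k. x \<in> level k"
proof -
  have "\<exists>k. x \<in> partial_level d k" if "x \<in> fspan F (\<lambda>i. u [^] i) d" for d x
    using that
  proof (induction d arbitrary: x)
    case (Suc d)
    obtain a y where *: "a \<in> F" "y \<in> fspan F (\<lambda>i. u [^] i) d" "x = a \<otimes> u [^] d \<oplus> y"
      using Suc.prems unfolding fspan_Suc_iff by blast
    obtain k where k: "y \<in> partial_level d k" using Suc.IH[OF *(2)] by blast
    define l where "l = min k (int p * w a - int d * j)"
    have "y \<in> partial_level d l" using k by (rule partial_level_antimono[rotated]) (simp add: l_def)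
    moreover have "a \<in> coef d l" using * by (simp add: coef_def l_def)
    ultimately show ?case using * by auto
  qed simp
  then show "x \<in> T \<Longrightarrow> \<exists>k. x \<in> level k" unfolding T_span level_def .
qed

text \<open>If \<open>x\<close> lay in arbitrarily high levels, multiplying by its inverse, which
  lies in some level, would put \<open>\<one>\<close> into a positive level.\<close>

lemma ex1_level:
  assumes "x \<in> T - {\<zero>}" shows "\<exists>k. x \<in> level k \<and> x \<notin> level (k + 1)"
proof (rule ccontr)
  assume no: "\<nexists>k. x \<in> level k \<and> x \<notin> level (k + 1)"
  obtain k where k: "x \<in> level k" using ex_level assms by blast
  have "x \<in> level (k + int n)" for n
  proof (induction n)
    case (Suc n)
    then show ?case using no by (force simp: algebra_simps)
  qed (use k in simp)
  moreover obtain l where l: "inv x \<in> level l"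
    using ex_level subfield_m_inv(1)[OF T assms] by blast
  ultimately have "\<one> \<in> level (k + int (nat (1 - k - l)) + l)"
    using level_mult[OF _ l] subfield_m_inv(2)[OF T assms] by metis
  then show False using one_notin_level by simp
qed

text \<open>Levels decrease, so for nonzero \<open>x\<close> in \<open>T\<close> the choice is
  unique (\<open>ext_val_eqI\<close>).\<close>

definition ext_val :: "'a \<Rightarrow> int" where
  "ext_val x = (SOME k. x \<in> level k \<and> x \<notin> level (k + 1))"

lemma ext_val: "x \<in> T - {\<zero>} \<Longrightarrow> x \<in> level (ext_val x) \<and> x \<notin> level (ext_val x + 1)"
  unfolding ext_val_def using ex1_level by (rule someI_ex)

lemma ext_val_eqI:
  assumes "x \<in> T - {\<zero>}" "x \<in> level k" "x \<notin> level (k + 1)" shows "ext_val x = k"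
  using ext_val[OF assms(1)] assms(2,3) level_antimono[of "k + 1" "ext_val x" x]
    level_antimono[of "ext_val x + 1" k x] by linarith

lemma ext_val_leading:
  assumes "x \<in> T - {\<zero>}"
  obtains a i where "a \<in> F - {\<zero>}" "int p * w a - int i * j = ext_val x"
    "x \<ominus> a \<otimes> u [^] i \<in> level (ext_val x + 1)"
  using ext_val[OF assms] partial_level_leading[of x p "ext_val x"] unfolding level_def by auto

text \<open>Modulo the next level both factors may be replaced by their leading monomials, whose
  product has exactly the expected value.\<close>

lemma ext_val_mult:
  assumes x: "x \<in> T - {\<zero>}" and y: "y \<in> T - {\<zero>}"
  shows "ext_val (x \<otimes> y) = ext_val x + ext_val y"
proof (rule ext_val_eqI)
  show "x \<otimes> y \<in> T - {\<zero>}"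
    using x y subringE(6)[OF subfieldE(1)[OF T]] subfieldE(5)[OF T] by auto
  show "x \<otimes> y \<in> level (ext_val x + ext_val y)"
    using level_mult ext_val x y by blast
  obtain a i where a: "a \<in> F - {\<zero>}" "int p * w a - int i * j = ext_val x"
    "x \<ominus> a \<otimes> u [^] i \<in> level (ext_val x + 1)" using ext_val_leading[OF x] .
  obtain b l where b: "b \<in> F - {\<zero>}" "int p * w b - int l * j = ext_val y"
    "y \<ominus> b \<otimes> u [^] l \<in> level (ext_val y + 1)" using ext_val_leading[OF y] .
  have C: "x \<in> carrier R" "y \<in> carrier R" "a \<in> carrier R" "b \<in> carrier R"
    using x y a(1) b(1) subfieldE(3)[OF T] by auto
  let ?m = "a \<otimes> u [^] i" and ?n = "b \<otimes> u [^] l"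
  have "?m \<in> level (ext_val x)"
    using a by (intro monomial_level) (auto simp: coef_def)
  then have "?m \<otimes> (y \<ominus> ?n) \<in> level (ext_val x + (ext_val y + 1))"
    using b(3) by (rule level_mult)
  moreover have "(x \<ominus> ?m) \<otimes> y \<in> level (ext_val x + 1 + ext_val y)"
    using a(3) ext_val[OF y] level_mult by blast
  ultimately have 1: "(x \<ominus> ?m) \<otimes> y \<oplus> ?m \<otimes> (y \<ominus> ?n) \<in> level (ext_val x + ext_val y + 1)"
    by (intro level_add) (simp_all add: algebra_simps)
  have "(x \<ominus> ?m) \<otimes> y \<oplus> ?m \<otimes> (y \<ominus> ?n) = x \<otimes> y \<ominus> ?m \<otimes> ?n"
  proof -
    have "(x \<ominus> m) \<otimes> y \<oplus> m \<otimes> (y \<ominus> n) = x \<otimes> y \<ominus> m \<otimes> n"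
      if "m \<in> carrier R" "n \<in> carrier R" for m n
      using C(1,2) that by algebra
    then show ?thesis using C by simp
  qed
  moreover have "?m \<otimes> ?n = (a \<otimes> b) \<otimes> u [^] (i + l)"
  proof -
    have "?m \<otimes> ?n = a \<otimes> (u [^] i \<otimes> b) \<otimes> u [^] l" using C by (simp add: m_assoc)
    also have "\<dots> = (a \<otimes> b) \<otimes> u [^] (i + l)"
      using C b(1) by (simp add: u_pow_F m_assoc nat_pow_mult)
    finally show ?thesis .
  qed
  moreover have "(a \<otimes> b) \<otimes> u [^] (i + l) \<notin> level (ext_val x + ext_val y + 1)"
  proof (rule monomial_notin_level)
    show "a \<otimes> b \<in> F - {\<zero>}"
      using a(1) b(1) F_ring(6) subfieldE(5)[OF F] by auto
    show "int p * w (a \<otimes> b) - int (i + l) * j < ext_val x + ext_val y + 1"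
      using dval_mult[OF w a(1) b(1)] a(2) b(2) by (simp add: algebra_simps)
  qed
  ultimately have 2: "x \<otimes> y \<ominus> ?m \<otimes> ?n \<in> level (ext_val x + ext_val y + 1)"
    and 3: "?m \<otimes> ?n \<notin> level (ext_val x + ext_val y + 1)"
    using 1 by simp_all
  show "x \<otimes> y \<notin> level (ext_val x + ext_val y + 1)"
  proof
    assume "x \<otimes> y \<in> level (ext_val x + ext_val y + 1)"
    then have "x \<otimes> y \<ominus> (x \<otimes> y \<ominus> ?m \<otimes> ?n) \<in> level (ext_val x + ext_val y + 1)"
      using 2 by (rule level_minus)
    moreover have "q \<ominus> (q \<ominus> r) = r" if "q \<in> carrier R" "r \<in> carrier R" for q r
      using that by algebra
    ultimately show False using 3 C by simp
  qed
qed

lemma F_subset_T: "F \<subseteq> T"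
proof
  fix a assume a: "a \<in> F"
  have "a \<in> fspan F (\<lambda>i. u [^] i) d" if "1 \<le> d" for d
    using that
  proof (induction d rule: dec_induct)
    case base
    have "a = a \<otimes> u [^] (0::nat) \<oplus> \<zero>" using a by simp
    then show ?case unfolding One_nat_def fspan_Suc_iff using a by auto
  next
    case (step d)
    then show ?case using fspan_Suc_mono[OF subfieldE(1)[OF F], of d "\<lambda>i. u [^] i"] by auto
  qed
  then show "a \<in> T" unfolding T_span using p_ge_2 by simp
qed

lemma u_in_T: "u \<in> T"
proof -
  have sub: "fspan F (\<lambda>i. u [^] i) 2 \<subseteq> fspan F (\<lambda>i. u [^] i) d" if "2 \<le> d" for d
    using that
  proof (induction d rule: dec_induct)
    case (step d)
    then show ?case using fspan_Suc_mono[OF subfieldE(1)[OF F], of d "\<lambda>i. u [^] i"] by auto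
  qed simp
  have "\<zero> \<in> fspan F (\<lambda>i. u [^] i) 1"
    by (rule fspan_zero[OF subfieldE(1)[OF F]]) simp
  moreover have "u = \<one> \<otimes> u [^] (1::nat) \<oplus> \<zero>" by simp
  ultimately have "u \<in> fspan F (\<lambda>i. u [^] i) (Suc 1)"
    unfolding fspan_Suc_iff using F_ring(3) by blast
  then show ?thesis using sub[OF p_ge_2] unfolding T_span by (auto simp: numeral_2_eq_2)
qed

lemma ext_val_monomial:
  assumes "a \<in> F - {\<zero>}"
  shows "a \<otimes> u [^] (i::nat) \<in> T - {\<zero>}" "ext_val (a \<otimes> u [^] i) = int p * w a - int i * j"
proof -
  have "a \<otimes> u [^] i \<in> T"
    using assms F_subset_T u_in_T subring_pow[OF subfieldE(1)[OF T]] subringE(6)[OF subfieldE(1)[OF T]]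
    by blast
  then show 1: "a \<otimes> u [^] i \<in> T - {\<zero>}"
    using assms integral[of a "u [^] i"] pow_nonzero[OF u u_nz] by auto
  show "ext_val (a \<otimes> u [^] i) = int p * w a - int i * j"
    using assms by (intro ext_val_eqI[OF 1] monomial_level monomial_notin_level) (auto simp: coef_def)
qed

lemma ext_val_F: "a \<in> F - {\<zero>} \<Longrightarrow> ext_val a = int p * w a"
  using ext_val_monomial(2)[of a 0] by simp

lemma ext_val_surj: "\<exists>x \<in> T - {\<zero>}. ext_val x = k"
proof -
  have "Factorial_Ring.prime (int p)" using prime_p by simp
  then have "coprime (int p) j" using j(2) prime_imp_coprime by blast
  then obtain a b where ab: "a * int p + b * j = 1"
    by (metis bezout_int coprime_imp_gcd_eq_1)
  \<comment> \<open>Since b j is 1 modulo \<open>p\<close>, this exponent makes k + i j divisible by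
    \<open>p\<close>.\<close>
  define i where "i = nat ((- (k * b)) mod int p)"
  have "int i = (- (k * b)) mod int p" using p_ge_2 by (simp add: i_def)
  then have "int p dvd int i + k * b"
    by (metis add.commute add.inverse_inverse diff_conv_add_uminus dvd_minus_mod mod_eq_dvd_iff mod_mod_trivial)
  then obtain c where c: "int i + k * b = int p * c" by blast
  have "k + int i * j = k * (a * int p + b * j) + int i * j" using ab by simp
  also have "\<dots> = int p * (k * a) + (int i + k * b) * j" by (simp add: algebra_simps)
  also have "\<dots> = int p * (k * a + c * j)" unfolding c by (simp add: algebra_simps)
  finally have e: "k = int p * (k * a + c * j) - int i * j" by simp
  obtain x where "x \<in> F - {\<zero>}" "w x = k * a + c * j" using dval_surj[OF w] by blast
  then show ?thesis using ext_val_monomial[of x i] e by metis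
qed

theorem discrete_valuation_ext_val: "discrete_valuation T ext_val"
  unfolding discrete_valuation_def
proof (intro conjI ballI)
  show "subfield T R" by (rule T)
  show "ext_val ` (T - {\<zero>}) = UNIV" using ext_val_surj by (auto simp: image_iff) metis
next
  fix x y assume x: "x \<in> T - {\<zero>}" and y: "y \<in> T - {\<zero>}"
  show "ext_val (x \<otimes> y) = ext_val x + ext_val y" by (rule ext_val_mult[OF x y])
  let ?k = "min (ext_val x) (ext_val y)"
  have "x \<in> level ?k" "y \<in> level ?k"
    using ext_val[OF x] ext_val[OF y] level_antimono[of ?k "ext_val x"] level_antimono[of ?k "ext_val y"] by auto
  then have xy: "x \<oplus> y \<in> level ?k" by (rule level_add)
  show "val_ge ext_val ?k (x \<oplus> y)"
  proof (cases "x \<oplus> y = \<zero>")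
    case False
    then have "x \<oplus> y \<in> T - {\<zero>}" using x y subringE(7)[OF subfieldE(1)[OF T]] by blast
    then have "\<not> ext_val (x \<oplus> y) + 1 \<le> ?k"
      using ext_val[of "x \<oplus> y"] level_antimono[OF _ xy] by blast
    then show ?thesis unfolding val_ge_def by (intro disjI2) linarith
  qed (simp add: val_ge_def)
qed

end

end

section \<open>Dimension counts and powers of a uniformizer\<close>

context ring
begin

lemma fspan_power_mem:
  assumes F: "subring F R" and b: "\<And>i. b i \<in> carrier R" and i: "i < d"
  shows "b i \<in> fspan F b d"
proof -
  have "b i = \<one> \<otimes> b i \<oplus> \<zero>" using b by simp
  then have "b i \<in> fspan F b (Suc i)"
    unfolding fspan_Suc_iff using fspan_zero[OF F, of i b] b subringE(3)[OF F] by blast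
  moreover have "fspan F b (Suc i) \<subseteq> fspan F b d"
    using Suc_leI[OF i] by (induction d rule: dec_induct) (use fspan_Suc_mono[OF F, of _ b] b in blast)+
  ultimately show ?thesis by blast
qed

lemma dimension_subset_eq:
  assumes K: "subfield K R" and "dimension n K E" "dimension n K E'" "E' \<subseteq> E"
  shows "E' = E"
proof -
  obtain Vs where Vs: "set Vs \<subseteq> carrier R" "independent K Vs" "length Vs = n" "Span K Vs = E'"
    using exists_base[OF K assms(3)] by blast
  then have "set Vs \<subseteq> E" using Span_base_incl[OF K Vs(1)] assms(4) by blast
  then show ?thesis using independent_length_eq_dimension[OF K assms(2) Vs(2)] Vs by blast
qed

lemma dimension_le:
  assumes K: "subfield K R" and "dimension n K E" "dimension m K E'" "E' \<subseteq> E"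
  shows "m \<le> n"
proof -
  obtain Vs where Vs: "set Vs \<subseteq> carrier R" "independent K Vs" "length Vs = m" "Span K Vs = E'"
    using exists_base[OF K assms(3)] by blast
  then have "set Vs \<subseteq> E" using Span_base_incl[OF K Vs(1)] assms(4) by blast
  then show ?thesis using independent_length_le_dimension[OF K assms(2) Vs(2)] Vs by blast
qed

text \<open>Independent lists in \<open>E\<close> have length at most \<open>n\<close>, and a
  longest one spans \<open>E\<close>.\<close>

lemma dimension_subspace:
  assumes K: "subfield K R" and V: "dimension n K V" and E: "E \<subseteq> V" "\<zero> \<in> E"
    and add: "\<And>x y. x \<in> E \<Longrightarrow> y \<in> E \<Longrightarrow> x \<oplus> y \<in> E"
    and smult: "\<And>k x. k \<in> K \<Longrightarrow> x \<in> E \<Longrightarrow> k \<otimes> x \<in> E"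
  shows "\<exists>m. dimension m K E"
proof -
  have VC: "V \<subseteq> carrier R" using space_subgroup_props(1)[OF K V] .
  define Q where "Q m \<longleftrightarrow> (\<exists>Us. independent K Us \<and> set Us \<subseteq> E \<and> length Us = m)" for m
  have "Q 0" by (auto simp: Q_def)
  moreover have "m \<le> n" if "Q m" for m
    using that independent_length_le_dimension[OF K V] E(1) by (auto simp: Q_def)
  ultimately obtain m where m: "Q m" "\<And>m'. Q m' \<Longrightarrow> m' \<le> m"
    by (metis Greatest_le_nat GreatestI_nat)
  obtain Us where Us: "independent K Us" "set Us \<subseteq> E" "length Us = m"
    using m(1) by (auto simp: Q_def)
  have span: "Span K Ws \<subseteq> E" if "set Ws \<subseteq> E" for Ws
    using that
  proof (induction Ws)
    case (Cons a Ws)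
    then have "foldr (line_extension K) Ws {\<zero>} \<subseteq> E" "a \<in> E" by auto
    then show ?case using add smult by (auto simp: line_extension_mem_iff) blast
  qed (use E in simp)
  have "Span K Us = E"
  proof (rule ccontr)
    assume "Span K Us \<noteq> E"
    then obtain x where x: "x \<in> E" "x \<notin> Span K Us" using span[OF Us(2)] by blast
    then have "independent K (x # Us)"
      using Us E(1) VC by (intro li_Cons) auto
    then have "Q (Suc m)"
      unfolding Q_def using Us x by (intro exI[of _ "x # Us"]) auto
    then show False using m(2) by fastforce
  qed
  then show ?thesis using dimensionI[OF K Us(1)] by blast
qed

text \<open>The powers of an element of value \<open>1\<close> lie in distinct classes of values modulo \<open>e\<close>.\<close>

lemma powers_of_uniformizer:
  assumes w: "discrete_valuation A w" and B: "subfield B R" "B \<subseteq> A"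
    and e: "\<And>b. b \<in> B - {\<zero>} \<Longrightarrow> int e dvd w b"
    and z: "z \<in> A - {\<zero>}" "w z = 1"
  shows "d \<le> e \<Longrightarrow> x \<in> fspan B (\<lambda>i. z [^] i) d \<Longrightarrow>
      \<exists>b \<in> B. x = b \<or> (x \<ominus> b \<in> A - {\<zero>} \<and> 0 < w (x \<ominus> b) mod int e \<and> w (x \<ominus> b) mod int e < int d)"
    and "dimension e B (fspan B (\<lambda>i. z [^] i) e)"
proof -
  note A = dval_subfield[OF w]
  note A_ring = subringE[OF subfieldE(1)[OF A]] and B_ring = subringE[OF subfieldE(1)[OF B(1)]]
  have AC: "x \<in> A \<Longrightarrow> x \<in> carrier R" for x using A_ring(1) by blast
  have zC: "z \<in> carrier R" using z AC by blast
  have wz: "z [^] i \<in> A - {\<zero>}" "w (z [^] i) = int i" for i :: nat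
    using dval_pow[OF w z(1), of i] z(2) by auto
  have fsA: "fspan B (\<lambda>i. z [^] i) d \<subseteq> A" for d
    using wz B by (intro fspan_subset[OF subfieldE(1)[OF B(1)] subfieldE(1)[OF A]]) auto
  show main: "\<exists>b \<in> B. x = b \<or> (x \<ominus> b \<in> A - {\<zero>} \<and> 0 < w (x \<ominus> b) mod int e \<and> w (x \<ominus> b) mod int e < int d)"
    if "d \<le> e" "x \<in> fspan B (\<lambda>i. z [^] i) d" for d x
    using that
  proof (induction d arbitrary: x)
    case 0
    then show ?case using B_ring(2) by auto
  next
    case (Suc d)
    obtain a y where *: "a \<in> B" "y \<in> fspan B (\<lambda>i. z [^] i) d" "x = a \<otimes> z [^] d \<oplus> y"
      using Suc.prems unfolding fspan_Suc_iff by blast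
    have yA: "y \<in> A" using * fsA by blast
    have C: "a \<in> carrier R" "y \<in> carrier R" "a \<in> A" using * yA B AC by auto
    obtain b where b: "b \<in> B" "y = b \<or> (y \<ominus> b \<in> A - {\<zero>} \<and> 0 < w (y \<ominus> b) mod int e \<and> w (y \<ominus> b) mod int e < int d)"
      using Suc.IH[OF _ *(2)] Suc.prems(1) by auto
    have bC: "b \<in> carrier R" using b B AC by auto
    show ?case
    proof (cases "a = \<zero> \<or> d = 0")
      case True
      show ?thesis
      proof (cases "a = \<zero>")
        case True
        then have "x = y" using * C zC by simp
        then show ?thesis using b by (intro bexI[OF _ b(1)]) auto
      next
        case False
        then have "x = a \<oplus> \<zero>" using * True C by simp
        then show ?thesis using *(1) C by auto
      qed
    next
      case False
      let ?m = "a \<otimes> z [^] d"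
      have m: "?m \<in> A - {\<zero>}" "w ?m = w a + int d"
        using False C wz[of d] A_ring(6)[of a "z [^] d"] subfieldE(5)[OF A, of a "z [^] d"]
          dval_mult[OF w, of a "z [^] d"] by auto
      \<comment> \<open>\<open>w a\<close> is a multiple of \<open>e\<close>, so monomials of
        different degrees have different values modulo \<open>e\<close> and cannot cancel.\<close>
      have mmod: "w ?m mod int e = int d"
        using m(2) e[of a] * False Suc.prems(1) by (auto elim!: dvdE)
      have eq: "x \<ominus> b = ?m \<oplus> (y \<ominus> b)"
        using C bC zC * by (simp add: minus_eq a_assoc)
      show ?thesis
      proof (cases "y = b")
        case True
        then have "x \<ominus> b = ?m" unfolding eq using C bC zC by simp
        then show ?thesis using b(1) m(1) mmod False by (intro bexI[of _ b]) auto
      next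
        case neq: False
        then have yb: "y \<ominus> b \<in> A - {\<zero>}" "0 < w (y \<ominus> b) mod int e" "w (y \<ominus> b) mod int e < int d"
          using b(2) by auto
        show ?thesis
        proof (cases "w ?m < w (y \<ominus> b)")
          case True
          have "x \<ominus> b \<in> A - {\<zero>} \<and> w (x \<ominus> b) = w ?m"
            unfolding eq using dval_add_less[OF w m(1), of "y \<ominus> b"] yb(1) True by blast
          then show ?thesis using b(1) mmod False by (intro bexI[of _ b]) auto
        next
          case nless: False
          have "w ?m \<noteq> w (y \<ominus> b)" using mmod yb(3) by auto
          then have "x \<ominus> b \<in> A - {\<zero>} \<and> w (x \<ominus> b) = w (y \<ominus> b)"
            unfolding eq using dval_add_less[OF w yb(1), of ?m] m(1) nless yb(1)
              a_comm[of ?m "y \<ominus> b"] AC[of ?m] AC[of "y \<ominus> b"] by auto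
          then show ?thesis using b(1) yb by (intro bexI[of _ b]) auto
        qed
      qed
    qed
  qed
  show "dimension e B (fspan B (\<lambda>i. z [^] i) e)"
  proof (rule dimension_fspan)
    show "z [^] i \<in> carrier R" if "i < e" for i using zC by simp
    \<comment> \<open>For d > 0, membership would make z^d equal to some b in \<open>B\<close>, or
      give z^d - b a value with residue between 1 and d - 1. But b has residue 0 and z^d residue d,
      so z^d - b has one of these two residues.\<close>
    show "z [^] d \<notin> fspan B (\<lambda>i. z [^] i) d" if lt: "d < e" for d
    proof
      assume "z [^] d \<in> fspan B (\<lambda>i. z [^] i) d"
      then obtain b where b: "b \<in> B" "z [^] d = b \<or> (z [^] d \<ominus> b \<in> A - {\<zero>} \<and>
          0 < w (z [^] d \<ominus> b) mod int e \<and> w (z [^] d \<ominus> b) mod int e < int d)"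
        using main[OF less_imp_le[OF lt]] by blast
      have dmod: "w (z [^] d) mod int e = int d" using wz(2)[of d] lt by simp
      have bC: "b \<in> carrier R" using b B AC by auto
      show False
      proof (cases "b = \<zero>")
        case True
        moreover have "z [^] d \<ominus> \<zero> = z [^] d" using zC by (simp add: minus_eq)
        ultimately show False using b(2) wz(1)[of d] dmod by auto
      next
        case False
        then have wb: "w b mod int e = 0" using e[of b] b(1) by auto
        show False
        proof (cases "z [^] d = b")
          case True
          then have "d = 0" using dmod wb by simp
          then show False
            using \<open>z [^] d \<in> fspan B (\<lambda>i. z [^] i) d\<close> wz(1)[of d] by simp
        next
          case neq: False
          let ?r = "z [^] d \<ominus> b"
          have r: "0 < w ?r mod int e" "w ?r mod int e < int d" using b(2) neq by auto
          have nb: "\<ominus> b \<in> A - {\<zero>}" "w (\<ominus> b) = w b"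
            using b(1) B False dval_uminus[OF w, of b] A_ring(5)[of b] bC by auto
          have "w (z [^] d) \<noteq> w (\<ominus> b)" using r dmod wb nb by auto
          then have "w ?r = w (z [^] d) \<or> w ?r = w (\<ominus> b)"
            using dval_add_less(2)[OF w wz(1)[of d], of "\<ominus> b"] dval_add_less(2)[OF w nb(1), of "z [^] d"]
              nb(1) wz(1)[of d] zC bC a_comm[of "z [^] d" "\<ominus> b"]
            by (auto simp: minus_eq linorder_neq_iff)
          then show False using r dmod wb nb by auto
        qed
      qed
    qed
  qed
qed

end

section \<open>The tower of maximal subfields\<close>

text \<open>The number \<open>N\<close> and the element \<open>v0\<close> record that \<open>dl t\<close> is a Jordan block of size greater than \<open>N\<close>
  over its kernel \<open>cent {t}\<close>.\<close>

locale inseparable_setting = char_p_division_ring +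
  fixes K :: "'a set" and v w0 :: "'a \<Rightarrow> int" and t :: 'a and n M N :: nat and v0 :: 'a
  assumes K_eq: "K = cent (carrier R)" and K: "subfield K R" and v: "discrete_valuation K v"
    and t [simp]: "t \<in> carrier R" "t \<noteq> \<zero>"
    and t_comm: "\<And>a b. a \<in> cent {t} \<Longrightarrow> b \<in> cent {t} \<Longrightarrow> a \<otimes> b = b \<otimes> a"
    and t_span: "cent {t} = fspan K (\<lambda>i. t [^] i) n"
    and t_dim: "dimension n K (cent {t})" and n_pos: "0 < n"
    and w0: "discrete_valuation (cent {t}) w0" "\<And>x. x \<in> K - {\<zero>} \<Longrightarrow> w0 x = int n * v x"
    and t_pM: "t [^] (p ^ M) \<in> K"
    and N: "\<And>r. r < M \<Longrightarrow> p ^ r \<le> N"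
    and v0: "v0 \<in> carrier R" "(dl t ^^ N) v0 = \<one>"
begin

lemma KC [simp, intro]: "a \<in> K \<Longrightarrow> a \<in> carrier R"
  using subfieldE(3)[OF K] by blast

lemma K_comm: "a \<in> K \<Longrightarrow> x \<in> carrier R \<Longrightarrow> a \<otimes> x = x \<otimes> a"
  unfolding K_eq by (rule centD)

lemma K_cent: "Y \<subseteq> carrier R \<Longrightarrow> K \<subseteq> cent Y"
  unfolding K_eq by (rule cent_antimono)

lemmas K_ring = subringE[OF subfieldE(1)[OF K]]

text \<open>Elements of \<open>cent {t}\<close> are sums of monomials a t^i with a in
  \<open>K\<close>, and Frobenius acts termwise on this commutative ring.\<close>

lemma power_pM:
  assumes "x \<in> cent {t}" shows "x [^] (p ^ M) \<in> K"
proof -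
  have "x [^] (p ^ M) \<in> K" if "x \<in> fspan K (\<lambda>i. t [^] i) d" for d x
    using that
  proof (induction d arbitrary: x)
    case 0
    then have x: "x = \<zero>" by simp
    have "(\<zero>::'a) [^] (p ^ M) = \<zero>"
      using nat_pow_zero[of "p ^ M"] p_ge_2 by simp
    then show ?case using x K_ring(2) by simp
  next
    case (Suc d)
    obtain a y where *: "a \<in> K" "y \<in> fspan K (\<lambda>i. t [^] i) d" "x = a \<otimes> t [^] d \<oplus> y"
      using Suc.prems unfolding fspan_Suc_iff by blast
    have sub: "fspan K (\<lambda>i. t [^] i) d \<subseteq> cent {t}"
      using subring_pow[OF subring_cent, of "{t}" t] K_cent[of "{t}"]
      by (intro fspan_subset[OF subfieldE(1)[OF K] subring_cent]) (auto simp: cent_def)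
    have y: "y \<in> cent {t}" "y \<in> carrier R" using * sub by auto
    have aC: "a \<in> carrier R" using * by simp
    have td: "t [^] d \<in> cent {t}" using pow_commute[of t t d] by (auto simp: cent_def)
    have at: "a \<otimes> t [^] d \<in> cent {t}"
      using K_cent[of "{t}"] * td by (intro subringE(6)[OF subring_cent]) auto
    have "x [^] (p ^ M) = (a \<otimes> t [^] d) [^] (p ^ M) \<oplus> y [^] (p ^ M)"
      unfolding *(3) using t_comm[OF at y(1)] aC y by (intro frobenius_power_add) auto
    also have "(a \<otimes> t [^] d) [^] (p ^ M) = a [^] (p ^ M) \<otimes> (t [^] (p ^ M)) [^] d"
      using aC pow_mult_distrib[OF K_comm[OF *(1)], of "t [^] d"] by (simp add: nat_pow_pow mult.commute)
    finally show ?case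
      using Suc.IH[OF *(2)] *(1) t_pM subring_pow[OF subfieldE(1)[OF K]] K_ring(6,7) by simp
  qed
  then show ?thesis using assms unfolding t_span by blast
qed

text \<open>Stage \<open>r\<close> of the tower: \<open>Y\<close> consists of \<open>y\<^sub>1, \<dots>, y\<^sub>r\<close>, the centre of \<open>cent Y\<close> is the cyclic field
  generated by them, \<open>c\<close> is an element of trace \<open>1\<close> of that field, and \<open>w\<close> is the normalized valuation of
  the maximal subfield obtained by adjoining \<open>t\<close> to the power \<open>p\<^sup>r\<close>.\<close>

definition stage :: "nat \<Rightarrow> 'a set \<Rightarrow> 'a \<Rightarrow> ('a \<Rightarrow> int) \<Rightarrow> bool" where
  "stage r Y c w \<longleftrightarrow>
     Y \<subseteq> cent Y \<and>
     (\<forall>x \<in> cent Y. conj t x \<in> cent Y) \<and>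
     (\<forall>z \<in> cent Y. (dl t ^^ N) z = \<zero> \<longrightarrow> (\<exists>x \<in> cent Y. dl t x = z)) \<and>
     c \<in> cent Y \<inter> cent (cent Y) \<and> (dl t ^^ (p ^ r - 1)) c = \<one> \<and>
     t [^] (p ^ r) \<in> cent Y \<and>
     (\<forall>a \<in> cent (insert (t [^] (p ^ r)) Y). \<forall>b \<in> cent (insert (t [^] (p ^ r)) Y). a \<otimes> b = b \<otimes> a) \<and>
     dimension n K (cent (insert (t [^] (p ^ r)) Y)) \<and>
     discrete_valuation (cent (insert (t [^] (p ^ r)) Y)) w \<and>
     (\<forall>x \<in> K - {\<zero>}. w x = int n * v x) \<and>
     cent Y \<inter> cent {t} \<subseteq> fspan K (\<lambda>i. (t [^] (p ^ r)) [^] i) n"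

text \<open>The centralizer is the whole algebra, \<open>\<one>\<close> has trace 1 under the empty
  iterate, and solvability is \<open>dl_image\<close> for the chain of \<open>v0\<close>.\<close>

lemma stage_0: "stage 0 {} \<one> w0"
proof -
  have e: "cent {} = carrier R" by (auto simp: cent_def)
  have 1: "\<one> \<in> cent (carrier R)" by (auto simp: cent_def)
  show ?thesis
    unfolding stage_def e using t_comm t_dim w0 t_span 1 dl_image[OF t carrier_is_subring _ v0]
    by auto
qed

end

locale tower_stage = inseparable_setting +
  fixes r :: nat and Y :: "'a set" and c :: 'a and w :: "'a \<Rightarrow> int"
  assumes stage: "stage r Y c w" and r: "r < M"
begin

abbreviation s :: 'a where "s \<equiv> t [^] (p ^ r)"

definition A :: "'a set" where "A = cent (insert s Y)"

text \<open>The centre of \<open>cent Y\<close> (see \<open>Z_eq\<close>), written as one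
  centralizer so that \<open>subring_cent\<close> applies.\<close>

definition Z :: "'a set" where "Z = cent (Y \<union> cent Y)"

lemma Y_cent: "Y \<subseteq> cent Y" and YC: "Y \<subseteq> carrier R"
  using stage cent_subset_carrier by (auto simp: stage_def)

lemma conj_C: "x \<in> cent Y \<Longrightarrow> conj t x \<in> cent Y"
  using stage by (simp add: stage_def)

lemma solve_C: "z \<in> cent Y \<Longrightarrow> (dl t ^^ N) z = \<zero> \<Longrightarrow> \<exists>x \<in> cent Y. dl t x = z"
  using stage by (simp add: stage_def)

lemma Z_eq: "Z = cent Y \<inter> cent (cent Y)"
  by (auto simp: Z_def cent_def)

text \<open>In characteristic \<open>p\<close>, (\<sigma> - 1)^(p^r - 1) is the sum of the
  \<sigma>^i with i < p^r. As \<open>s\<close> commutes with \<open>Z\<close>, this is the trace on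
  \<open>Z\<close>.\<close>

lemma c_Z: "c \<in> Z" and c_trace: "(dl t ^^ (p ^ r - 1)) c = \<one>"
  using stage unfolding Z_eq by (auto simp: stage_def)

lemma s_C: "s \<in> cent Y"
  using stage by (simp add: stage_def)

lemma A_comm: "a \<in> A \<Longrightarrow> b \<in> A \<Longrightarrow> a \<otimes> b = b \<otimes> a"
  using stage by (simp add: stage_def A_def)

lemma A_dim: "dimension n K A" and A_val: "discrete_valuation A w"
  and w_K: "x \<in> K - {\<zero>} \<Longrightarrow> w x = int n * v x"
  using stage by (simp_all add: stage_def A_def)

lemma C_T: "cent Y \<inter> cent {t} \<subseteq> fspan K (\<lambda>i. s [^] i) n"
  using stage by (simp add: stage_def)

lemma sC [simp]: "s \<in> carrier R" and s_nz [simp]: "s \<noteq> \<zero>"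
  using pow_nonzero[of t "p ^ r"] by simp_all

lemma C_ring: "subring (cent Y) R" using subring_cent[OF YC] .

lemma Z_ring: "subring Z R"
  unfolding Z_def using YC cent_subset_carrier by (intro subring_cent) blast

lemma A_ring: "subring A R"
  unfolding A_def using YC by (intro subring_cent) auto

lemma CC: "x \<in> cent Y \<Longrightarrow> x \<in> carrier R" and ZC: "x \<in> Z \<Longrightarrow> x \<in> cent Y"
  and Z_comm: "x \<in> Z \<Longrightarrow> y \<in> cent Y \<Longrightarrow> x \<otimes> y = y \<otimes> x"
  by (auto simp: Z_eq dest: centD)

lemma AC: "x \<in> A \<Longrightarrow> x \<in> carrier R" and A_C: "x \<in> A \<Longrightarrow> x \<in> cent Y"
  and A_s: "x \<in> A \<Longrightarrow> x \<otimes> s = s \<otimes> x"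
  by (auto simp: A_def cent_def)

lemma AI: "x \<in> cent Y \<Longrightarrow> x \<otimes> s = s \<otimes> x \<Longrightarrow> x \<in> A"
  by (auto simp: A_def cent_def)

lemma K_C: "K \<subseteq> cent Y" and K_Z: "K \<subseteq> Z" and K_A: "K \<subseteq> A"
  using K_cent YC cent_subset_carrier[of Y] by (auto simp: Z_def A_def)

lemma t_s: "x \<in> carrier R \<Longrightarrow> x \<otimes> t = t \<otimes> x \<Longrightarrow> x \<otimes> s = s \<otimes> x"
  using pow_commute[of t x "p ^ r"] by simp

text \<open>\<sigma> has finite order because t^(p^M) is central, so its inverse is one of its
  powers. Surjectivity lets \<sigma> preserve the centre \<open>Z\<close>.\<close>

lemma conj_t_surj: "x \<in> cent Y \<Longrightarrow> \<exists>x' \<in> cent Y. conj t x' = x"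
proof -
  assume x: "x \<in> cent Y"
  have it: "(conj t ^^ k) x \<in> cent Y" for k
    by (induction k) (use x conj_C in auto)
  have pM: "p ^ M = Suc (p ^ M - 1)" using p_ge_2 by simp
  have "conj t ((conj t ^^ (p ^ M - 1)) x) = (conj t ^^ (p ^ M)) x"
    by (subst (2) pM) simp
  also have "\<dots> = x"
    using funpow_conj[of t x "p ^ M"] conj_fixed_iff[of "t [^] (p ^ M)" x] pow_nonzero[of t "p ^ M"]
      K_comm[OF t_pM] x by auto
  finally show ?thesis using it by blast
qed

lemma conj_Z: "z \<in> Z \<Longrightarrow> conj t z \<in> Z"
proof -
  assume z: "z \<in> Z"
  have "conj t z \<otimes> y = y \<otimes> conj t z" if y: "y \<in> cent Y" for y
  proof -
    obtain y' where y': "y' \<in> cent Y" "conj t y' = y" using conj_t_surj[OF y] by blast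
    have "conj t z \<otimes> conj t y' = conj t y' \<otimes> conj t z"
      using Z_comm[OF z y'(1)] conj_mult[of t z y'] conj_mult[of t y' z] z y'(1) ZC CC by simp
    then show ?thesis using y' by simp
  qed
  then show ?thesis
    unfolding Z_eq using conj_C ZC[OF z] CC by (auto intro!: centI)
qed

lemma dl_Z: "z \<in> Z \<Longrightarrow> dl t z \<in> Z"
  unfolding dl_def using conj_Z by (intro subring_minus[OF Z_ring])

text \<open>Frobenius commutes with \<open>dl t\<close> on the commutative ring \<open>Z\<close>, so
  c^p also has trace 1 and c^p - c has trace 0. The chain of \<open>c\<close> in
  \<open>dl_image\<close> then does the work of additive Hilbert 90.\<close>

lemma ex_alpha: "\<exists>\<alpha> \<in> Z. dl t \<alpha> = c [^] p \<ominus> c"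
proof (rule dl_image[OF t Z_ring dl_Z c_Z c_trace])
  have C: "z \<in> Z \<Longrightarrow> z \<in> carrier R" for z using ZC CC by blast
  have pow: "(dl t ^^ k) c \<in> Z" for k
    by (induction k) (use c_Z dl_Z in auto)
  have frob: "dl t (z [^] p) = dl t z [^] p" if z: "z \<in> Z" for z
    unfolding dl_def using frobenius_minus[of "conj t z" z] conj_pow[of t z p] Z_comm[OF conj_Z[OF z] ZC[OF z]]
      C[OF z] by simp
  have "(dl t ^^ k) (c [^] p) = (dl t ^^ k) c [^] p" for k
    by (induction k) (simp_all add: frob[OF pow])
  then have "(dl t ^^ (p ^ r - 1)) (c [^] p) = \<one>" using c_trace by simp
  then show "(dl t ^^ (p ^ r - 1)) (c [^] p \<ominus> c) = \<zero>"
    using additive_map_diff[OF additive_map_funpow[OF additive_map_dl], of t "c [^] p" c "p ^ r - 1"]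
      c_trace C[OF c_Z] by simp
  show "c [^] p \<ominus> c \<in> Z"
    using c_Z subring_pow[OF Z_ring] by (intro subring_minus[OF Z_ring])
qed simp_all

text \<open>One iteration beyond the trace kills \<open>c\<close>, and p^r \<le> N brings it within
  reach of \<open>solve_C\<close>.\<close>

lemma ex_root: "\<exists>y \<in> cent Y. dl t y = c"
proof (rule solve_C)
  show "c \<in> cent Y" using c_Z ZC by blast
  have "dl t \<one> = \<zero>" using dl_eq_zero_iff[of t \<one>] by simp
  then have "(dl t ^^ Suc (p ^ r - 1)) c = \<zero>" using c_trace by simp
  moreover have pr: "Suc (p ^ r - 1) = p ^ r" using p_ge_2 by simp
  ultimately have "(dl t ^^ (p ^ r)) c = \<zero>" unfolding pr by simp
  moreover have "N = (N - p ^ r) + p ^ r" using N[OF r] by simp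
  ultimately show "(dl t ^^ N) c = \<zero>"
    using additive_map_zero[OF additive_map_funpow[OF additive_map_dl[OF t]]]
    by (metis comp_apply funpow_add)
qed

text \<open>\<open>dl s\<close> is the p^r-th iterate of \<open>dl t\<close>, which takes
  \<open>y\<close> to the trace of \<open>c\<close>. So conjugation by \<open>s\<close> moves
  \<open>y\<close> to y + 1.\<close>

lemma dl_s:
  assumes "y \<in> carrier R" "dl t y = c" shows "dl s y = \<one>"
proof -
  have "(dl t ^^ Suc (p ^ r - 1)) y = \<one>"
    using assms c_trace by (simp add: funpow_Suc_right del: funpow.simps)
  moreover have pr: "Suc (p ^ r - 1) = p ^ r" using p_ge_2 by simp
  ultimately show ?thesis using funpow_dl_pk[of t y r] assms unfolding pr by simp
qed

lemma s_mult:
  assumes "y \<in> carrier R" "dl s y = \<one>" shows "s \<otimes> y = (y \<oplus> \<one>) \<otimes> s"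
  using conj_eq_add_dl[of s y] conj_eq_iff[of s y "y \<oplus> \<one>"] assms by simp

text \<open>The defect \<open>\<tau> = y\<^sup>p - y - \<alpha>\<close> is fixed by \<open>\<sigma>\<close>, hence purely inseparable over \<open>K\<close>; adding
  \<open>\<tau> + \<tau>\<^sup>p + \<dots>\<close> to \<open>y\<close> moves it into \<open>K\<close>.\<close>

lemma ex_artin_schreier:
  assumes y: "y \<in> cent Y" "dl t y = c"
  shows "\<exists>b \<in> cent Y \<inter> cent {t}. b \<otimes> y = y \<otimes> b \<and> (y \<oplus> b) [^] p \<ominus> (y \<oplus> b) \<in> Z"
proof -
  obtain \<alpha> where \<alpha>: "\<alpha> \<in> Z" "dl t \<alpha> = c [^] p \<ominus> c" using ex_alpha by blast
  define \<tau> where "\<tau> = y [^] p \<ominus> y \<ominus> \<alpha>"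
  have yC: "y \<in> carrier R" and \<alpha>C: "\<alpha> \<in> carrier R" and cC: "c \<in> carrier R"
    using y \<alpha> c_Z ZC CC by blast+
  have cy: "c \<otimes> y = y \<otimes> c" and ay: "\<alpha> \<otimes> y = y \<otimes> \<alpha>" using Z_comm c_Z \<alpha>(1) y by auto
  have \<tau>_C: "\<tau> \<in> cent Y"
    unfolding \<tau>_def using y \<alpha> ZC subring_pow[OF C_ring] by (intro subring_minus[OF C_ring]) auto
  have conj_y: "conj t y = y \<oplus> c"
    using conj_eq_add_dl[of t y] yC y(2) by simp
  have "conj t (y [^] p) = y [^] p \<oplus> c [^] p"
    using conj_pow[of t y p] frobenius_add[OF yC cC] cy yC conj_y by simp
  moreover have "conj t \<alpha> = \<alpha> \<oplus> (c [^] p \<ominus> c)"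
    using conj_eq_add_dl[of t \<alpha>] \<alpha>C \<alpha>(2) by simp
  ultimately have "conj t \<tau> = (y [^] p \<oplus> c [^] p) \<ominus> (y \<oplus> c) \<ominus> (\<alpha> \<oplus> (c [^] p \<ominus> c))"
    unfolding \<tau>_def using conj_y yC \<alpha>C by (simp add: additive_map_diff[OF additive_map_conj])
  also have "\<dots> = \<tau>"
  proof -
    have "(q \<oplus> d) \<ominus> (y \<oplus> c) \<ominus> (\<alpha> \<oplus> (d \<ominus> c)) = q \<ominus> y \<ominus> \<alpha>"
      if "q \<in> carrier R" "d \<in> carrier R" for q d
      using that yC cC \<alpha>C by algebra
    then show ?thesis unfolding \<tau>_def using yC cC by simp
  qed
  finally have "t \<otimes> \<tau> = \<tau> \<otimes> t"
    using conj_fixed_iff[of t \<tau>] \<tau>_C by auto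
  then have \<tau>_T: "\<tau> \<in> cent {t}" using \<tau>_C by (auto simp: cent_def)
  have "\<tau> \<otimes> y = y \<otimes> \<tau>"
    unfolding \<tau>_def using yC \<alpha>C ay pow_commute[OF yC yC refl, of p]
    by (simp add: minus_eq l_distr r_distr l_minus r_minus)
  then have \<tau>_B: "\<tau> \<in> cent (insert t (insert y Y))" using \<tau>_C \<tau>_T by (auto simp: cent_def)
  \<comment> \<open>This centralizer contains \<tau> and lies in the commutative
    \<open>cent {t}\<close>, so Frobenius applies in it.\<close>
  have B_ring: "subring (cent (insert t (insert y Y))) R" (is "subring ?B R")
    using YC yC by (intro subring_cent) auto
  have B_comm: "a \<otimes> b = b \<otimes> a" if "a \<in> ?B" "b \<in> ?B" for a b
    using that by (intro t_comm) (auto simp: cent_def)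
  \<comment> \<open>Telescoping with b = \<tau> + \<tau>^p + ... + \<tau>^(p^(k - 1)); for k = M the
    power on the right lies in \<open>K\<close>.\<close>
  have "\<exists>b \<in> ?B. b [^] p \<ominus> b = \<tau> [^] (p ^ k) \<ominus> \<tau>" for k
  proof (induction k)
    case 0
    have "\<zero> [^] p \<ominus> \<zero> = \<tau> [^] (p ^ 0) \<ominus> \<tau>"
      using nat_pow_zero[of p] p_ge_2 \<tau>_C CC by (simp add: minus_eq r_neg)
    then show ?case using subringE(2)[OF B_ring] by blast
  next
    case (Suc k)
    then obtain b where b: "b \<in> ?B" "b [^] p \<ominus> b = \<tau> [^] (p ^ k) \<ominus> \<tau>" by blast
    define d where "d = \<tau> [^] (p ^ k)"
    have d: "d \<in> ?B" unfolding d_def using subring_pow[OF B_ring \<tau>_B] .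
    have C: "b \<in> carrier R" "d \<in> carrier R" "\<tau> \<in> carrier R" using b d \<tau>_B by auto
    have "(b \<oplus> d) [^] p \<ominus> (b \<oplus> d) = (b [^] p \<oplus> d [^] p) \<ominus> (b \<oplus> d)"
      using frobenius_add[OF C(1,2) B_comm[OF b(1) d]] by simp
    also have "\<dots> = (b [^] p \<ominus> b) \<oplus> (d [^] p \<ominus> d)"
      using C nat_pow_closed[of b p] nat_pow_closed[of d p] by algebra
    also have "\<dots> = d [^] p \<ominus> \<tau>"
      unfolding b(2) d_def[symmetric] using C nat_pow_closed[of d p] by algebra
    also have "d [^] p = \<tau> [^] (p ^ Suc k)"
      using C by (simp add: d_def nat_pow_pow mult.commute)
    finally show ?case using subringE(7)[OF B_ring b(1) d] by blast
  qed
  then obtain b where b: "b \<in> ?B" "b [^] p \<ominus> b = \<tau> [^] (p ^ M) \<ominus> \<tau>" by blast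
  have bC: "b \<in> carrier R" and b_C: "b \<in> cent Y" "b \<in> cent {t}" and b_y: "b \<otimes> y = y \<otimes> b"
    using b by (auto simp: cent_def)
  have \<tau>C: "\<tau> \<in> carrier R" using \<tau>_C CC by blast
  have "(y \<oplus> b) [^] p \<ominus> (y \<oplus> b) = (y [^] p \<oplus> b [^] p) \<ominus> (y \<oplus> b)"
    using frobenius_add[OF yC bC] b_y by simp
  also have "\<dots> = (y [^] p \<ominus> y) \<oplus> (b [^] p \<ominus> b)"
    using yC bC nat_pow_closed[of b p] nat_pow_closed[of y p] by algebra
  also have "y [^] p \<ominus> y = \<tau> \<oplus> \<alpha>"
    unfolding \<tau>_def using yC \<alpha>C by (simp add: diff_add_cancel)
  also have "(\<tau> \<oplus> \<alpha>) \<oplus> (b [^] p \<ominus> b) = \<alpha> \<oplus> \<tau> [^] (p ^ M)"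
    unfolding b(2) using \<tau>C \<alpha>C nat_pow_closed[of \<tau> "p ^ M"] by algebra
  also have "\<dots> \<in> Z"
    using subringE(7)[OF Z_ring \<alpha>(1)] power_pM[OF \<tau>_T] K_Z by blast
  finally show ?thesis using b_C b_y by blast
qed

subsection \<open>The two maximal subfields of the degree \<open>p\<close> algebra\<close>

context
  fixes y assumes y: "y \<in> cent Y" "dl s y = \<one>"
begin

lemma yC [simp]: "y \<in> carrier R" using y CC by blast

definition F :: "'a set" where "F = cent (insert y (insert s Y))"

lemma F_eq: "F = A \<inter> cent {y}" by (auto simp: F_def A_def cent_def)

lemma F_A: "F \<subseteq> A" by (auto simp: F_eq)

lemma F_field: "subfield F R"
  unfolding F_def
proof (rule subfield_cent)
  show "insert y (insert s Y) \<subseteq> carrier R" using YC by auto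
  show "a \<otimes> b = b \<otimes> a" if "a \<in> cent (insert y (insert s Y))" "b \<in> cent (insert y (insert s Y))" for a b
    using that A_comm F_A unfolding F_def by blast
qed

lemma A_field: "subfield A R"
  using dval_subfield[OF A_val] .

lemma FC: "x \<in> F \<Longrightarrow> x \<in> carrier R" and F_y: "x \<in> F \<Longrightarrow> x \<otimes> y = y \<otimes> x"
  and F_s: "x \<in> F \<Longrightarrow> x \<otimes> s = s \<otimes> x"
  by (auto simp: F_def cent_def)

lemma FI: "x \<in> A \<Longrightarrow> x \<otimes> y = y \<otimes> x \<Longrightarrow> x \<in> F"
  using AC by (auto simp: F_eq cent_def)

lemma K_F: "K \<subseteq> F"
  unfolding F_def using YC by (intro K_cent) auto

lemma s_A: "s \<in> A" using s_C by (intro AI) simp_all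

text \<open>Chosen so that \<open>ad q\<close> sends \<open>s\<close> to \<open>\<one>\<close>: on
  \<open>A\<close> it is differentiation with respect to \<open>s\<close>, with \<open>F\<close> as
  field of constants.\<close>

definition q :: 'a where "q = inv s \<otimes> (\<ominus> y)"

lemma qC [simp]: "q \<in> carrier R" by (simp add: q_def)

lemma s_q: "s \<otimes> q = \<ominus> y"
  using m_assoc[of s "inv s" "\<ominus> y"] by (simp add: q_def)

lemma q_s: "q \<otimes> s = \<one> \<ominus> y"
proof -
  have "q \<otimes> s = inv s \<otimes> ((\<ominus> y) \<otimes> s)" by (simp add: q_def m_assoc)
  also have "(\<ominus> y) \<otimes> s = s \<otimes> (\<one> \<ominus> y)"
    using s_mult[OF yC y(2)] by (simp add: l_distr r_distr l_minus r_minus minus_eq minus_add a_ac r_neg2)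
  also have "inv s \<otimes> (s \<otimes> (\<one> \<ominus> y)) = \<one> \<ominus> y"
    by (simp flip: m_assoc)
  finally show ?thesis .
qed

lemma ad_q_s: "ad q s = \<one>"
  unfolding ad_def q_s s_q by (simp add: minus_eq a_assoc l_neg)

lemma q_C: "q \<in> cent Y"
proof -
  have "inv s \<in> cent Y" using cent_inv[OF YC s_C] by simp
  then show ?thesis unfolding q_def using y subringE(5,6)[OF C_ring] by blast
qed

text \<open>For \<open>x\<close> commuting with \<open>s\<close>, commuting with q = - s^(-1) y and
  commuting with \<open>y\<close> are the same.\<close>

lemma ad_q_commute_iff:
  assumes "x \<in> A" shows "ad q x = \<zero> \<longleftrightarrow> x \<in> F"
proof
  have xC: "x \<in> carrier R" using assms AC by blast
  assume "ad q x = \<zero>"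
  then have "q \<otimes> x = x \<otimes> q" using ad_eq_zero_iff xC by simp
  then have "s \<otimes> q \<otimes> x = x \<otimes> (s \<otimes> q)"
    using commute_mult[of s q x] A_s[OF assms] xC by simp
  then have "y \<otimes> x = x \<otimes> y"
    unfolding s_q using xC by (simp add: l_minus r_minus) (metis add.inv_inv m_closed xC yC)
  then show "x \<in> F" using FI[OF assms] by simp
next
  assume x: "x \<in> F"
  have xC: "x \<in> carrier R" using x FC by blast
  have "inv s \<otimes> x = x \<otimes> inv s"
    using cent_inv[of "{x}" s] F_s[OF x] xC by (auto simp: cent_def)
  moreover have "(\<ominus> y) \<otimes> x = x \<otimes> (\<ominus> y)"
    using F_y[OF x] xC by (simp add: l_minus r_minus)
  ultimately have "q \<otimes> x = x \<otimes> q"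
    unfolding q_def using xC by (intro commute_mult) auto
  then show "ad q x = \<zero>" using ad_eq_zero_iff xC by simp
qed

text \<open>The derivation \<open>ad q\<close>, applied to both sides of x s = s x, produces the
  same extra summand \<open>x\<close>, which cancels.\<close>

lemma ad_q_A: "x \<in> A \<Longrightarrow> ad q x \<in> A"
proof (rule AI)
  assume x: "x \<in> A"
  have xC: "x \<in> carrier R" using x AC by blast
  show "ad q x \<in> cent Y" using ad_in_subring[OF C_ring q_C A_C[OF x]] .
  have "ad q (x \<otimes> s) = ad q x \<otimes> s \<oplus> x" "ad q (s \<otimes> x) = s \<otimes> ad q x \<oplus> x"
    using ad_mult[of q x s] ad_mult[of q s x] ad_q_s xC by (simp_all add: a_comm)
  then have "ad q x \<otimes> s \<oplus> x = s \<otimes> ad q x \<oplus> x" using A_s[OF x] by simp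
  then show "ad q x \<otimes> s = s \<otimes> ad q x" using xC by simp
qed

text \<open>ad (q^p) = (ad q)^p kills \<open>s\<close>, since \<open>ad q\<close> takes
  \<open>s\<close> to \<open>\<one>\<close> and \<open>\<one>\<close> to zero. Lying in the
  commutative \<open>A\<close>, q^p then makes \<open>ad q\<close> nilpotent on
  \<open>A\<close>.\<close>

lemma q_p_F: "q [^] p \<in> F"
proof (rule FI)
  have p2: "p = Suc (Suc (p - 2))" using p_ge_2 by simp
  have one: "ad q \<one> = \<zero>" by (simp add: ad_def)
  have "(ad q ^^ p) s = (ad q ^^ (p - 2)) (ad q (ad q s))"
    by (subst p2) (simp only: funpow_Suc_right comp_apply)
  also have "\<dots> = \<zero>"
    unfolding ad_q_s one using additive_map_zero[OF additive_map_funpow[OF additive_map_ad]] by simp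
  finally have "(ad q ^^ p) s = \<zero>" .
  then have s: "q [^] p \<otimes> s = s \<otimes> q [^] p"
    using ad_funpow_p[of q s] ad_eq_zero_iff[of "q [^] p" s] by simp
  then show "q [^] p \<in> A"
    using subring_pow[OF C_ring q_C] by (intro AI)
  have "q [^] p \<otimes> (s \<otimes> q) = (s \<otimes> q) \<otimes> q [^] p"
    using s commute_mult[of s q "q [^] p"] pow_commute[of q q p] by simp
  then show "q [^] p \<otimes> y = y \<otimes> q [^] p"
    unfolding s_q using nat_pow_closed[of q p] by (simp add: l_minus r_minus) (metis add.inv_inv m_closed nat_pow_closed qC yC)
qed

text \<open>\<open>ad q\<close> is nilpotent on \<open>A\<close> with kernel \<open>F\<close>, and
  its \<open>k\<close>-th iterate takes s^k to k!, so \<open>nilpotent_basis\<close> makes 1, s,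
  ..., s^(p - 1) a basis.\<close>

lemma A_F_dim: "dimension p F A"
proof -
  have facts: "\<And>x. x \<in> A \<Longrightarrow> ad q x \<in> A" "\<And>a x. a \<in> F \<Longrightarrow> x \<in> carrier R \<Longrightarrow> ad q (a \<otimes> x) = a \<otimes> ad q x"
    "\<And>x. x \<in> A \<Longrightarrow> ad q x = \<zero> \<longleftrightarrow> x \<in> F" "\<And>k. k < p \<Longrightarrow> s [^] k \<in> A"
    using ad_q_A ad_q_commute_iff subring_pow[OF A_ring s_A] apply auto
    subgoal premises prems for a x
    proof -
      have "ad q a = \<zero>" using ad_q_commute_iff[of a] F_A prems by blast
      then show ?thesis using ad_mult[of q a x] FC[of a] prems by simp
    qed
    done
  have top: "(ad q ^^ k) (s [^] k) \<in> F - {\<zero>}" if "k < p" for k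
  proof -
    have "(ad q ^^ k) (s [^] k) = [(fact k :: nat)] \<cdot> \<one>"
      using ad_mult[of q s] ad_q_s
      by (intro funpow_power_fact[where r = "\<lambda>x. x"] additive_map_ad)
        (auto intro!: additive_mapI simp: a_comm ad_def[of q \<one>])
    then show ?thesis
      using add_pow_nonzero[of \<one> "fact k"] not_dvd_fact[OF that] subring_add_pow[OF subfieldE(1)[OF F_field]]
        subringE(3)[OF subfieldE(1)[OF F_field]] by auto
  qed
  have nb: "x \<in> fspan F (\<lambda>i. s [^] i) p" if "x \<in> A" "(ad q ^^ p) x = \<zero>" for x
    by (rule nilpotent_basis(1)[where L = "ad q" and B = A and m = p])
      (fact F_field A_ring F_A additive_map_ad[OF qC] facts top that order_refl)+
  have dim: "dimension p F (fspan F (\<lambda>i. s [^] i) p)"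
    by (rule nilpotent_basis(3)[where L = "ad q" and B = A and m = p])
      (fact F_field A_ring F_A additive_map_ad[OF qC] facts top order_refl)+
  have "fspan F (\<lambda>i. s [^] i) p \<subseteq> A"
    using facts(4) by (intro fspan_subset[OF subfieldE(1)[OF F_field] A_ring F_A]) auto
  moreover have "A \<subseteq> fspan F (\<lambda>i. s [^] i) p"
  proof
    fix x assume x: "x \<in> A"
    have "(ad q ^^ p) x = \<zero>"
      using ad_funpow_p[of q x] ad_eq_zero_iff[of "q [^] p" x] A_comm[OF _ x, of "q [^] p"] q_p_F F_A AC[OF x] by auto
    then show "x \<in> fspan F (\<lambda>i. s [^] i) p" using nb x by blast
  qed
  ultimately have "A = fspan F (\<lambda>i. s [^] i) p" by blast
  then show ?thesis using dim by simp
qed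

text \<open>A derivation kills p-th powers: \<open>ad x\<close> maps \<open>q\<close> into the
  commutative \<open>A\<close>, a second application gives zero, and ad (x^p) q = (ad x)^p
  q.\<close>

lemma power_p_F:
  assumes x: "x \<in> A" shows "x [^] p \<in> F"
proof -
  have xC: "x \<in> carrier R" using x AC by blast
  have p2: "p = Suc (Suc (p - 2))" using p_ge_2 by simp
  have "ad x q = \<ominus> ad q x"
    using xC by (simp add: ad_def minus_eq minus_add a_comm)
  then have "ad x (ad x q) = \<zero>"
    using A_comm[OF x ad_q_A[OF x]] xC by (simp add: ad_eq_zero_iff l_minus r_minus)
  then have "(ad x ^^ p) q = \<zero>"
    using additive_map_zero[OF additive_map_funpow[OF additive_map_ad[OF xC]], of "p - 2"]
    by (subst p2) (simp only: funpow_Suc_right comp_apply)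
  then have "ad q (x [^] p) = \<zero>"
    using ad_funpow_p[of x q] xC ad_eq_zero_iff[of "x [^] p" q] ad_eq_zero_iff[of q "x [^] p"] by simp
  then show ?thesis using ad_q_commute_iff subring_pow[OF A_ring x] by blast
qed

lemma s_notin_F: "s \<notin> F"
  using ad_q_commute_iff[OF s_A] ad_q_s by simp

lemma ex_F_dim: "\<exists>m. dimension m K F \<and> n = m * p \<and> 0 < m"
proof -
  obtain m where m: "dimension m K F"
    using dimension_subspace[OF K A_dim F_A] K_F subringE(2,6,7)[OF subfieldE(1)[OF F_field]] by blast
  then have "n = m * p"
    using telescopic_base[OF K F_field m A_F_dim] dimension_is_inj[OF K A_dim] by blast
  then show ?thesis using m n_pos by (cases m) auto
qed

text \<open>Otherwise \<open>F\<close>, which contains the p-th powers of \<open>A\<close>, would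
  contain an element of value 1. Its first n powers are independent over \<open>K\<close>, whereas
  \<open>F\<close> has degree n / p.\<close>

lemma p_dvd_w_F:
  assumes f: "f \<in> F - {\<zero>}" shows "int p dvd w f"
proof (rule ccontr)
  assume ndvd: "\<not> int p dvd w f"
  have pp: "Factorial_Ring.prime (int p)" using prime_p by simp
  then have "coprime (int p) (w f)" using ndvd prime_imp_coprime by blast
  then obtain a b where ab: "a * int p + b * w f = 1"
    by (metis bezout_int coprime_imp_gcd_eq_1)
  \<comment> \<open>The Bezout coefficient of \<open>w f\<close> is reduced modulo \<open>p\<close>
    to become a natural exponent; \<open>k\<close> absorbs the change.\<close>
  define i where "i = nat (b mod int p)"
  have i: "int i = b - int p * (b div int p)"
    using p_ge_2 by (simp add: i_def minus_mult_div_eq_mod)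
  define k where "k = a + (b div int p) * w f"
  have k: "int p * k + int i * w f = 1"
    using ab unfolding k_def i by (simp add: algebra_simps)
  obtain x where x: "x \<in> A - {\<zero>}" "w x = k" using dval_surj[OF A_val] by blast
  have fA: "f \<in> A - {\<zero>}" using f F_A by blast
  define z where "z = x [^] p \<otimes> f [^] i"
  have "z \<in> F" unfolding z_def
    using power_p_F[of x] x f subring_pow[OF subfieldE(1)[OF F_field]] subringE(6)[OF subfieldE(1)[OF F_field]]
    by blast
  moreover have "z \<noteq> \<zero>" unfolding z_def
    using dval_pow[OF A_val x(1), of p] dval_pow[OF A_val fA, of i] subfieldE(5)[OF A_field] by blast
  moreover have "w z = 1" unfolding z_def
    using dval_mult[OF A_val, of "x [^] p" "f [^] i"] dval_pow[OF A_val x(1), of p] dval_pow[OF A_val fA, of i] x(2) k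
    by simp
  ultimately have z: "z \<in> F" "z \<in> A - {\<zero>}" "w z = 1" using F_A by auto
  have "dimension n K (fspan K (\<lambda>i. z [^] i) n)"
    using powers_of_uniformizer(2)[OF A_val K K_A _ z(2,3), of n] w_K by simp
  moreover have "fspan K (\<lambda>i. z [^] i) n \<subseteq> F"
    using z(1) subring_pow[OF subfieldE(1)[OF F_field]]
    by (intro fspan_subset[OF subfieldE(1)[OF K] subfieldE(1)[OF F_field] K_F]) blast
  ultimately have "n \<le> m" if "dimension m K F" for m
    using dimension_le[OF K that] by blast
  moreover obtain m where "dimension m K F" "n = m * p" "0 < m" using ex_F_dim by blast
  moreover have "m * 1 < m * p" if "0 < m" for m using that p_ge_2 by (intro mult_strict_left_mono) auto
  ultimately show False by fastforce
qed

text \<open>Powers of a uniformizer of \<open>A\<close> form a basis over \<open>F\<close>, so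
  \<open>s\<close>, not being in \<open>F\<close>, equals an element of \<open>F\<close> plus one of
  value prime to \<open>p\<close>.\<close>

lemma ex_g: "\<exists>g \<in> F. s \<ominus> g \<noteq> \<zero> \<and> \<not> int p dvd w (s \<ominus> g)"
proof -
  obtain z where z: "z \<in> A - {\<zero>}" "w z = 1" using dval_surj[OF A_val] by blast
  note pu = powers_of_uniformizer[OF A_val F_field F_A p_dvd_w_F z]
  have "fspan F (\<lambda>i. z [^] i) p \<subseteq> A"
    using z subring_pow[OF A_ring] by (intro fspan_subset[OF subfieldE(1)[OF F_field] A_ring F_A]) auto
  then have "fspan F (\<lambda>i. z [^] i) p = A"
    using dimension_subset_eq[OF F_field A_F_dim pu(2)] by blast
  then obtain g where "g \<in> F" "s = g \<or> (s \<ominus> g \<in> A - {\<zero>} \<and> 0 < w (s \<ominus> g) mod int p \<and> w (s \<ominus> g) mod int p < int p)"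
    using pu(1)[of p s] s_A by blast
  then show ?thesis using s_notin_F by (intro bexI[of _ g]) (auto simp: dvd_eq_mod_eq_0)
qed

text \<open>Values on \<open>F\<close> are divisible by \<open>p\<close>, and the p-th powers of
  \<open>A\<close> attain all multiples of \<open>p\<close>; dividing by \<open>p\<close>
  normalizes.\<close>

lemma F_val: "discrete_valuation F (\<lambda>x. w x div int p)"
  unfolding discrete_valuation_def
proof (intro conjI ballI)
  show "subfield F R" by (rule F_field)
  have "\<exists>x \<in> F - {\<zero>}. w x div int p = k" for k
  proof -
    obtain x where x: "x \<in> A - {\<zero>}" "w x = k" using dval_surj[OF A_val] by blast
    then have "x [^] p \<in> F - {\<zero>}" "w (x [^] p) div int p = k"
      using power_p_F dval_pow[OF A_val x(1), of p] p_ge_2 by auto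
    then show ?thesis by blast
  qed
  then show "(\<lambda>x. w x div int p) ` (F - {\<zero>}) = UNIV" by (auto simp: image_iff) metis
next
  fix x z assume x: "x \<in> F - {\<zero>}" and z: "z \<in> F - {\<zero>}"
  then have xz: "x \<in> A - {\<zero>}" "z \<in> A - {\<zero>}" using F_A by auto
  show "w (x \<otimes> z) div int p = w x div int p + w z div int p"
    using dval_mult[OF A_val xz] p_dvd_w_F[OF x] by (simp add: div_plus_div_distrib_dvd_left)
  have "val_ge w (min (w x) (w z)) (x \<oplus> z)"
    using A_val xz by (simp add: discrete_valuation_def)
  moreover have "min (w x div int p) (w z div int p) = min (w x) (w z) div int p"
    using p_ge_2 by (cases "w x \<le> w z") (auto simp: min_def zdiv_mono1 intro!: antisym)
  ultimately show "val_ge (\<lambda>x. w x div int p) (min (w x div int p) (w z div int p)) (x \<oplus> z)"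
    using p_ge_2 by (auto simp: val_ge_def zdiv_mono1)
qed

end

declare yC [simp del] qC [simp del]

end

text \<open>The value of \<open>d\<close> is so negative that \<open>e = d (s - g)\<close> determines the pole of \<open>u\<^sup>p - u\<close> for \<open>u = y1 + e\<close>;
  the summand \<open>b\<close> only serves to bring \<open>y2\<^sup>p - y2\<close> back into the centre of \<open>cent Y\<close>.\<close>

locale next_stage = tower_stage +
  fixes y1 g d b y2 :: 'a
  assumes y1: "y1 \<in> cent Y" "dl t y1 = c" "y1 [^] p \<ominus> y1 \<in> Z"
    and g: "g \<in> F y1" "s \<ominus> g \<noteq> \<zero>" "\<not> int p dvd w (s \<ominus> g)"
    and d: "d \<in> K - {\<zero>}" "w d + w (s \<ominus> g) < 0"
      "y1 [^] p \<ominus> y1 = \<zero> \<or> w d + w (s \<ominus> g) < w (y1 [^] p \<ominus> y1) div int p"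
      "g = \<zero> \<or> w d + w (s \<ominus> g) < w (d \<otimes> g) div int p"
    and b: "b \<in> cent Y \<inter> cent {t}" "b \<otimes> (y1 \<oplus> d \<otimes> s) = (y1 \<oplus> d \<otimes> s) \<otimes> b"
    and y2: "y2 = y1 \<oplus> d \<otimes> s \<oplus> b" "y2 [^] p \<ominus> y2 \<in> Z"
begin

lemma y1C [simp]: "y1 \<in> carrier R" using y1 CC by blast

lemma dl_y1: "dl s y1 = \<one>" using dl_s y1 by simp

abbreviation F1 :: "'a set" where "F1 \<equiv> F y1"

lemmas F1_field = F_field[OF y1(1) dl_y1]
lemmas F1_ring = subfieldE(1)[OF F1_field]

lemma F1D: "x \<in> F1 \<Longrightarrow> x \<in> carrier R" "x \<in> F1 \<Longrightarrow> x \<in> A" "x \<in> F1 \<Longrightarrow> x \<otimes> y1 = y1 \<otimes> x"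
    "x \<in> F1 \<Longrightarrow> x \<otimes> s = s \<otimes> x"
  using FC[OF y1(1) dl_y1] F_A[OF y1(1) dl_y1] F_y[OF y1(1) dl_y1] F_s[OF y1(1) dl_y1] by auto

lemma gC [simp]: "g \<in> carrier R" and dC [simp]: "d \<in> carrier R" and bC [simp]: "b \<in> carrier R"
  and y2C [simp]: "y2 \<in> carrier R"
proof -
  show 1: "g \<in> carrier R" using g F1D by blast
  show 2: "d \<in> carrier R" using d by blast
  show 3: "b \<in> carrier R" using b(1) by blast
  show "y2 \<in> carrier R" unfolding y2(1) using 1 2 3 by simp
qed

lemma d_comm: "x \<in> carrier R \<Longrightarrow> d \<otimes> x = x \<otimes> d" using K_comm d by blast

lemma d_A: "d \<in> A" using d K_A by blast

lemma d_F1: "d \<in> F1" using d K_F[OF y1(1) dl_y1] by blast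

lemma b_t: "b \<otimes> t = t \<otimes> b" using b(1) centD[of b "{t}" t] by blast

lemma b_A: "b \<in> A"
proof (rule AI)
  show "b \<in> cent Y" using b(1) by blast
  show "b \<otimes> s = s \<otimes> b" using t_s[OF _ b_t] by simp
qed

lemma ds_A: "d \<otimes> s \<in> A"
  using subringE(6)[OF A_ring d_A s_A[OF y1(1) dl_y1]] .

lemma dg_F1: "d \<otimes> g \<in> F1"
  using subringE(6)[OF F1_ring d_F1 g(1)] .

lemma y2_C: "y2 \<in> cent Y"
  unfolding y2(1) using y1(1) A_C[OF ds_A] b(1) by (intro subringE(7)[OF C_ring]) auto

lemma dl_t_y2: "dl t y2 = c"
proof -
  have "dl t (d \<otimes> s) = \<zero>"
    using dl_eq_zero_iff[of t "d \<otimes> s"] commute_mult[of d s t] d_comm[of t] pow_commute[of t t "p ^ r"] by simp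
  moreover have "dl t b = \<zero>"
    using dl_eq_zero_iff[OF t bC] b_t by simp
  moreover have "dl t y2 = dl t y1 \<oplus> dl t (d \<otimes> s) \<oplus> dl t b"
    unfolding y2(1) by (simp only: additive_map_add[OF additive_map_dl[OF t]] y1C dC sC bC m_closed a_closed)
  moreover have "dl t y1 \<in> carrier R" using dl_closed[OF t y1C] .
  ultimately show ?thesis by (simp only: r_zero y1(2))
qed

lemma dl_y2: "dl s y2 = \<one>" using dl_s dl_t_y2 by simp

lemma y2_s: "s \<otimes> y2 = (y2 \<oplus> \<one>) \<otimes> s" using s_mult dl_y2 by simp

definition e :: 'a where "e = d \<otimes> (s \<ominus> g)"
definition u :: 'a where "u = y1 \<oplus> e"
text \<open>This is u^p - u (see \<open>u_p\<close>). The summand \<open>d \<otimes> g\<close>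
  arises because the twisted Frobenius contributes d s, while \<open>u\<close> contains only e = d s
  - d g.\<close>

definition \<gamma> :: 'a where "\<gamma> = (y1 [^] p \<ominus> y1) \<oplus> e [^] p \<oplus> d \<otimes> g"
definition j :: int where "j = - (w d + w (s \<ominus> g))"

lemma s_g_A: "s \<ominus> g \<in> A - {\<zero>}"
  using g F1D s_A[OF y1(1) dl_y1] by (auto intro: subring_minus[OF A_ring])

lemma e_A: "e \<in> A - {\<zero>}" and w_e: "w e = - j"
proof -
  show "e \<in> A - {\<zero>}"
    unfolding e_def using s_g_A d d_A subringE(6)[OF A_ring] subfieldE(5)[OF dval_subfield[OF A_val], of d "s \<ominus> g"]
    by auto
  show "w e = - j"
    unfolding e_def j_def using dval_mult[OF A_val, of d "s \<ominus> g"] s_g_A d d_A by simp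
qed

lemma eC [simp]: "e \<in> carrier R" using e_A AC by blast
lemma uC [simp]: "u \<in> carrier R" by (simp add: u_def)

lemma e_eq: "e = d \<otimes> s \<ominus> d \<otimes> g" by (simp add: e_def minus_eq r_distr r_minus)

text \<open>Links \<open>u\<close>, whose pole is computed, to \<open>y2\<close>, which continues
  the tower.\<close>

lemma u_eq: "u = y2 \<ominus> b \<ominus> d \<otimes> g"
proof -
  have "y1 \<oplus> (m \<ominus> n) = y1 \<oplus> m \<oplus> b \<ominus> b \<ominus> n" if "m \<in> carrier R" "n \<in> carrier R" for m n
    using that y1C bC by algebra
  then show ?thesis unfolding u_def e_eq y2(1) by simp
qed

text \<open>Membership in \<open>Z\<close> makes this element commute with both \<open>s\<close> and
  \<open>y1\<close>.\<close>

lemma \<beta>_F1: "y1 [^] p \<ominus> y1 \<in> F1"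
proof (rule FI[OF y1(1) dl_y1])
  show "y1 [^] p \<ominus> y1 \<in> A" using y1(3) ZC Z_comm[OF _ s_C] by (intro AI) auto
  show "(y1 [^] p \<ominus> y1) \<otimes> y1 = y1 \<otimes> (y1 [^] p \<ominus> y1)" using y1 Z_comm by blast
qed

lemma e_p_F1: "e [^] p \<in> F1" using power_p_F[OF y1(1) dl_y1] e_A by blast

lemma \<gamma>_F1: "\<gamma> \<in> F1"
  unfolding \<gamma>_def using \<beta>_F1 e_p_F1 dg_F1 by (intro subringE(7)[OF F1_ring])

text \<open>As \<open>d\<close> is central, conjugation by d s also shifts \<open>y1\<close> by 1,
  so \<open>frobenius_twisted\<close> applies to y1 + d s. The remaining d g commutes with both
  \<open>y1\<close> and d s.\<close>

lemma u_p: "u [^] p = \<gamma> \<oplus> u"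
proof -
  let ?z = "d \<otimes> s" and ?h = "d \<otimes> g"
  have z: "?z \<in> carrier R" "?h \<in> carrier R" by simp_all
  have "?z \<noteq> \<zero>" using integral[of d s] d by auto
  moreover have "?z \<otimes> y1 = (y1 \<oplus> \<one>) \<otimes> ?z"
  proof -
    have "?z \<otimes> y1 = d \<otimes> ((y1 \<oplus> \<one>) \<otimes> s)"
      using s_mult[OF y1C dl_y1] by (simp add: m_assoc)
    also have "\<dots> = (y1 \<oplus> \<one>) \<otimes> ?z"
      using d_comm[of "y1 \<oplus> \<one>"] by (simp flip: m_assoc)
    finally show ?thesis .
  qed
  ultimately have 1: "(y1 \<oplus> ?z) [^] p = y1 [^] p \<oplus> ?z [^] p \<oplus> ?z"
    by (intro frobenius_twisted) simp_all
  have zh: "?z \<otimes> ?h = ?h \<otimes> ?z"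
    using A_comm[OF ds_A] F1D(2)[OF dg_F1] by simp
  have "(y1 \<oplus> ?z) \<otimes> ?h = ?h \<otimes> (y1 \<oplus> ?z)"
    using zh F1D(3)[OF dg_F1] by (simp add: l_distr r_distr)
  then have "((y1 \<oplus> ?z) \<ominus> ?h) [^] p = (y1 \<oplus> ?z) [^] p \<ominus> ?h [^] p"
    by (intro frobenius_minus) simp_all
  moreover have "(y1 \<oplus> ?z) \<ominus> ?h = u"
    unfolding u_def e_eq by (simp add: minus_eq a_assoc)
  moreover have "e [^] p = ?z [^] p \<ominus> ?h [^] p"
    unfolding e_eq using zh by (intro frobenius_minus) simp_all
  ultimately have 2: "u [^] p = y1 [^] p \<oplus> ?z [^] p \<oplus> ?z \<ominus> ?h [^] p" "e [^] p = ?z [^] p \<ominus> ?h [^] p"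
    using 1 by simp_all
  have "y' \<oplus> z' \<oplus> z'' \<ominus> h' = (y' \<ominus> y1) \<oplus> (z' \<ominus> h') \<oplus> h'' \<oplus> (y1 \<oplus> (z'' \<ominus> h''))"
    if "y' \<in> carrier R" "z' \<in> carrier R" "z'' \<in> carrier R" "h' \<in> carrier R" "h'' \<in> carrier R"
    for y' z' z'' h' h''
    using that y1C by algebra
  then have "u [^] p = (y1 [^] p \<ominus> y1) \<oplus> (?z [^] p \<ominus> ?h [^] p) \<oplus> ?h \<oplus> (y1 \<oplus> (?z \<ominus> ?h))"
    unfolding 2(1) by simp
  also have "y1 \<oplus> (?z \<ominus> ?h) = u" by (simp add: u_def e_eq)
  finally show ?thesis unfolding \<gamma>_def 2(2) .
qed

text \<open>\<open>w d\<close> is a multiple of \<open>n\<close>, hence of \<open>p\<close>, and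
  leaves the residue of w (s - g) unchanged.\<close>

lemma j: "0 < j" "\<not> int p dvd j"
proof -
  show "0 < j" using d by (simp add: j_def)
  obtain m where "n = m * p" using ex_F_dim[OF y1(1) dl_y1] by blast
  then have "int p dvd w d" using w_K[OF d(1)] by simp
  then show "\<not> int p dvd j" unfolding j_def dvd_minus_iff using g(3) dvd_add_right_iff by blast
qed

text \<open>The normalized value of e^p on \<open>F1\<close> is w e = - j, and \<open>d\<close> was
  chosen to give the other two summands larger values.\<close>

lemma \<gamma>_val: "\<gamma> \<noteq> \<zero>" "w \<gamma> div int p = - j"
proof -
  let ?w = "\<lambda>x. w x div int p"
  note F1_val = F_val[OF y1(1) dl_y1]
  have "w (e [^] p) = int p * (- j)" using dval_pow[OF A_val e_A, of p] w_e by simp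
  then have "?w (e [^] p) = - j"
    using p_ge_2 nonzero_mult_div_cancel_left[of "int p" "- j"] by simp
  then have e: "e [^] p \<in> F1 - {\<zero>}" "?w (e [^] p) = - j"
    using e_p_F1 dval_pow[OF A_val e_A, of p] by auto
  have 1: "e [^] p \<oplus> (y1 [^] p \<ominus> y1) \<in> F1 - {\<zero>}" "?w (e [^] p \<oplus> (y1 [^] p \<ominus> y1)) = - j"
    using dval_add_less[OF F1_val e(1) \<beta>_F1] e(2) d(3) by (auto simp: j_def)
  have "d \<otimes> g = \<zero> \<or> - j < ?w (d \<otimes> g)"
    using d(4) by (auto simp: j_def)
  then have 2: "e [^] p \<oplus> (y1 [^] p \<ominus> y1) \<oplus> d \<otimes> g \<in> F1 - {\<zero>}"
    "?w (e [^] p \<oplus> (y1 [^] p \<ominus> y1) \<oplus> d \<otimes> g) = - j"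
    using dval_add_less[OF F1_val 1(1) dg_F1] 1(2) by auto
  have "\<gamma> = e [^] p \<oplus> (y1 [^] p \<ominus> y1) \<oplus> d \<otimes> g"
    unfolding \<gamma>_def by (simp add: a_comm[of "y1 [^] p \<ominus> y1"])
  then show "\<gamma> \<noteq> \<zero>" "?w \<gamma> = - j" using 2 by simp_all
qed

lemma dl_u: "dl s u = \<one>"
proof -
  have "dl s e = \<zero>" using dl_eq_zero_iff[of s e] A_s[of e] e_A by simp
  then show ?thesis
    unfolding u_def using dl_y1 additive_map_add[OF additive_map_dl, of s y1 e] by simp
qed

lemma u_F1: "a \<in> F1 \<Longrightarrow> u \<otimes> a = a \<otimes> u"
proof -
  assume a: "a \<in> F1"
  have "e \<otimes> a = a \<otimes> e" using A_comm[of e a] e_A F1D(2)[OF a] by blast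
  then show ?thesis unfolding u_def using F1D[OF a] by (simp add: l_distr r_distr)
qed

lemma artin_schreier_pole: "artin_schreier_pole R p F1 (\<lambda>x. w x div int p) u \<gamma> s j"
  using F_val[OF y1(1) dl_y1] u_F1 F1D dl_u u_p \<gamma>_F1 \<gamma>_val j by unfold_locales auto

subsection \<open>The next maximal subfield\<close>

definition Y' :: "'a set" where "Y' = insert y2 Y"
definition A' :: "'a set" where "A' = cent (insert (s [^] p) Y')"

lemma Y'C: "Y' \<subseteq> carrier R" using YC by (auto simp: Y'_def)

lemma A'_ring: "subring A' R" unfolding A'_def using Y'C by (intro subring_cent) auto

lemma A'_eq: "A' = cent Y \<inter> cent {y2} \<inter> cent {s [^] p}"
  unfolding A'_def Y'_def cent_insert[of "s [^] p" "insert y2 Y"] cent_insert[of y2 Y] by blast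

lemma cent_single: "x \<in> cent {z} \<longleftrightarrow> x \<in> carrier R \<and> x \<otimes> z = z \<otimes> x"
  by (simp add: cent_def)

lemma A'I: "x \<in> cent Y \<Longrightarrow> x \<otimes> y2 = y2 \<otimes> x \<Longrightarrow> x \<otimes> s [^] p = s [^] p \<otimes> x \<Longrightarrow> x \<in> A'"
  unfolding A'_eq using CC by (simp add: cent_single)

lemma A'D: "x \<in> A' \<Longrightarrow> x \<in> carrier R" "x \<in> A' \<Longrightarrow> x \<in> cent Y" "x \<in> A' \<Longrightarrow> x \<otimes> y2 = y2 \<otimes> x"
    "x \<in> A' \<Longrightarrow> x \<otimes> s [^] p = s [^] p \<otimes> x"
  unfolding A'_eq by (simp_all add: cent_single)

lemma sp_comm: "x \<in> carrier R \<Longrightarrow> x \<otimes> s = s \<otimes> x \<Longrightarrow> x \<otimes> s [^] p = s [^] p \<otimes> x"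
  using pow_commute[of s x p] by simp

lemma y2_sp: "y2 \<otimes> s [^] p = s [^] p \<otimes> y2"
proof -
  have p2: "p = Suc (Suc (p - 2))" using p_ge_2 by simp
  have "dl s \<one> = \<zero>" using dl_eq_zero_iff[of s \<one>] by simp
  then have "(dl s ^^ p) y2 = \<zero>"
    using additive_map_zero[OF additive_map_funpow[OF additive_map_dl[OF sC s_nz]], of "p - 2"] dl_y2
    by (subst p2) (simp only: funpow_Suc_right comp_apply)
  moreover have "s [^] p \<noteq> \<zero>" using pow_nonzero[OF sC s_nz] .
  ultimately have "s [^] p \<otimes> y2 = y2 \<otimes> s [^] p"
    using funpow_dl_pk[OF sC s_nz y2C, of 1] dl_eq_zero_iff[of "s [^] p" y2] by simp
  then show ?thesis by (rule sym)
qed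

text \<open>\<open>y1\<close> and \<open>y2\<close> differ by an element of the commutative
  \<open>A\<close>, so \<open>F1\<close> is attached to \<open>y2\<close> as well.\<close>

lemma A_y2_iff: "x \<in> A \<Longrightarrow> x \<otimes> y2 = y2 \<otimes> x \<longleftrightarrow> x \<in> F1"
proof -
  assume x: "x \<in> A"
  have xC: "x \<in> carrier R" using x AC by blast
  have "x \<otimes> (d \<otimes> s \<oplus> b) = (d \<otimes> s \<oplus> b) \<otimes> x"
    using A_comm[OF x subringE(7)[OF A_ring ds_A b_A]] .
  then have "x \<otimes> y2 = y2 \<otimes> x \<longleftrightarrow> x \<otimes> y1 \<oplus> x \<otimes> (d \<otimes> s \<oplus> b) = y1 \<otimes> x \<oplus> x \<otimes> (d \<otimes> s \<oplus> b)"
    unfolding y2(1) using xC by (simp add: a_assoc l_distr r_distr)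
  also have "\<dots> \<longleftrightarrow> x \<otimes> y1 = y1 \<otimes> x" using xC by simp
  also have "\<dots> \<longleftrightarrow> x \<in> F1" using FI[OF y1(1) dl_y1 x] F1D(3) by blast
  finally show ?thesis .
qed

lemma F1_A': "F1 \<subseteq> A'"
proof
  fix x assume x: "x \<in> F1"
  note X = F1D[OF x]
  show "x \<in> A'" using A_C[OF X(2)] A_y2_iff[OF X(2)] x sp_comm[OF X(1,4)] by (intro A'I) auto
qed

lemma dl_zero_A': "x \<in> A' \<Longrightarrow> dl s x = \<zero> \<longleftrightarrow> x \<in> F1"
proof -
  assume x: "x \<in> A'"
  note X = A'D[OF x]
  have "dl s x = \<zero> \<longleftrightarrow> x \<in> A"
    unfolding dl_eq_zero_iff[OF sC s_nz X(1)] using AI[OF X(2)] A_s[of x] by metis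
  then show ?thesis using A_y2_iff[of x] X(3) F1D(2)[of x] by blast
qed

lemma y2_A': "y2 \<in> A'" using y2_C y2_sp by (intro A'I) simp_all

lemma b_A': "b \<in> A'"
proof (rule A'I)
  show "b \<in> cent Y" using b(1) by blast
  show "b \<otimes> y2 = y2 \<otimes> b" unfolding y2(1) using b(2) by (simp add: l_distr r_distr)
  show "b \<otimes> s [^] p = s [^] p \<otimes> b" using sp_comm[OF bC A_s[OF b_A]] .
qed

lemma u_A': "u \<in> A'"
  unfolding u_eq using y2_A' b_A' F1_A' dg_F1 by (intro subring_minus[OF A'_ring]) auto

text \<open>Applied to x y2 = y2 x, the map \<open>dl s\<close> yields the extra summand x + dl s x
  on both sides.\<close>

lemma dl_A': "x \<in> A' \<Longrightarrow> dl s x \<in> A'"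
proof (rule A'I)
  assume x: "x \<in> A'"
  note X = A'D[OF x]
  have "inv s \<in> cent Y" using cent_inv[OF YC s_C] by simp
  then have "conj s x \<in> cent Y"
    unfolding conj_def using s_C X(2) by (intro subringE(6)[OF C_ring])
  then show "dl s x \<in> cent Y" unfolding dl_def using X(2) by (intro subring_minus[OF C_ring])
  have "dl s (x \<otimes> y2) = x \<oplus> dl s x \<otimes> conj s y2"
    using dl_mult[of s x y2] X(1) dl_y2 by simp
  also have "conj s y2 = y2 \<oplus> \<one>" using conj_eq_add_dl[of s y2] dl_y2 by simp
  finally have 1: "dl s (x \<otimes> y2) = (x \<oplus> dl s x) \<oplus> dl s x \<otimes> y2"
    using X(1) by (simp add: r_distr a_ac)
  have "dl s (y2 \<otimes> x) = y2 \<otimes> dl s x \<oplus> conj s x"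
    using dl_mult[of s y2 x] X(1) dl_y2 by simp
  also have "conj s x = x \<oplus> dl s x" using conj_eq_add_dl[of s x] X(1) by simp
  finally have 2: "dl s (y2 \<otimes> x) = (x \<oplus> dl s x) \<oplus> y2 \<otimes> dl s x"
    using X(1) by (simp add: a_comm)
  show "dl s x \<otimes> y2 = y2 \<otimes> dl s x"
    using 1 2 X(1,3) by simp
  have "conj s x \<otimes> s [^] p = s [^] p \<otimes> conj s x"
    using conj_mult[of s x "s [^] p"] conj_mult[of s "s [^] p" x] X(1,4)
      conj_pow[of s s p] conj_fixed_iff[of s s] by simp
  then show "dl s x \<otimes> s [^] p = s [^] p \<otimes> dl s x"
    unfolding dl_def using X(1,4) by (simp add: minus_eq l_distr r_distr l_minus r_minus)
qed

text \<open>Mirror image of \<open>A_F_dim\<close>, with \<open>dl s\<close> for \<open>ad q\<close>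
  and \<open>u\<close> for \<open>s\<close>. The p-th iterate of \<open>dl s\<close> vanishes on
  \<open>A'\<close> because its elements commute with s^p.\<close>

lemma A'_span: "A' = fspan F1 (\<lambda>i. u [^] i) p" and A'_F1_dim: "dimension p F1 A'"
proof -
  have lin: "dl s (a \<otimes> x) = a \<otimes> dl s x" if "a \<in> F1" "x \<in> carrier R" for a x
    using dl_lin[of s a x] F1D[OF that(1)] that(2) by simp
  have uk: "u [^] k \<in> A'" if "k < p" for k :: nat using subring_pow[OF A'_ring u_A'] .
  have top: "(dl s ^^ k) (u [^] k) \<in> F1 - {\<zero>}" if "k < p" for k
    using funpow_dl_power[of s u k] dl_u add_pow_nonzero[of \<one> "fact k"] not_dvd_fact[OF that]
      subring_add_pow[OF F1_ring subringE(3)[OF F1_ring]] by auto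
  have nb: "x \<in> fspan F1 (\<lambda>i. u [^] i) p" if "x \<in> A'" "(dl s ^^ p) x = \<zero>" for x
    by (rule nilpotent_basis(1)[where L = "dl s" and B = A' and m = p])
      (fact F1_field A'_ring F1_A' additive_map_dl[OF sC s_nz] dl_A' lin dl_zero_A' uk top that order_refl)+
  have dim: "dimension p F1 (fspan F1 (\<lambda>i. u [^] i) p)"
    by (rule nilpotent_basis(3)[where L = "dl s" and B = A' and m = p])
      (fact F1_field A'_ring F1_A' additive_map_dl[OF sC s_nz] dl_A' lin dl_zero_A' uk top order_refl)+
  have "fspan F1 (\<lambda>i. u [^] i) p \<subseteq> A'"
    using uk by (intro fspan_subset[OF F1_ring A'_ring F1_A']) auto
  moreover have "A' \<subseteq> fspan F1 (\<lambda>i. u [^] i) p"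
  proof
    fix x assume x: "x \<in> A'"
    have "dl (s [^] p) x = \<zero>"
      using dl_eq_zero_iff[of "s [^] p" x] pow_nonzero[OF sC s_nz, of p] A'D(1,4)[OF x] by simp
    then have "(dl s ^^ p) x = \<zero>"
      using funpow_dl_pk[OF sC s_nz A'D(1)[OF x], of 1] by simp
    then show "x \<in> fspan F1 (\<lambda>i. u [^] i) p" using nb x by blast
  qed
  ultimately show "A' = fspan F1 (\<lambda>i. u [^] i) p" by blast
  then show "dimension p F1 A'" using dim by simp
qed

text \<open>The span lies in the centralizer of its generators, so the generators centralize
  \<open>A'\<close>, and then so does their span.\<close>

lemma A'_comm: "x \<in> A' \<Longrightarrow> z \<in> A' \<Longrightarrow> x \<otimes> z = z \<otimes> x"
proof -
  assume x: "x \<in> A'" and z: "z \<in> A'"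
  have FF: "f \<otimes> f' = f' \<otimes> f" if "f \<in> F1" "f' \<in> F1" for f f'
    using A_comm F1D(2) that by blast
  have B: "insert u F1 \<subseteq> carrier R" using F1D by auto
  have "F1 \<subseteq> cent (insert u F1)" "u \<in> cent (insert u F1)"
    using FF F1D u_F1 by (auto intro!: centI)
  then have "fspan F1 (\<lambda>i. u [^] i) p \<subseteq> cent (insert u F1)"
    using subring_pow[OF subring_cent[OF B]] by (intro fspan_subset[OF F1_ring subring_cent[OF B]]) auto
  then have 1: "A' \<subseteq> cent (insert u F1)" using A'_span by simp
  have A'C: "A' \<subseteq> carrier R" using A'D by blast
  have "f \<in> cent A'" if f: "f \<in> insert u F1" for f
  proof (rule centI)
    show "f \<in> carrier R" using f B by blast
    show "f \<otimes> x' = x' \<otimes> f" if "x' \<in> A'" for x'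
      using that 1 f centD[of x' "insert u F1" f] by auto
  qed
  then have "F1 \<subseteq> cent A'" "u \<in> cent A'" by blast+
  then have "fspan F1 (\<lambda>i. u [^] i) p \<subseteq> cent A'"
    using subring_pow[OF subring_cent[OF A'C]] by (intro fspan_subset[OF F1_ring subring_cent[OF A'C]]) auto
  then show "x \<otimes> z = z \<otimes> x" using A'_span x z centD by blast
qed

lemma A'_field: "subfield A' R"
  unfolding A'_def
proof (rule subfield_cent)
  show "insert (s [^] p) Y' \<subseteq> carrier R" using Y'C by simp
qed (fold A'_def, rule A'_comm)

lemma A'_dim: "dimension n K A'"
  using ex_F_dim[OF y1(1) dl_y1] telescopic_base[OF K F1_field _ A'_F1_dim] by blast

text \<open>On \<open>K\<close> the extension multiplies by \<open>p\<close> what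
  \<open>F_val\<close> divided by \<open>p\<close>, so the index over \<open>K\<close> remains
  \<open>n\<close>.\<close>

lemma ex_A'_val: "\<exists>w'. discrete_valuation A' w' \<and> (\<forall>x \<in> K - {\<zero>}. w' x = int n * v x)"
proof -
  interpret AS: artin_schreier_pole R p F1 "\<lambda>x. w x div int p" u \<gamma> s j
    by (rule artin_schreier_pole)
  have "AS.ext_val x = int n * v x" if x: "x \<in> K - {\<zero>}" for x
  proof -
    have xF: "x \<in> F1 - {\<zero>}" using x K_F[OF y1(1) dl_y1] by blast
    then show ?thesis
      using AS.ext_val_F[OF A'_field A'_span xF] p_dvd_w_F[OF y1(1) dl_y1 xF] w_K[OF x] by simp
  qed
  then show ?thesis using AS.discrete_valuation_ext_val[OF A'_field A'_span] by blast
qed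

lemma c_C: "c \<in> cent Y" and cC [simp]: "c \<in> carrier R" using c_Z ZC CC by auto

lemma cent_Y': "cent Y' = cent Y \<inter> cent {y2}"
  unfolding Y'_def by (rule cent_insert)

lemma cent_Y'I: "x \<in> cent Y \<Longrightarrow> x \<otimes> y2 = y2 \<otimes> x \<Longrightarrow> x \<in> cent Y'"
  unfolding cent_Y' using CC by (simp add: cent_single)

lemma cent_Y'D: "x \<in> cent Y' \<Longrightarrow> x \<in> carrier R" "x \<in> cent Y' \<Longrightarrow> x \<in> cent Y"
    "x \<in> cent Y' \<Longrightarrow> x \<otimes> y2 = y2 \<otimes> x"
  unfolding cent_Y' by (simp_all add: cent_single)

lemma conj_y2: "conj t y2 = y2 \<oplus> c"
  using conj_eq_add_dl[of t y2] dl_t_y2 by simp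

lemma c_comm: "x \<in> cent Y \<Longrightarrow> x \<otimes> c = c \<otimes> x" using Z_comm[OF c_Z] by simp

lemma conj_Y': "x \<in> cent Y' \<Longrightarrow> conj t x \<in> cent Y'"
proof (rule cent_Y'I)
  assume x: "x \<in> cent Y'"
  note X = cent_Y'D[OF x]
  show 1: "conj t x \<in> cent Y" using conj_C X by blast
  have "conj t x \<otimes> (y2 \<oplus> c) = (y2 \<oplus> c) \<otimes> conj t x"
    using conj_mult[of t x y2] conj_mult[of t y2 x] X conj_y2 by simp
  then have "conj t x \<otimes> y2 \<oplus> c \<otimes> conj t x = y2 \<otimes> conj t x \<oplus> c \<otimes> conj t x"
    using X(1) c_comm[OF 1] by (simp add: l_distr r_distr)
  then show "conj t x \<otimes> y2 = y2 \<otimes> conj t x" using X(1) by simp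
qed

lemma ny2C [simp]: "\<ominus> y2 \<in> carrier R" by simp

text \<open>y2^p and \<open>y2\<close> differ by an element of \<open>Z\<close>, invisible to
  \<open>ad\<close> on \<open>cent Y\<close>. This is the purpose of the condition on y2^p - y2: it
  makes \<open>wproj\<close> a projection onto the centralizer of \<open>y2\<close>.\<close>

lemma ad_ny2_p: "x \<in> cent Y \<Longrightarrow> (ad (\<ominus> y2) ^^ p) x = ad (\<ominus> y2) x"
proof -
  assume x: "x \<in> cent Y"
  define \<beta> where "\<beta> = y2 [^] p \<ominus> y2"
  have \<beta>: "\<beta> \<in> carrier R" "\<beta> \<otimes> x = x \<otimes> \<beta>"
    using y2(2) Z_comm[OF _ x] ZC CC unfolding \<beta>_def by auto
  have "(\<zero> \<ominus> y2) [^] p = \<zero> [^] p \<ominus> y2 [^] p" by (intro frobenius_minus) simp_all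
  moreover have "\<zero> [^] p = \<zero>" using nat_pow_zero[of p] p_ge_2 by simp
  ultimately have "(\<ominus> y2) [^] p = \<ominus> (y2 [^] p)" by (simp add: minus_eq)
  also have "y2 [^] p = y2 \<oplus> \<beta>" unfolding \<beta>_def using diff_add_cancel[of "y2 [^] p" y2] by (simp add: a_comm)
  finally have "(\<ominus> y2) [^] p = \<ominus> y2 \<oplus> \<ominus> \<beta>" using \<beta> by (simp add: minus_add)
  moreover have "ad (\<ominus> \<beta>) x = \<zero>"
    using \<beta> CC[OF x] by (simp add: ad_eq_zero_iff l_minus r_minus)
  ultimately show ?thesis
    using ad_funpow_p[of "\<ominus> y2" x] ad_add_left[of "\<ominus> y2" "\<ominus> \<beta>" x] \<beta> CC[OF x] by simp
qed

text \<open>\<sigma> moves \<open>y2\<close> by \<open>c\<close>, which is central in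
  \<open>cent Y\<close> and so does not affect \<open>ad\<close>.\<close>

lemma dl_ad: "x \<in> cent Y \<Longrightarrow> dl t (ad (\<ominus> y2) x) = ad (\<ominus> y2) (dl t x)"
proof -
  assume x: "x \<in> cent Y"
  have xC: "x \<in> carrier R" using x CC by blast
  have "conj t (ad (\<ominus> y2) x) = ad (\<ominus> y2 \<oplus> \<ominus> c) (conj t x)"
    unfolding ad_def using xC conj_mult[of t "\<ominus> y2" x] conj_mult[of t x "\<ominus> y2"] conj_y2
    by (simp add: additive_map_diff[OF additive_map_conj] additive_map_uminus[OF additive_map_conj] minus_add)
  also have "\<dots> = ad (\<ominus> y2) (conj t x)"
    using ad_add_left[of "\<ominus> y2" "\<ominus> c" "conj t x"] xC c_comm[OF conj_C[OF x]] ad_eq_zero_iff[of "\<ominus> c" "conj t x"]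
    by (simp add: l_minus r_minus)
  finally show ?thesis
    unfolding dl_def using xC additive_map_diff[OF additive_map_ad[OF ny2C]] by simp
qed

text \<open>A solution in \<open>cent Y\<close> is projected by \<open>wproj\<close>, which commutes
  with \<open>dl t\<close> on it and fixes \<open>z\<close>.\<close>

lemma solve_Y': "z \<in> cent Y' \<Longrightarrow> (dl t ^^ N) z = \<zero> \<Longrightarrow> \<exists>x \<in> cent Y'. dl t x = z"
proof -
  assume z: "z \<in> cent Y'" "(dl t ^^ N) z = \<zero>"
  obtain x where x: "x \<in> cent Y" "dl t x = z" using solve_C[of z] z cent_Y'D by blast
  have pw: "(ad (\<ominus> y2) ^^ k) x \<in> cent Y" for k
    by (induction k) (use x ad_in_subring[OF C_ring] subringE(5)[OF C_ring y2_C] in auto)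
  have dl: "dl t ((ad (\<ominus> y2) ^^ k) x) = (ad (\<ominus> y2) ^^ k) z" for k
    by (induction k) (use x dl_ad[OF pw] in auto)
  have p1: "p = Suc (p - 1)" using p_ge_2 by simp
  have xC: "x \<in> carrier R" using x CC by blast
  show ?thesis
  proof (rule bexI)
    show "wproj (\<ominus> y2) x \<in> cent Y'"
    proof (rule cent_Y'I)
      show 1: "wproj (\<ominus> y2) x \<in> cent Y"
        unfolding wproj_def using x(1) pw by (intro subring_minus[OF C_ring])
      have "ad (\<ominus> y2) (wproj (\<ominus> y2) x) = ad (\<ominus> y2) x \<ominus> (ad (\<ominus> y2) ^^ Suc (p - 1)) x"
        unfolding wproj_def using additive_map_diff[OF additive_map_ad[OF ny2C]] xC CC[OF pw] by simp
      also have "\<dots> = \<zero>" using ad_ny2_p[OF x(1)] p1 xC by simp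
      finally have "(\<ominus> y2) \<otimes> wproj (\<ominus> y2) x = wproj (\<ominus> y2) x \<otimes> (\<ominus> y2)"
        using ad_eq_zero_iff CC[OF 1] by simp
      then show "wproj (\<ominus> y2) x \<otimes> y2 = y2 \<otimes> wproj (\<ominus> y2) x"
        using CC[OF 1] by (simp add: l_minus r_minus) (metis add.inv_inv m_closed y2C)
    qed
    have "dl t (wproj (\<ominus> y2) x) = wproj (\<ominus> y2) z"
      unfolding wproj_def using additive_map_diff[OF additive_map_dl[OF t]] xC CC[OF pw] dl x(2) by simp
    also have "\<dots> = z"
    proof -
      have "weight (\<ominus> y2) 0 z"
        using weight_0_iff cent_Y'D[OF z(1)] by (simp add: l_minus r_minus)
      from wproj_weight[OF ny2C this] show ?thesis by simp
    qed
    finally show "dl t (wproj (\<ominus> y2) x) = z" .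
  qed
qed

text \<open>The witness is c y2^(p - 1) / (p - 1)!. The new trace is (dl t)^(p^r - 1) after (dl
  s)^(p - 1); the latter turns y2^(p - 1) into (p - 1)!, leaving the trace of
  \<open>c\<close>.\<close>

lemma ex_c': "\<exists>c'. c' \<in> cent Y' \<inter> cent (cent Y') \<and> (dl t ^^ (p ^ Suc r - 1)) c' = \<one>"
proof -
  have "\<not> p dvd fact (p - 1)" using not_dvd_fact p_ge_2 by simp
  then obtain k :: nat where k: "\<And>x. x \<in> carrier R \<Longrightarrow> [k] \<cdot> ([(fact (p - 1) :: nat)] \<cdot> x) = x"
    using add_pow_inverse by blast
  let ?Z = "cent (Y' \<union> cent Y')"
  have Z': "cent Y' \<inter> cent (cent Y') = ?Z" by (auto simp: cent_def)
  have Z'_ring: "subring ?Z R" using Y'C cent_subset_carrier by (intro subring_cent) blast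
  have "y2 \<in> cent Y'" "c \<in> cent Y'"
    using y2_C c_C c_comm[OF y2_C] by (auto intro: cent_Y'I)
  moreover have "y2 \<in> cent (cent Y')" "c \<in> cent (cent Y')"
    using cent_Y'D(2,3) c_comm by (auto intro!: centI simp del: cent_Y' dest: sym)
  ultimately have "y2 \<in> ?Z" and "c \<in> ?Z"
    unfolding Z'[symmetric] by blast+
  then have mem: "[k] \<cdot> (c \<otimes> y2 [^] (p - 1)) \<in> ?Z"
    using subring_pow[OF Z'_ring] subring_add_pow[OF Z'_ring] subringE(6)[OF Z'_ring] by blast
  have it: "((dl t ^^ (p ^ r)) ^^ m) x = (dl s ^^ m) x" if "x \<in> carrier R" for m x
    using that funpow_dl_pk[of t _ r]
    by (intro funpow_cong_on additive_map_funpow additive_map_dl) simp_all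
  have "(dl s ^^ (p - 1)) (c \<otimes> y2 [^] (p - 1)) = c \<otimes> ([(fact (p - 1) :: nat)] \<cdot> \<one>)"
    using funpow_dl_lin[of s c "y2 [^] (p - 1)" "p - 1"] funpow_dl_power[of s y2 "p - 1"] dl_y2 c_comm[OF s_C] by simp
  also have "\<dots> = [(fact (p - 1) :: nat)] \<cdot> c" by (simp add: add_pow_rdistr)
  finally have "(dl s ^^ (p - 1)) ([k] \<cdot> (c \<otimes> y2 [^] (p - 1))) = c"
    using additive_map_add_pow[OF additive_map_funpow[OF additive_map_dl[OF sC s_nz]], of "c \<otimes> y2 [^] (p - 1)" "p - 1" k] k[of c]
    by simp
  then have *: "((dl t ^^ (p ^ r)) ^^ (p - 1)) ([k] \<cdot> (c \<otimes> y2 [^] (p - 1))) = c"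
    using it by simp
  have "p ^ Suc r - 1 = (p ^ r - 1) + p ^ r * (p - 1)"
    using p_ge_2 by (simp add: algebra_simps diff_mult_distrib2)
  then have "(dl t ^^ (p ^ Suc r - 1)) ([k] \<cdot> (c \<otimes> y2 [^] (p - 1))) = (dl t ^^ (p ^ r - 1)) c"
    using * by (simp add: funpow_add funpow_mult mult.commute)
  then have "(dl t ^^ (p ^ Suc r - 1)) ([k] \<cdot> (c \<otimes> y2 [^] (p - 1))) = \<one>"
    using c_trace by (rule trans)
  then show ?thesis using mem unfolding Z' by (intro exI conjI)
qed

lemma sp_eq: "t [^] (p ^ Suc r) = s [^] p"
  by (simp add: nat_pow_pow mult.commute)

lemma sp_Y': "s [^] p \<in> cent Y'"
  using subring_pow[OF C_ring s_C] y2_sp by (intro cent_Y'I) simp_all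

text \<open>\<open>s\<close> has weight 1 under \<open>ad (\<ominus> y2)\<close>, so
  \<open>wproj\<close> keeps just the monomials a s^k with p | k, and it fixes what commutes with
  \<open>y2\<close>. Allowing \<open>n\<close> generators at every stage avoids counting
  them.\<close>

lemma T_Y': "cent Y' \<inter> cent {t} \<subseteq> fspan K (\<lambda>i. (s [^] p) [^] i) n"
proof
  fix x assume x: "x \<in> cent Y' \<inter> cent {t}"
  have Kr: "subring K R" using subfieldE(1)[OF K] .
  have ws: "weight (\<ominus> y2) 1 s"
  proof -
    have "ad (\<ominus> y2) s = s \<otimes> y2 \<ominus> y2 \<otimes> s" by (simp add: ad_def l_minus r_minus minus_eq a_comm)
    also have "\<dots> = s" unfolding y2_s by (simp add: l_distr a_comm[of "y2 \<otimes> s"] add_diff_cancel)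
    finally show ?thesis by (simp add: weight_def)
  qed
  have sub: "fspan K (\<lambda>i. (s [^] p) [^] i) k \<subseteq> carrier R" for k
    by (rule fspan_subset_carrier[OF Kr]) simp
  have "wproj (\<ominus> y2) z \<in> fspan K (\<lambda>i. (s [^] p) [^] i) k" if "z \<in> fspan K (\<lambda>i. s [^] i) k" for z k
    using that
  proof (induction k arbitrary: z)
    case 0
    then show ?case using additive_map_zero[OF additive_map_wproj[OF ny2C]] by simp
  next
    case (Suc k)
    obtain a z' where *: "a \<in> K" "z' \<in> fspan K (\<lambda>i. s [^] i) k" "z = a \<otimes> s [^] k \<oplus> z'"
      using Suc.prems unfolding fspan_Suc_iff by blast
    have aC: "a \<in> carrier R" using * by blast
    have z'C: "z' \<in> carrier R"
      using * fspan_subset_carrier[OF Kr, of k "\<lambda>i. s [^] i"] by auto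
    have "weight (\<ominus> y2) 0 a" using weight_0_iff K_comm[OF *(1)] aC by simp
    then have "weight (\<ominus> y2) (0 + k * 1) (a \<otimes> s [^] k)"
      using weight_power[OF ny2C ws, of k] by (rule weight_mult[OF ny2C])
    from wproj_weight[OF ny2C this] have "wproj (\<ominus> y2) (a \<otimes> s [^] k) = (if p dvd k then a \<otimes> s [^] k else \<zero>)"
      by simp
    moreover have "(if p dvd k then a \<otimes> s [^] k else \<zero>) \<in> fspan K (\<lambda>i. (s [^] p) [^] i) (Suc k)"
    proof (cases "p dvd k")
      case True
      then obtain l where l: "k = p * l" by blast
      have "1 * l \<le> p * l" using p_ge_2 by (intro mult_right_mono) auto
      then have "l < Suc k" unfolding l by linarith
      then have "(s [^] p) [^] l \<in> fspan K (\<lambda>i. (s [^] p) [^] i) (Suc k)"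
        using fspan_power_mem[OF Kr, of "\<lambda>i. (s [^] p) [^] i" l] by (simp del: fspan.simps)
      then have "a \<otimes> (s [^] p) [^] l \<in> fspan K (\<lambda>i. (s [^] p) [^] i) (Suc k)"
        by (intro fspan_smult[OF Kr _ *(1)]) simp_all
      moreover have "(s [^] p) [^] l = s [^] k" unfolding l using nat_pow_pow[OF sC, of p l] .
      ultimately show ?thesis using True by simp
    next
      case False
      then show ?thesis using fspan_zero[OF Kr, of "Suc k" "\<lambda>i. (s [^] p) [^] i"] by (simp del: fspan.simps)
    qed
    moreover have "wproj (\<ominus> y2) z' \<in> fspan K (\<lambda>i. (s [^] p) [^] i) (Suc k)"
      using Suc.IH[OF *(2)] fspan_Suc_mono[OF Kr, of k "\<lambda>i. (s [^] p) [^] i"] by auto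
    ultimately show ?case
      unfolding *(3) using additive_map_add[OF additive_map_wproj[OF ny2C], of "a \<otimes> s [^] k" z'] aC z'C
        fspan_add[OF Kr, of "Suc k" "\<lambda>i. (s [^] p) [^] i"] by (simp del: fspan.simps)
  qed
  moreover have "x \<in> fspan K (\<lambda>i. s [^] i) n" using C_T x cent_Y'D(2) by blast
  moreover have "wproj (\<ominus> y2) x = x"
  proof -
    have "weight (\<ominus> y2) 0 x" using weight_0_iff cent_Y'D[of x] x by (simp add: l_minus r_minus)
    from wproj_weight[OF ny2C this] show ?thesis by simp
  qed
  ultimately show "x \<in> fspan K (\<lambda>i. (s [^] p) [^] i) n" by metis
qed

lemma Y'_cent: "Y' \<subseteq> cent Y'"
proof
  fix x assume x: "x \<in> Y'"
  have "x \<in> cent Y \<and> x \<otimes> y2 = y2 \<otimes> x"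
  proof (cases "x = y2")
    case False
    then have "x \<in> Y" using x by (simp add: Y'_def)
    then show ?thesis using Y_cent centD[OF y2_C, of x] by auto
  qed (use y2_C in simp)
  then show "x \<in> cent Y'" using cent_Y'I by blast
qed

lemma stage_Suc: "\<exists>c' w'. stage (Suc r) Y' c' w'"
proof -
  obtain c' where c': "c' \<in> cent Y' \<inter> cent (cent Y')" "(dl t ^^ (p ^ Suc r - 1)) c' = \<one>"
    using ex_c' by blast
  obtain w' where w': "discrete_valuation A' w'" "\<forall>x \<in> K - {\<zero>}. w' x = int n * v x"
    using ex_A'_val by blast
  have "stage (Suc r) Y' c' w'"
    unfolding stage_def sp_eq A'_def[symmetric]
    using Y'_cent conj_Y' solve_Y' c' sp_Y' A'_comm A'_dim w' T_Y' by blast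
  then show ?thesis by blast
qed

end

section \<open>Choice of the next generator\<close>

context tower_stage
begin

text \<open>\<open>ex_artin_schreier\<close> is used twice: before the choice of \<open>d\<close>,
  to place y1^p - y1 in \<open>F y1\<close> where its value bounds \<open>d\<close>, and after
  adding d s, which spoils membership in \<open>Z\<close>.\<close>

lemma ex_next_stage: "\<exists>y c' w'. stage (Suc r) (insert y Y) c' w'"
proof -
  obtain y0 where y0: "y0 \<in> cent Y" "dl t y0 = c" using ex_root by blast
  obtain b0 where b0: "b0 \<in> cent Y \<inter> cent {t}" "(y0 \<oplus> b0) [^] p \<ominus> (y0 \<oplus> b0) \<in> Z"
    using ex_artin_schreier[OF y0] by blast
  define y1 where "y1 = y0 \<oplus> b0"
  have y1: "y1 \<in> cent Y" "y1 [^] p \<ominus> y1 \<in> Z"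
    using y0 b0 subringE(7)[OF C_ring] unfolding y1_def by auto
  have "b0 \<otimes> t = t \<otimes> b0" "b0 \<in> carrier R" using b0(1) centD[of b0 "{t}" t] by blast+
  then have "dl t b0 = \<zero>" using dl_eq_zero_iff[OF t] by simp
  then have dl1: "dl t y1 = c"
    unfolding y1_def using y0 b0 CC additive_map_add[OF additive_map_dl[OF t], of y0 b0] dl_closed[OF t, of y0] by auto
  have y1C: "y1 \<in> carrier R" using y1 CC by blast
  have dls: "dl s y1 = \<one>" using dl_s y1C dl1 .
  obtain g where g: "g \<in> F y1" "s \<ominus> g \<noteq> \<zero>" "\<not> int p dvd w (s \<ominus> g)"
    using ex_g[OF y1(1) dls] by blast
  define \<beta> where "\<beta> = y1 [^] p \<ominus> y1"
  \<comment> \<open>Exceeds every quantity to be dominated; as \<open>n\<close> is positive, w d = -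
    n k \<le> - k.\<close>
  define k where "k = \<bar>w g\<bar> + int p * \<bar>w (s \<ominus> g)\<bar> + int p + \<bar>w \<beta> div int p\<bar> + 1"
  obtain d where d: "d \<in> K - {\<zero>}" "v d = - k" using dval_surj[OF v] by blast
  have wd: "w d = - (int n * k)" using w_K[OF d(1)] d(2) by simp
  have k0: "0 < k" and kg: "\<bar>w (s \<ominus> g)\<bar> < k" and kb: "\<bar>w (s \<ominus> g)\<bar> + \<bar>w \<beta> div int p\<bar> < k"
    and kw: "\<bar>w g\<bar> + int p * \<bar>w (s \<ominus> g)\<bar> + int p < k"
  proof -
    have "1 * \<bar>w (s \<ominus> g)\<bar> \<le> int p * \<bar>w (s \<ominus> g)\<bar>"
      using p_ge_2 by (intro mult_right_mono) auto
    then show "0 < k" "\<bar>w (s \<ominus> g)\<bar> < k" "\<bar>w (s \<ominus> g)\<bar> + \<bar>w \<beta> div int p\<bar> < k"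
      "\<bar>w g\<bar> + int p * \<bar>w (s \<ominus> g)\<bar> + int p < k"
      using p_ge_2 by (simp_all add: k_def)
  qed
  have nk: "k \<le> int n * k" using mult_right_mono[of 1 "int n" k] n_pos k0 by simp
  have d2: "w d + w (s \<ominus> g) < 0" using wd nk kg by linarith
  have d3: "w d + w (s \<ominus> g) < w \<beta> div int p" using wd nk kb by linarith
  have d4: "g = \<zero> \<or> w d + w (s \<ominus> g) < w (d \<otimes> g) div int p"
  proof (cases "g = \<zero>")
    case False
    have "w (d \<otimes> g) = w d + w g"
      using dval_mult[OF A_val, of d g] d K_A g(1) F_A[OF y1(1) dls] False by blast
    \<comment> \<open>Since p \<ge> 2, p times a very negative \<open>w d\<close> lies below
      \<open>w d\<close> by at least n k, which outweighs the other terms.\<close>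
    moreover have "int p * (w d + w (s \<ominus> g) + 1) \<le> w d + w g"
    proof -
      have "1 * (int n * k) \<le> (int p - 1) * (int n * k)"
        using p_ge_2 k0 by (intro mult_right_mono) auto
      then have "int p * w d \<le> w d - int n * k" unfolding wd by (simp add: algebra_simps)
      moreover have "int p * w (s \<ominus> g) \<le> int p * \<bar>w (s \<ominus> g)\<bar>" by (intro mult_left_mono) auto
      ultimately show ?thesis using nk kw by (simp add: algebra_simps)
    qed
    ultimately have "w d + w (s \<ominus> g) + 1 \<le> w (d \<otimes> g) div int p"
      using zdiv_mono1[of "int p * (w d + w (s \<ominus> g) + 1)" "w (d \<otimes> g)" "int p"] p_ge_2 by simp
    then show ?thesis by simp
  qed simp
  have dC: "d \<in> carrier R" using d by blast
  have ds: "d \<otimes> s \<in> cent Y" using d K_C s_C subringE(6)[OF C_ring] by blast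
  have "dl t (d \<otimes> s) = \<zero>"
    using dl_eq_zero_iff[of t "d \<otimes> s"] commute_mult[of d s t] K_comm[of d t] d pow_commute[of t t "p ^ r"] by auto
  then have "dl t (y1 \<oplus> d \<otimes> s) = c"
    using dl1 y1C dC additive_map_add[OF additive_map_dl[OF t], of y1 "d \<otimes> s"] dl_closed[OF t, of y1] by auto
  moreover have "y1 \<oplus> d \<otimes> s \<in> cent Y" using y1(1) ds subringE(7)[OF C_ring] by blast
  ultimately obtain b where b: "b \<in> cent Y \<inter> cent {t}" "b \<otimes> (y1 \<oplus> d \<otimes> s) = (y1 \<oplus> d \<otimes> s) \<otimes> b"
    "(y1 \<oplus> d \<otimes> s \<oplus> b) [^] p \<ominus> (y1 \<oplus> d \<otimes> s \<oplus> b) \<in> Z"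
    using ex_artin_schreier by blast
  interpret next_stage R p K v w0 t n M N v0 r Y c w y1 g d b "y1 \<oplus> d \<otimes> s \<oplus> b"
    using y1 dl1 g d(1) d2 d3[unfolded \<beta>_def] d4 b by unfold_locales auto
  show ?thesis using stage_Suc unfolding Y'_def by blast
qed

end

context inseparable_setting
begin

lemma ex_stage: "r \<le> M \<Longrightarrow> \<exists>Y c w. stage r Y c w"
proof (induction r)
  case 0
  then show ?case using stage_0 by blast
next
  case (Suc r)
  then obtain Y c w where "stage r Y c w" by auto
  then interpret tower_stage R p K v w0 t n M N v0 r Y c w
    using Suc.prems by unfold_locales auto
  show ?case using ex_next_stage by blast
qed

end

section \<open>Cyclicity\<close>

context char_p_division_ring
begin

definition difference :: "(nat \<Rightarrow> 'a) \<Rightarrow> nat \<Rightarrow> 'a" where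
  "difference f k = f (Suc k) \<ominus> f k"

lemma difference_closed: "(\<And>k. f k \<in> carrier R) \<Longrightarrow> (difference ^^ m) f k \<in> carrier R"
  by (induction m arbitrary: k) (simp_all add: difference_def)

text \<open>Leibniz rule for forward differences: the factor a + k has first difference
  \<open>\<one>\<close> and second difference zero, so two terms remain.\<close>

lemma difference_linear_mult:
  assumes a: "a \<in> carrier R" and f: "\<And>k. f k \<in> carrier R"
  shows "(difference ^^ Suc m) (\<lambda>k. (a \<oplus> [k] \<cdot> \<one>) \<otimes> f k) k =
    (a \<oplus> [k] \<cdot> \<one>) \<otimes> (difference ^^ Suc m) f k \<oplus> [Suc m] \<cdot> (difference ^^ m) f (Suc k)"
proof -
  have step: "(z \<oplus> \<one>) \<otimes> h' \<ominus> z \<otimes> h = z \<otimes> (h' \<ominus> h) \<oplus> h'"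
    if "z \<in> carrier R" "h \<in> carrier R" "h' \<in> carrier R" for z h h'
    using that by algebra
  have prod: "difference (\<lambda>k. (a \<oplus> [k] \<cdot> \<one>) \<otimes> h k) k = (a \<oplus> [k] \<cdot> \<one>) \<otimes> difference h k \<oplus> h (Suc k)"
    if h: "\<And>k. h k \<in> carrier R" for h k
    using step[of "a \<oplus> [k] \<cdot> \<one>" "h k" "h (Suc k)"] a h by (simp add: difference_def a_assoc)
  show ?thesis
  proof (induction m arbitrary: k)
    case 0
    then show ?case using prod[OF f] f by simp
  next
    case (Suc m)
    let ?G = "(difference ^^ Suc m) f" and ?H = "(difference ^^ m) f"
    have G: "?G k \<in> carrier R" and H: "?H k \<in> carrier R" for k
      using difference_closed[of f, OF f] by blast+
    have IH: "(difference ^^ Suc m) (\<lambda>k. (a \<oplus> [k] \<cdot> \<one>) \<otimes> f k) =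
        (\<lambda>k. (a \<oplus> [k] \<cdot> \<one>) \<otimes> ?G k \<oplus> [Suc m] \<cdot> ?H (Suc k))"
      by (rule ext) (rule Suc.IH)
    have "(difference ^^ Suc (Suc m)) (\<lambda>k. (a \<oplus> [k] \<cdot> \<one>) \<otimes> f k) k =
        difference (\<lambda>k. (a \<oplus> [k] \<cdot> \<one>) \<otimes> ?G k \<oplus> [Suc m] \<cdot> ?H (Suc k)) k"
      by (simp only: funpow.simps(2)[of "Suc m" difference] comp_apply IH)
    also have "\<dots> = difference (\<lambda>k. (a \<oplus> [k] \<cdot> \<one>) \<otimes> ?G k) k \<oplus> ([Suc m] \<cdot> ?H (Suc (Suc k)) \<ominus> [Suc m] \<cdot> ?H (Suc k))"
    proof -
      have "(x \<oplus> y) \<ominus> (x' \<oplus> y') = (x \<ominus> x') \<oplus> (y \<ominus> y')"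
        if "x \<in> carrier R" "y \<in> carrier R" "x' \<in> carrier R" "y' \<in> carrier R" for x y x' y'
        using that by algebra
      then show ?thesis unfolding difference_def[of "\<lambda>k. _ k \<oplus> _ k"] difference_def[of "\<lambda>k. _ k \<otimes> _ k"]
        using a G H by (simp del: add.nat_pow_Suc funpow.simps)
    qed
    also have "[Suc m] \<cdot> ?H (Suc (Suc k)) \<ominus> [Suc m] \<cdot> ?H (Suc k) = [Suc m] \<cdot> ?G (Suc k)"
    proof -
      have am: "additive_map (\<lambda>x. [Suc m] \<cdot> x)"
        by (rule additive_mapI) (simp_all add: add.nat_pow_distrib del: add.nat_pow_Suc)
      show ?thesis
        using additive_map_diff[OF am H H, of "Suc (Suc k)" "Suc k"] by (simp add: difference_def del: add.nat_pow_Suc)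
    qed
    also have "difference (\<lambda>k. (a \<oplus> [k] \<cdot> \<one>) \<otimes> ?G k) k = (a \<oplus> [k] \<cdot> \<one>) \<otimes> difference ?G k \<oplus> ?G (Suc k)"
      by (rule prod[OF G])
    also have "difference ?G k = (difference ^^ Suc (Suc m)) f k" by simp
    finally show ?case
      using a G[of "Suc k"] G[of k] difference_closed[of f, OF f, of "Suc (Suc m)" k]
      by (simp add: a_assoc add.nat_pow_Suc[where n = "Suc m"] a_comm[of "?G (Suc k)"] del: add.nat_pow_Suc funpow.simps)
  qed
qed

lemma difference_power:
  assumes a: "a \<in> carrier R"
  shows "(difference ^^ m) (\<lambda>k. (a \<oplus> [k] \<cdot> \<one>) [^] m) k = [(fact m :: nat)] \<cdot> \<one>"
proof (induction m arbitrary: k)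
  case (Suc m)
  let ?f = "\<lambda>k. (a \<oplus> [k] \<cdot> \<one>) [^] m"
  have f: "?f k \<in> carrier R" for k :: nat using a by simp
  \<comment> \<open>The \<open>m\<close>-th difference is constant, so the next one vanishes and
    only the second Leibniz term is left.\<close>
  have "(difference ^^ Suc m) ?f k = difference ((difference ^^ m) ?f) k" by simp
  then have "(difference ^^ Suc m) ?f k = \<zero>"
    unfolding difference_def[of "(difference ^^ m) ?f"] Suc by simp
  moreover have "(\<lambda>k :: nat. (a \<oplus> [k] \<cdot> \<one>) [^] Suc m) = (\<lambda>k. (a \<oplus> [k] \<cdot> \<one>) \<otimes> ?f k)"
    using a by (intro ext nat_pow_Suc2) simp
  ultimately have "(difference ^^ Suc m) (\<lambda>k. (a \<oplus> [k] \<cdot> \<one>) [^] Suc m) k = [Suc m] \<cdot> ([(fact m :: nat)] \<cdot> \<one>)"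
    using difference_linear_mult[of a ?f, OF a f, of m k] Suc[of "Suc k"] a by simp
  then show ?case using add_pow_mult[of \<one> "Suc m" "fact m"] by simp
qed simp

text \<open>Otherwise the \<open>(p - 1)\<close>-st powers of all \<open>a + k\<close> would be \<open>1\<close>, although the \<open>(p - 1)\<close>-st difference
  of this sequence is \<open>(p - 1)!\<close>.\<close>

lemma frobenius_fixed:
  assumes a: "a \<in> carrier R" and a_p: "a [^] p = a"
  shows "\<exists>k :: nat. a = [k] \<cdot> \<one>"
proof -
  have "\<exists>k :: nat. a \<oplus> [k] \<cdot> \<one> = \<zero>"
  proof (rule ccontr)
    assume no: "\<nexists>k :: nat. a \<oplus> [k] \<cdot> \<one> = \<zero>"
    have p1: "p = Suc (p - 1)" using p_ge_2 by simp
    have "(a \<oplus> [k] \<cdot> \<one>) [^] (p - 1) = \<one>" for k :: nat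
    proof -
      let ?b = "a \<oplus> [k] \<cdot> \<one>"
      have b: "?b \<in> carrier R" "?b \<noteq> \<zero>" using a no by auto
      have pk: "([k] \<cdot> \<one>) [^] p = [k] \<cdot> \<one>"
      proof (induction k)
        case 0
        then show ?case using nat_pow_zero[of p] p_ge_2 by simp
      next
        case (Suc k)
        then show ?case using frobenius_add[of "[k] \<cdot> \<one>" \<one>] by simp
      qed
      have "?b [^] p = ?b"
        using frobenius_add[of a "[k] \<cdot> \<one>"] a a_p pk by (simp add: add_pow_ldistr add_pow_rdistr)
      then have "?b [^] (p - 1) \<otimes> ?b = ?b"
        using p1 nat_pow_Suc[of ?b "p - 1"] by simp
      moreover have "?b [^] (p - 1) = ?b [^] (p - 1) \<otimes> ?b \<otimes> inv ?b"
        using b inv_nonzero[OF b] by (simp add: m_assoc)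
      ultimately show ?thesis using inv_nonzero[OF b] by simp
    qed
    then have "(difference ^^ (p - 1)) (\<lambda>k. \<one>) 0 = [(fact (p - 1) :: nat)] \<cdot> \<one>"
      using difference_power[OF a, of "p - 1" 0] by simp
    moreover have "(difference ^^ Suc m) (\<lambda>k. \<one>) k = \<zero>" for m k
    proof (induction m arbitrary: k)
      case (Suc m)
      show ?case
        by (simp only: funpow.simps(2)[of "Suc m" difference] comp_apply) (simp add: difference_def Suc del: funpow.simps)
    qed (simp add: difference_def)
    moreover have "p - 1 = Suc (p - 2)" using p_ge_2 by simp
    ultimately have "[(fact (p - 1) :: nat)] \<cdot> \<one> = \<zero>" by metis
    then show False using add_pow_nonzero[of \<one> "fact (p - 1)"] not_dvd_fact[of "p - 1"] p_ge_2 by simp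
  qed
  then obtain k :: nat where k: "a \<oplus> [k] \<cdot> \<one> = \<zero>" by blast
  \<comment> \<open>(p - 1) k serves as a natural number representing - k.\<close>
  have "[k] \<cdot> \<one> \<oplus> [((p - 1) * k)] \<cdot> \<one> = [(p * k)] \<cdot> \<one>"
    using p_ge_2 add.nat_pow_mult[of \<one> k "(p - 1) * k"] by (simp add: algebra_simps diff_mult_distrib)
  also have "\<dots> = \<zero>" by (rule dvd_add_pow) simp_all
  finally have k': "[k] \<cdot> \<one> \<oplus> [((p - 1) * k)] \<cdot> \<one> = \<zero>" .
  have "a = (a \<oplus> [k] \<cdot> \<one>) \<oplus> [((p - 1) * k)] \<cdot> \<one>"
    using a k' by (simp add: a_assoc)
  then show ?thesis using k a by auto
qed

end

context inseparable_setting
begin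

context
  fixes Y c w assumes final: "stage M Y c w"
begin

definition E :: "'a set" where "E = cent Y"

lemma YC: "Y \<subseteq> carrier R" and Y_E: "Y \<subseteq> E" and conj_t_E: "x \<in> E \<Longrightarrow> conj t x \<in> E"
  and c_E: "c \<in> E" and c_trace: "(dl t ^^ (p ^ M - 1)) c = \<one>"
  using final cent_subset_carrier[of Y] by (auto simp: stage_def E_def)

text \<open>t^(p^M) is central and imposes no condition, so the maximal subfield of stage
  \<open>M\<close> is \<open>cent Y\<close> itself.\<close>

lemma E_eq: "cent (insert (t [^] (p ^ M)) Y) = E"
proof -
  have "cent Y \<subseteq> cent {t [^] (p ^ M)}"
    using K_comm[OF t_pM] by (auto simp: cent_def)
  then show ?thesis unfolding E_def cent_insert[of _ Y] by blast
qed

lemma E_comm: "a \<in> E \<Longrightarrow> b \<in> E \<Longrightarrow> a \<otimes> b = b \<otimes> a"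
  and E_dim: "dimension n K E" and E_val: "discrete_valuation E w"
  and E_val_K: "x \<in> K - {\<zero>} \<Longrightarrow> w x = int n * v x"
  using final unfolding stage_def E_eq by blast+

lemma E_field: "subfield E R" using dval_subfield[OF E_val] .

lemmas E_ring = subfieldE(1)[OF E_field]

lemma EC: "x \<in> E \<Longrightarrow> x \<in> carrier R" using subringE(1)[OF E_ring] by blast

lemma K_E: "K \<subseteq> E" unfolding E_def using K_cent[OF YC] .

text \<open>By the last clause of \<open>stage\<close>, elements of \<open>E\<close> commuting with
  \<open>t\<close> are combinations of powers of t^(p^M), which is in \<open>K\<close>.\<close>

lemma E_T: "E \<inter> cent {t} = K"
proof
  have "fspan K (\<lambda>i. (t [^] (p ^ M)) [^] i) n \<subseteq> K"
    using subring_pow[OF subfieldE(1)[OF K] t_pM]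
    by (intro fspan_subset[OF subfieldE(1)[OF K] subfieldE(1)[OF K]]) auto
  then show "E \<inter> cent {t} \<subseteq> K"
    using final unfolding stage_def E_def by blast
  show "K \<subseteq> E \<inter> cent {t}" using K_E K_cent[of "{t}"] by auto
qed

text \<open>A larger subfield commutes with \<open>Y\<close>, which lies in \<open>E\<close>, and so
  is contained in \<open>cent Y\<close>.\<close>

lemma maximal_E: "maximal_subfield K E"
  unfolding maximal_subfield_def
proof (intro conjI allI impI E_field K_E)
  fix M' assume M': "subfield M' R \<and> E \<subseteq> M'"
  have "M' \<subseteq> cent Y"
  proof
    fix x assume x: "x \<in> M'"
    show "x \<in> cent Y"
    proof (rule centI)
      show "x \<in> carrier R" using subfieldE(3)[of M' R] M' x by blast
      show "x \<otimes> y = y \<otimes> x" if "y \<in> Y" for y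
        using subfieldE(4)[of M' R x y] that Y_E M' x by auto
    qed
  qed
  then show "M' = E" using M' by (auto simp: E_def)
qed

lemma totally_ramified_E: "totally_ramified K v E"
  unfolding totally_ramified_def finite_field_extension_def prolongs_with_index_def
  using K E_field K_E E_dim E_val E_val_K n_pos finite_dimensionI[OF E_dim] by blast

text \<open>Natural exponents reach inverses because the order is finite; \<open>restrict\<close> is
  there because \<open>Bij E\<close> consists of extensional functions.\<close>

definition \<sigma> :: "nat \<Rightarrow> 'a \<Rightarrow> 'a" where "\<sigma> i = restrict (conj (t [^] i)) E"

lemma t_pow [simp]: "t [^] (i::nat) \<in> carrier R" "t [^] (i::nat) \<noteq> \<zero>"
  using pow_nonzero[of t i] by simp_all

lemma conj_E: "x \<in> E \<Longrightarrow> conj (t [^] (i::nat)) x \<in> E"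
proof -
  assume x: "x \<in> E"
  have "(conj t ^^ i) x \<in> E" by (induction i) (use x conj_t_E in auto)
  then show ?thesis using funpow_conj[of t x i] EC[OF x] by simp
qed

lemma conj_conj_pow: "x \<in> carrier R \<Longrightarrow> conj (t [^] (i::nat)) (conj (t [^] (k::nat)) x) = conj (t [^] (i + k)) x"
  using conj_conj[of "t [^] i" "t [^] k" x] by (simp add: nat_pow_mult)

lemma conj_period: "x \<in> carrier R \<Longrightarrow> conj (t [^] (p ^ M * i)) x = x"
  using conj_fixed_iff[of "t [^] (p ^ M * i)" x] K_comm[of "t [^] (p ^ M * i)" x]
    subring_pow[OF subfieldE(1)[OF K] t_pM, of i] by (simp add: nat_pow_pow)

lemma \<sigma>_add: "compose E (\<sigma> i) (\<sigma> k) = \<sigma> (i + k)"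
  by (auto simp: \<sigma>_def compose_def restrict_def conj_E conj_conj_pow EC)

lemma \<sigma>_Bij: "\<sigma> i \<in> Bij E"
proof -
  have e: "(p ^ M - 1) * i + i = p ^ M * i" "i + (p ^ M - 1) * i = p ^ M * i"
    using p_ge_2 by (simp_all add: diff_mult_distrib)
  have "bij_betw (conj (t [^] i)) E E"
  proof (rule bij_betwI[where g = "conj (t [^] ((p ^ M - 1) * i))"])
    show "conj (t [^] ((p ^ M - 1) * i)) (conj (t [^] i) x) = x" if "x \<in> E" for x
      unfolding conj_conj_pow[OF EC[OF that]] e using conj_period[OF EC[OF that]] .
    show "conj (t [^] i) (conj (t [^] ((p ^ M - 1) * i)) x) = x" if "x \<in> E" for x
      unfolding conj_conj_pow[OF EC[OF that]] e using conj_period[OF EC[OF that]] .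
  qed (use conj_E in auto)
  then show ?thesis unfolding Bij_def \<sigma>_def by (auto simp: bij_betw_restrict_eq)
qed

lemma \<sigma>_Gal: "\<sigma> i \<in> carrier (Gal K E)"
proof -
  have "\<sigma> i \<in> ring_hom (R\<lparr>carrier := E\<rparr>) (R\<lparr>carrier := E\<rparr>)"
    using subringE(3,6,7)[OF E_ring]
    by (intro ring_hom_memI)
      (auto simp: \<sigma>_def conj_E conj_mult conj_one EC additive_map_add[OF additive_map_conj])
  moreover have "\<forall>x \<in> K. \<sigma> i x = x"
    using conj_fixed_iff[of "t [^] i"] K_comm[of _ "t [^] i", symmetric] K_E by (auto simp: \<sigma>_def)
  ultimately show ?thesis using \<sigma>_Bij by (simp add: Gal_def)
qed

text \<open>The fixed field of the p^r-th power of \<sigma>, rising from \<open>K\<close> for r = 0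
  to \<open>E\<close> for r = M.\<close>

definition fixed :: "nat \<Rightarrow> 'a set" where "fixed r = E \<inter> cent {t [^] (p ^ r)}"

lemma fixed_eq: "fixed r = cent (insert (t [^] (p ^ r)) Y)"
  unfolding fixed_def E_def cent_insert[of _ Y] by blast

lemma fixed_ring: "subring (fixed r) R"
  unfolding fixed_eq using YC by (intro subring_cent) auto

lemma fixed_field: "subfield (fixed r) R"
  unfolding fixed_eq using YC E_comm
  by (intro subfield_cent) (auto simp: fixed_eq[symmetric] fixed_def)

lemma fixed_iff: "x \<in> fixed r \<longleftrightarrow> x \<in> E \<and> t [^] (p ^ r) \<otimes> x = x \<otimes> t [^] (p ^ r)"
  by (auto simp: fixed_def cent_def EC)

text \<open>Instead of recalling the generators in \<open>Y\<close>, an iterate of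
  \<open>dl t\<close> on the trace-one element \<open>c\<close> supplies one for each step;
  \<open>nilpotent_basis\<close> gives the span.\<close>

lemma ex_fixed_generator:
  assumes r: "r < M"
  shows "\<exists>y \<in> fixed (Suc r). dl (t [^] (p ^ r)) y = \<one> \<and> fixed (Suc r) = fspan (fixed r) (\<lambda>i. y [^] i) p"
proof -
  let ?s = "t [^] (p ^ r)"
  have sp: "t [^] (p ^ Suc r) = ?s [^] p" by (simp add: nat_pow_pow mult.commute)
  have spC: "?s [^] p \<in> carrier R" "?s [^] p \<noteq> \<zero>" unfolding sp[symmetric] by simp_all
  \<comment> \<open>Exactly p^r further iterations lead from here to the trace value
    \<open>\<one>\<close>.\<close>
  define y where "y = (dl t ^^ (p ^ M - 1 - p ^ r)) c"
  have dl_E: "dl t x \<in> E" if "x \<in> E" for x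
    unfolding dl_def using that conj_t_E by (intro subring_minus[OF E_ring])
  have "(dl t ^^ k) c \<in> E" for k
    by (induction k) (use c_E dl_E in auto)
  then have y: "y \<in> E" unfolding y_def .
  have "p ^ r < p ^ M" using r p_ge_2 by (intro power_strict_increasing) auto
  then have "p ^ M - 1 = p ^ r + (p ^ M - 1 - p ^ r)" by simp
  then have "(dl t ^^ (p ^ r)) y = \<one>"
    using c_trace unfolding y_def by (metis comp_apply funpow_add)
  then have dl_y: "dl ?s y = \<one>" using funpow_dl_pk[of t y r] EC[OF y] by simp
  have p2: "p = Suc (Suc (p - 2))" using p_ge_2 by simp
  have "dl ?s \<one> = \<zero>" using dl_eq_zero_iff[of ?s \<one>] by simp
  then have "(dl ?s ^^ p) y = \<zero>"
    using additive_map_zero[OF additive_map_funpow[OF additive_map_dl[OF t_pow]], of "p - 2" "p ^ r"] dl_y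
    by (subst p2) (simp only: funpow_Suc_right comp_apply)
  moreover have dl_p: "(dl ?s ^^ p) x = \<zero> \<longleftrightarrow> ?s [^] p \<otimes> x = x \<otimes> ?s [^] p" if "x \<in> carrier R" for x
    using funpow_dl_pk[of ?s x 1] dl_eq_zero_iff[OF spC that] that by simp
  ultimately have y': "y \<in> fixed (Suc r)"
    unfolding fixed_iff sp using y EC[OF y] by simp
  have sub: "fixed r \<subseteq> fixed (Suc r)"
  proof
    fix x assume "x \<in> fixed r"
    then show "x \<in> fixed (Suc r)"
      unfolding fixed_iff sp using pow_commute[of ?s x p] EC by auto
  qed
  have ker: "dl ?s x = \<zero> \<longleftrightarrow> x \<in> fixed r" if "x \<in> fixed (Suc r)" for x
    using that dl_eq_zero_iff[of ?s x] EC[of x] by (auto simp: fixed_iff)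
  have dlf: "dl ?s x \<in> fixed (Suc r)" if x: "x \<in> fixed (Suc r)" for x
  proof -
    have xE: "x \<in> E" and xC: "x \<in> carrier R" using x EC by (auto simp: fixed_iff)
    have "dl ?s x \<in> E"
      unfolding dl_def using conj_E[OF xE] xE by (intro subring_minus[OF E_ring])
    moreover have "(dl ?s ^^ p) (dl ?s x) = dl ?s ((dl ?s ^^ p) x)"
      using funpow_swap1[of "dl ?s" p x] by simp
    moreover have "(dl ?s ^^ p) x = \<zero>" using x dl_p[OF xC] by (simp add: fixed_iff sp del: power_Suc)
    ultimately show ?thesis
      unfolding fixed_iff sp using dl_p[of "dl ?s x"] xC additive_map_zero[OF additive_map_dl[OF t_pow], of "p ^ r"]
      by simp
  qed
  have lin: "dl ?s (a \<otimes> x) = a \<otimes> dl ?s x" if "a \<in> fixed r" "x \<in> carrier R" for a x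
    using dl_lin[of ?s a x] that EC[of a] by (simp add: fixed_iff)
  have yk: "y [^] k \<in> fixed (Suc r)" if "k < p" for k :: nat
    using subring_pow[OF fixed_ring y'] .
  have top: "(dl ?s ^^ k) (y [^] k) \<in> fixed r - {\<zero>}" if "k < p" for k
    using funpow_dl_power[of ?s y k] EC[OF y] dl_y add_pow_nonzero[of \<one> "fact k"] not_dvd_fact[OF that]
      subring_add_pow[OF fixed_ring subringE(3)[OF fixed_ring]] by auto
  have nb: "x \<in> fspan (fixed r) (\<lambda>i. y [^] i) p" if "x \<in> fixed (Suc r)" "(dl ?s ^^ p) x = \<zero>" for x
    by (rule nilpotent_basis(1)[where L = "dl ?s" and B = "fixed (Suc r)" and m = p])
      (fact fixed_field fixed_ring sub additive_map_dl[OF t_pow] dlf lin ker yk top that order_refl)+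
  have "fspan (fixed r) (\<lambda>i. y [^] i) p \<subseteq> fixed (Suc r)"
    using yk by (intro fspan_subset[OF fixed_ring fixed_ring sub])
  moreover have "fixed (Suc r) \<subseteq> fspan (fixed r) (\<lambda>i. y [^] i) p"
  proof
    fix x assume x: "x \<in> fixed (Suc r)"
    then have "(dl ?s ^^ p) x = \<zero>" using dl_p[of x] EC[of x] by (simp add: fixed_iff sp del: power_Suc)
    then show "x \<in> fspan (fixed r) (\<lambda>i. y [^] i) p" using nb x by blast
  qed
  ultimately show ?thesis using y' dl_y by blast
qed

text \<open>Induction along the fields \<open>fixed r\<close>. If \<tau> agrees with \<sigma>^i on
  one of them, \<tau> y and \<sigma>^i y satisfy the same Artin-Schreier equation and differ by some
  k in the prime field. Adding p^r k to the exponent repairs this and changes nothing on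
  \<open>fixed r\<close>.\<close>

lemma Gal_eq_\<sigma>:
  assumes \<tau>: "\<tau> \<in> carrier (Gal K E)" shows "\<exists>i. \<tau> = \<sigma> i"
proof -
  have bij: "\<tau> \<in> Bij E" and hom: "\<tau> \<in> ring_hom (R\<lparr>carrier := E\<rparr>) (R\<lparr>carrier := E\<rparr>)" and fixK: "\<And>x. x \<in> K \<Longrightarrow> \<tau> x = x"
    using \<tau> by (auto simp: Gal_def)
  have \<tau>E: "\<tau> x \<in> E" if "x \<in> E" for x using ring_hom_closed[OF hom, of x] that by simp
  have \<tau>_mult: "\<tau> (x \<otimes> y) = \<tau> x \<otimes> \<tau> y" if "x \<in> E" "y \<in> E" for x y
    using ring_hom_mult[OF hom, of x y] that by simp
  have \<tau>_add: "\<tau> (x \<oplus> y) = \<tau> x \<oplus> \<tau> y" if "x \<in> E" "y \<in> E" for x y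
    using ring_hom_add[OF hom, of x y] that by simp
  have \<tau>_one: "\<tau> \<one> = \<one>" using ring_hom_one[OF hom] by simp
  have \<tau>_zero: "\<tau> \<zero> = \<zero>" using fixK subringE(2)[OF subfieldE(1)[OF K]] by blast
  have \<tau>_pow: "\<tau> (x [^] (k::nat)) = \<tau> x [^] k" if "x \<in> E" for x k
    by (induction k) (use that \<tau>_one \<tau>_mult subring_pow[OF E_ring] in auto)
  have "\<exists>i. \<forall>x \<in> fixed r. \<tau> x = conj (t [^] (i::nat)) x" if "r \<le> M" for r
    using that
  proof (induction r)
    case 0
    have "fixed 0 = K" using E_T by (simp add: fixed_def)
    moreover have "conj (t [^] (0::nat)) x = x" if "x \<in> K" for x
      using conj_fixed_iff[of "t [^] (0::nat)" x] that by simp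
    ultimately show ?case using fixK by (intro exI[of _ 0]) auto
  next
    case (Suc r)
    then obtain i where i: "\<And>x. x \<in> fixed r \<Longrightarrow> \<tau> x = conj (t [^] (i::nat)) x" by auto
    obtain y where y: "y \<in> fixed (Suc r)" "dl (t [^] (p ^ r)) y = \<one>"
      "fixed (Suc r) = fspan (fixed r) (\<lambda>i. y [^] i) p"
      using ex_fixed_generator[of r] Suc.prems by auto
    let ?s = "t [^] (p ^ r)"
    have yE: "y \<in> E" using y(1) unfolding fixed_iff by blast
    have yC: "y \<in> carrier R" using EC[OF yE] .
    define \<beta> where "\<beta> = y [^] p \<ominus> y"
    have \<beta>E: "\<beta> \<in> E" unfolding \<beta>_def using yE subring_pow[OF E_ring] by (intro subring_minus[OF E_ring])
    have y_p: "y [^] p = \<beta> \<oplus> y" unfolding \<beta>_def using yC by (simp add: diff_add_cancel)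
    have cy: "conj ?s y = y \<oplus> \<one>" using conj_eq_add_dl[of ?s y] yC y(2) by simp
    have "conj ?s \<beta> = (y [^] p \<oplus> \<one>) \<ominus> (y \<oplus> \<one>)"
      unfolding \<beta>_def using yC cy conj_pow[of ?s y p] frobenius_add[of y \<one>]
      by (simp add: additive_map_diff[OF additive_map_conj])
    also have "\<dots> = \<beta>" unfolding \<beta>_def using yC nat_pow_closed[OF yC, of p] one_closed by algebra
    finally have \<beta>: "\<beta> \<in> fixed r" unfolding fixed_iff using \<beta>E conj_fixed_iff[of ?s \<beta>] EC by simp
    define z where "z = conj (t [^] i) y"
    define \<delta> where "\<delta> = \<tau> y \<ominus> z"
    have zE: "z \<in> E" unfolding z_def using conj_E[OF yE] .
    have C: "\<tau> y \<in> carrier R" "z \<in> carrier R" using EC \<tau>E[OF yE] zE by auto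
    have "\<tau> y [^] p = \<tau> \<beta> \<oplus> \<tau> y"
      using \<tau>_pow[OF yE, of p] \<tau>_add[OF \<beta>E yE] y_p by simp
    moreover have "z [^] p = \<tau> \<beta> \<oplus> z"
      unfolding z_def i[OF \<beta>] using conj_pow[of "t [^] i" y p] yC EC[OF \<beta>E] y_p
      by (simp add: additive_map_add[OF additive_map_conj])
    ultimately have "\<delta> [^] p = (\<tau> \<beta> \<oplus> \<tau> y) \<ominus> (\<tau> \<beta> \<oplus> z)"
      unfolding \<delta>_def using frobenius_minus[OF C] E_comm[OF \<tau>E[OF yE] zE] by simp
    also have "\<dots> = \<delta>"
    proof -
      have "\<tau> \<beta> \<in> carrier R" using EC \<tau>E[OF \<beta>E] by blast
      then show ?thesis unfolding \<delta>_def using C by algebra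
    qed
    finally obtain k :: nat where k: "\<delta> = [k] \<cdot> \<one>"
      using frobenius_fixed[of \<delta>] C by (auto simp: \<delta>_def)
    have conj_s_k: "conj (?s [^] k) y = y \<oplus> [k] \<cdot> \<one>" for k :: nat
    proof -
      have "(conj ?s ^^ k) y = y \<oplus> [k] \<cdot> \<one>"
      proof (induction k)
        case (Suc k)
        have "conj ?s ([k] \<cdot> \<one>) = [k] \<cdot> \<one>"
          using additive_map_add_pow[OF additive_map_conj[OF t_pow] one_closed] by (simp add: conj_one)
        then show ?case
          using Suc cy yC by (simp add: additive_map_add[OF additive_map_conj] a_ac)
      qed (use yC in simp)
      then show ?thesis using funpow_conj[of ?s y k] yC by simp
    qed
    have sk: "?s [^] k = t [^] (p ^ r * k)" by (simp add: nat_pow_pow)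
    have \<tau>y: "\<tau> y = conj (t [^] (i + p ^ r * k)) y"
    proof -
      have "conj (t [^] (i + p ^ r * k)) y = conj (t [^] i) (y \<oplus> [k] \<cdot> \<one>)"
        using conj_conj_pow[OF yC, of i "p ^ r * k"] conj_s_k[of k] unfolding sk by simp
      also have "\<dots> = z \<oplus> \<delta>"
        unfolding z_def k using yC additive_map_add_pow[OF additive_map_conj[OF t_pow] one_closed]
        by (simp add: additive_map_add[OF additive_map_conj] conj_one)
      also have "\<dots> = \<tau> y" unfolding \<delta>_def using C diff_add_cancel[OF C] by (simp add: a_comm)
      finally show ?thesis by simp
    qed
    have \<tau>f: "\<tau> x = conj (t [^] (i + p ^ r * k)) x" if x: "x \<in> fixed r" for x
    proof -
      have xC: "x \<in> carrier R" using x EC by (auto simp: fixed_iff)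
      have "conj (?s [^] k) x = x"
        using conj_fixed_iff[of "?s [^] k" x] pow_commute[of ?s x k] x xC pow_nonzero[of ?s k]
        by (auto simp: fixed_iff)
      then show ?thesis
        using conj_conj_pow[OF xC, of i "p ^ r * k"] i[OF x] unfolding sk by simp
    qed
    have yk: "y [^] d \<in> E" for d :: nat using subring_pow[OF E_ring yE] .
    have fE: "fspan (fixed r) (\<lambda>i. y [^] i) d \<subseteq> E" for d
      using yk by (intro fspan_subset[OF fixed_ring E_ring]) (auto simp: fixed_iff)
    have "\<tau> x = conj (t [^] (i + p ^ r * k)) x" if "x \<in> fspan (fixed r) (\<lambda>i. y [^] i) d" for x d
      using that
    proof (induction d arbitrary: x)
      case 0
      then show ?case using \<tau>_zero additive_map_zero[OF additive_map_conj[OF t_pow]] by simp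
    next
      case (Suc d)
      obtain a x' where *: "a \<in> fixed r" "x' \<in> fspan (fixed r) (\<lambda>i. y [^] i) d" "x = a \<otimes> y [^] d \<oplus> x'"
        using Suc.prems unfolding fspan_Suc_iff by blast
      have aE: "a \<in> E" and x'E: "x' \<in> E" using * fE by (auto simp: fixed_iff)
      have "\<tau> x = \<tau> a \<otimes> \<tau> y [^] d \<oplus> \<tau> x'"
        using * aE x'E yk \<tau>_add[of "a \<otimes> y [^] d" x'] \<tau>_mult[of a "y [^] d"] \<tau>_pow[OF yE, of d] subringE(6)[OF E_ring aE yk]
        by simp
      also have "\<dots> = conj (t [^] (i + p ^ r * k)) x"
        unfolding *(3) \<tau>f[OF *(1)] \<tau>y Suc.IH[OF *(2)]
        using EC[OF aE] EC[OF x'E] yC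
        by (simp add: additive_map_add[OF additive_map_conj] conj_mult conj_pow)
      finally show ?case .
    qed
    then show ?case unfolding y(3) by blast
  qed
  from this[OF le_refl] obtain i where "\<And>x. x \<in> E \<Longrightarrow> \<tau> x = conj (t [^] (i::nat)) x"
    unfolding fixed_eq E_eq by blast
  then have "\<tau> = \<sigma> i"
    using Bij_imp_extensional[OF bij] by (intro extensionalityI[of _ E]) (auto simp: \<sigma>_def)
  then show ?thesis by blast
qed

lemma carrier_Gal: "carrier (Gal K E) = range \<sigma>"
  using \<sigma>_Gal Gal_eq_\<sigma> by blast

lemma \<sigma>_mult: "\<sigma> i \<otimes>\<^bsub>BijGroup E\<^esub> \<sigma> k = \<sigma> (i + k)"
  using \<sigma>_Bij \<sigma>_add by (simp add: BijGroup_def)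

lemma \<sigma>_zero: "\<one>\<^bsub>BijGroup E\<^esub> = \<sigma> 0"
proof -
  have "conj \<one> x = x" if "x \<in> E" for x
    using conj_fixed_iff[of \<one> x] EC[OF that] by simp
  then show ?thesis by (auto simp: BijGroup_def \<sigma>_def)
qed

lemma group_Gal: "group (Gal K E)"
proof -
  interpret B: group "BijGroup E" by (rule group_BijGroup)
  have \<sigma>B: "\<sigma> i \<in> carrier (BijGroup E)" for i using \<sigma>_Bij by (simp add: BijGroup_def)
  have "subgroup (range \<sigma>) (BijGroup E)"
  proof (rule B.subgroupI)
    fix a assume "a \<in> range \<sigma>"
    then obtain i where a: "a = \<sigma> i" by blast
    have "(p ^ M - 1) * i + i = p ^ M * i" using p_ge_2 by (simp add: diff_mult_distrib)
    then have "\<sigma> ((p ^ M - 1) * i) \<otimes>\<^bsub>BijGroup E\<^esub> \<sigma> i = \<sigma> (p ^ M * i)"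
      by (simp add: \<sigma>_mult)
    also have "\<dots> = \<sigma> 0"
      using conj_period[of _ i] conj_period[of _ 0] EC by (auto simp: \<sigma>_def)
    finally have "inv\<^bsub>BijGroup E\<^esub> \<sigma> i = \<sigma> ((p ^ M - 1) * i)"
      unfolding \<sigma>_zero[symmetric] using \<sigma>B by (intro B.inv_equality)
    then show "inv\<^bsub>BijGroup E\<^esub> a \<in> range \<sigma>" using a by simp
  qed (use \<sigma>B \<sigma>_mult in auto)
  then have "group (BijGroup E\<lparr>carrier := range \<sigma>\<rparr>)"
    by (rule B.subgroup_imp_group)
  moreover have "Gal K E = BijGroup E\<lparr>carrier := range \<sigma>\<rparr>"
    using carrier_Gal unfolding Gal_def by simp
  ultimately show ?thesis by simp
qed

lemma cyclic_E: "cyclic_extension K E"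
proof -
  interpret G: group "Gal K E" by (rule group_Gal)
  have mult: "\<sigma> i \<otimes>\<^bsub>Gal K E\<^esub> \<sigma> k = \<sigma> (i + k)" for i k
    using \<sigma>_mult by (simp add: Gal_def)
  have one: "\<one>\<^bsub>Gal K E\<^esub> = \<sigma> 0"
    using \<sigma>_zero by (simp add: Gal_def)
  have pow: "\<sigma> 1 [^]\<^bsub>Gal K E\<^esub> i = \<sigma> i" for i :: nat
    by (induction i) (simp_all add: one mult)
  have "carrier (Gal K E) \<subseteq> range (\<lambda>i::int. \<sigma> 1 [^]\<^bsub>Gal K E\<^esub> i)"
  proof
    fix \<tau> assume "\<tau> \<in> carrier (Gal K E)"
    then obtain i where "\<tau> = \<sigma> i" using Gal_eq_\<sigma> by blast
    then have "\<tau> = \<sigma> 1 [^]\<^bsub>Gal K E\<^esub> int i" using pow by (simp add: int_pow_int)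
    then show "\<tau> \<in> range (\<lambda>i::int. \<sigma> 1 [^]\<^bsub>Gal K E\<^esub> i)" by blast
  qed
  moreover have "range (\<lambda>i::int. \<sigma> 1 [^]\<^bsub>Gal K E\<^esub> i) \<subseteq> carrier (Gal K E)"
    using G.int_pow_closed[OF \<sigma>_Gal] by blast
  ultimately have "cyclic_group (Gal K E)"
    unfolding G.cyclic_group using \<sigma>_Gal by blast
  moreover have "{x \<in> E. \<forall>\<tau> \<in> carrier (Gal K E). \<tau> x = x} = K"
  proof
    show "{x \<in> E. \<forall>\<tau> \<in> carrier (Gal K E). \<tau> x = x} \<subseteq> K"
    proof
      fix x assume x: "x \<in> {x \<in> E. \<forall>\<tau> \<in> carrier (Gal K E). \<tau> x = x}"
      then have "\<sigma> 1 x = x" using \<sigma>_Gal by blast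
      then have "t \<otimes> x = x \<otimes> t"
        using x conj_fixed_iff[of t x] EC[of x] by (simp add: \<sigma>_def)
      then have "x \<in> E \<inter> cent {t}" using x EC[of x] by (simp add: cent_def)
      then show "x \<in> K" using E_T by blast
    qed
    show "K \<subseteq> {x \<in> E. \<forall>\<tau> \<in> carrier (Gal K E). \<tau> x = x}"
      using K_E by (auto simp: Gal_def)
  qed
  ultimately show ?thesis
    unfolding cyclic_extension_def galois_extension_def
    using totally_ramified_E by (simp add: totally_ramified_def)
qed

end

theorem ex_cyclic_totally_ramified:
  "\<exists>L. maximal_subfield K L \<and> totally_ramified K v L \<and> cyclic_extension K L"
  using ex_stage[of M] maximal_E totally_ramified_E cyclic_E by blast

end

section \<open>The degenerate case and the reduction to the inseparable setting\<close>

context ring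
begin

text \<open>Covers the case T = K, where no prime characteristic is at hand.\<close>

lemma cyclic_extension_refl:
  assumes K: "subfield K R" shows "cyclic_extension K K"
proof -
  have Gal: "carrier (Gal K K) = {\<one>\<^bsub>BijGroup K\<^esub>}"
  proof
    show "carrier (Gal K K) \<subseteq> {\<one>\<^bsub>BijGroup K\<^esub>}"
    proof
      fix \<tau> assume "\<tau> \<in> carrier (Gal K K)"
      then have "\<tau> \<in> Bij K" "\<And>x. x \<in> K \<Longrightarrow> \<tau> x = x" by (auto simp: Gal_def)
      then have "\<tau> = (\<lambda>x \<in> K. x)"
        using Bij_imp_extensional by (intro extensionalityI[of _ K]) auto
      then show "\<tau> \<in> {\<one>\<^bsub>BijGroup K\<^esub>}" by (simp add: BijGroup_def)
    qed
    have "(\<lambda>x \<in> K. x) \<in> ring_hom (R\<lparr>carrier := K\<rparr>) (R\<lparr>carrier := K\<rparr>)"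
      using subringE(3,6,7)[OF subfieldE(1)[OF K]] by (intro ring_hom_memI) auto
    then show "{\<one>\<^bsub>BijGroup K\<^esub>} \<subseteq> carrier (Gal K K)"
      using id_Bij by (simp add: Gal_def BijGroup_def)
  qed
  have "Gal K K = BijGroup K\<lparr>carrier := {\<one>\<^bsub>BijGroup K\<^esub>}\<rparr>"
    using Gal unfolding Gal_def by simp
  moreover have "group (BijGroup K\<lparr>carrier := {\<one>\<^bsub>BijGroup K\<^esub>}\<rparr>)"
    using group.subgroup_imp_group[OF group_BijGroup group.triv_subgroup[OF group_BijGroup]] .
  ultimately have "trivial_group (Gal K K)"
    unfolding trivial_group_def by simp
  then have "cyclic_group (Gal K K)" by (rule trivial_imp_cyclic_group)
  moreover have "{x \<in> K. \<forall>\<tau> \<in> carrier (Gal K K). \<tau> x = x} = K"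
    by (auto simp: Gal_def)
  moreover have "finite_dimension K K" using finite_dimensionI[OF dimension_one[OF K]] .
  ultimately show ?thesis
    using K by (simp add: cyclic_extension_def galois_extension_def finite_field_extension_def)
qed

end

theorem mainTheorem14:
  fixes D :: "('a, 'm) ring_scheme" (structure)
    and K :: "'a set" and v :: "'a \<Rightarrow> int"
  assumes "ring.complete_discrete_valuation D K v"
    and "NSR_division_algebra D K v"
    and "\<exists>T. ring.maximal_subfield D K T \<and> ring.totally_ramified D K v T \<and>
           ring.purely_inseparable_extension D K T"
  shows "\<exists>L. ring.maximal_subfield D K L \<and> ring.totally_ramified D K v L \<and>
           ring.cyclic_extension D K L"
proof -
  interpret NSR_division_algebra D K v by (rule assms(2))
  have v: "discrete_valuation K v"
    using assms(1) by (simp add: complete_discrete_valuation_def)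
  obtain T where T: "maximal_subfield K T" "totally_ramified K v T" "purely_inseparable_extension K T"
    using assms(3) by blast
  obtain w e where w: "discrete_valuation T w" "0 < e" "\<And>x. x \<in> K - {\<zero>} \<Longrightarrow> w x = int e * v x"
    and dim: "dimension e K T"
    using T(2) by (auto simp: totally_ramified_def prolongs_with_index_def)
  note T_field = dval_subfield[OF w(1)]
  have KT: "K \<subseteq> T" using T(1) by (simp add: maximal_subfield_def)
  have TC: "x \<in> T \<Longrightarrow> x \<in> carrier D" for x using subfieldE(3)[OF T_field] by blast
  obtain t where t: "t \<in> T - {\<zero>}" "w t = 1" using dval_surj[OF w(1)] by blast
  have tC: "t \<in> carrier D" "t \<noteq> \<zero>" using t TC by auto
  show ?thesis
  proof (cases "t \<in> K")
    case True
    \<comment> \<open>A uniformizer in \<open>K\<close> forces ramification index 1, hence T =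
      K.\<close>
    then have "int e * v t = 1" using w(3)[of t] t by simp
    then have "int e dvd 1" by (metis dvd_triv_left)
    then have "e = 1" by simp
    then have "K = T"
      using dimension_subset_eq[OF subfield_K] dim dimension_one[OF subfield_K] KT by blast
    then show ?thesis using T cyclic_extension_refl[OF subfield_K] by blast
  next
    case False
    then obtain p m :: nat where p: "Factorial_Ring.prime p" "[p] \<cdot> \<one> = \<zero>" "t [^] (p ^ m) \<in> K"
      using T(3) t by (auto simp: purely_inseparable_extension_def)
    interpret char_p_division_ring D p
      using p Units_eq by unfold_locales
    have K_eq: "K = cent (carrier D)" using center_eq by (simp add: cent_def)
    have K_comm: "a \<otimes> x = x \<otimes> a" if "a \<in> K" "x \<in> carrier D" for a x
      using that K_eq centD by blast
    have T_comm: "a \<otimes> b = b \<otimes> a" if "a \<in> T" "b \<in> T" for a b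
      using subfieldE(4)[OF T_field] that .
    have "fspan K (\<lambda>i. t [^] i) e \<subseteq> T"
      using t subring_pow[OF subfieldE(1)[OF T_field]]
      by (intro fspan_subset[OF subfieldE(1)[OF subfield_K] subfieldE(1)[OF T_field] KT]) auto
    moreover have "dimension e K (fspan K (\<lambda>i. t [^] i) e)"
      using w(3) by (intro powers_of_uniformizer(2)[OF w(1) subfield_K KT _ t]) simp
    ultimately have T_span: "T = fspan K (\<lambda>i. t [^] i) e"
      using dimension_subset_eq[OF subfield_K dim] by blast
    \<comment> \<open>If \<open>x\<close> commutes with \<open>t\<close>, it commutes with
      \<open>T\<close>, and maximality of \<open>T\<close> applies to the double centralizer of
      \<open>T\<close> and \<open>x\<close>.\<close>
    have cent_t: "cent {t} = T"
    proof
      show "T \<subseteq> cent {t}" using T_comm t TC by (auto intro!: centI)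
      show "cent {t} \<subseteq> T"
      proof
        fix x assume x: "x \<in> cent {t}"
        have xC: "x \<in> carrier D" and xt: "t \<otimes> x = x \<otimes> t" using x centD[of x "{t}" t] by auto
        have ring: "subring (cent {x}) D" using xC by (intro subring_cent) simp
        have "K \<subseteq> cent {x}" "t \<in> cent {x}"
          using K_comm xC xt tC subfieldE(3)[OF subfield_K] by (auto intro!: centI)
        then have "T \<subseteq> cent {x}"
          unfolding T_span using subring_pow[OF ring]
          by (intro fspan_subset[OF subfieldE(1)[OF subfield_K] ring]) auto
        then have "\<And>a. a \<in> T \<Longrightarrow> a \<otimes> x = x \<otimes> a" using centD by blast
        then have comm: "a \<otimes> b = b \<otimes> a" if "a \<in> insert x T" "b \<in> insert x T" for a b
          using that T_comm by (elim insertE) simp_all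
        have sub: "insert x T \<subseteq> carrier D" using xC TC by blast
        have "subfield (cent (cent (insert x T))) D" using subfield_bicommutant[OF sub comm] .
        moreover have "insert x T \<subseteq> cent (cent (insert x T))" using subset_cent_cent[OF sub] .
        ultimately have "cent (cent (insert x T)) = T" "x \<in> cent (cent (insert x T))"
          using T(1) unfolding maximal_subfield_def by blast+
        then show "x \<in> T" by simp
      qed
    qed
    \<comment> \<open>Minimality makes t^(p^r) noncentral for r < M, whence the bound
      \<open>pr\<close>.\<close>
    define M where "M = (LEAST m. t [^] (p ^ m) \<in> K)"
    have tM: "t [^] (p ^ M) \<in> K" unfolding M_def using p(3) by (rule LeastI)
    have t_pow: "t [^] i \<in> carrier D" "t [^] i \<noteq> \<zero>" for i :: nat
      using tC pow_nonzero by auto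
    \<comment> \<open>The nilpotency index of \<open>dl t\<close>; the setting receives
      \<open>N - 1\<close>, the last exponent whose iterate is not identically zero.\<close>
    define N where "N = (LEAST N. \<forall>x \<in> carrier D. (dl t ^^ N) x = \<zero>)"
    have "\<forall>x \<in> carrier D. (dl t ^^ (p ^ M)) x = \<zero>"
      using funpow_dl_pk[OF tC] dl_eq_zero_iff[OF t_pow] K_comm[OF tM] by simp
    then have N: "\<forall>x \<in> carrier D. (dl t ^^ N) x = \<zero>" unfolding N_def by (rule LeastI)
    have "N \<noteq> 0" using N one_not_zero by (metis funpow_0 one_closed)
    then have NS: "N = Suc (N - 1)" by simp
    have pr: "p ^ r \<le> N - 1" if "r < M" for r
    proof -
      have "t [^] (p ^ r) \<notin> K" using that not_less_Least unfolding M_def by blast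
      then obtain x where x: "x \<in> carrier D" "t [^] (p ^ r) \<otimes> x \<noteq> x \<otimes> t [^] (p ^ r)"
        using center_eq t_pow by blast
      then have nz: "(dl t ^^ (p ^ r)) x \<noteq> \<zero>"
        using funpow_dl_pk[OF tC x(1)] dl_eq_zero_iff[OF t_pow x(1)] by simp
      have "\<not> N \<le> p ^ r"
      proof
        assume "N \<le> p ^ r"
        then have "(dl t ^^ (p ^ r)) x = (dl t ^^ (p ^ r - N)) ((dl t ^^ N) x)"
          by (simp flip: funpow_add[unfolded comp_def, THEN fun_cong])
        then show False
          using nz N x(1) additive_map_zero[OF additive_map_funpow[OF additive_map_dl[OF tC]]] by simp
      qed
      then show ?thesis by simp
    qed
    have "\<not> (\<forall>x \<in> carrier D. (dl t ^^ (N - 1)) x = \<zero>)"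
      using not_less_Least[of "N - 1" "\<lambda>N. \<forall>x \<in> carrier D. (dl t ^^ N) x = \<zero>"] NS unfolding N_def[symmetric] by auto
    then obtain x where x: "x \<in> carrier D" "(dl t ^^ (N - 1)) x \<noteq> \<zero>" by blast
    \<comment> \<open>The last nonzero iterate lies in \<open>cent {t}\<close>, over which
      \<open>dl t\<close> is linear, so dividing \<open>x\<close> by it turns the iterate into
      \<open>\<one>\<close>.\<close>
    define a where "a = (dl t ^^ (N - 1)) x"
    have aC: "a \<in> carrier D" unfolding a_def
      using additive_map_funpow[OF additive_map_dl[OF tC]] x(1) by blast
    have "dl t a = (dl t ^^ N) x" unfolding a_def by (subst (2) NS) simp
    then have "dl t a = \<zero>" using N x(1) by simp
    then have "a \<in> cent {t}" using dl_eq_zero_iff[OF tC aC] aC by (simp add: cent_def)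
    moreover have a0: "a \<noteq> \<zero>" using x a_def by simp
    ultimately have "inv a \<in> cent {t}" using tC by (intro cent_inv) simp_all
    then have ia: "t \<otimes> inv a = inv a \<otimes> t" "inv a \<in> carrier D" by (auto simp: cent_def)
    have v0: "(dl t ^^ (N - 1)) (inv a \<otimes> x) = \<one>"
      using funpow_dl_lin[OF tC ia(2) x(1) ia(1), of "N - 1", folded a_def] inv_nonzero(3)[OF aC a0] by (rule trans)
    interpret inseparable_setting D p K v w t e M "N - 1" "inv a \<otimes> x"
    proof (intro inseparable_setting.intro inseparable_setting_axioms.intro)
      show "char_p_division_ring D p" by (rule char_p_division_ring_axioms)
      show "K = cent (carrier D)" by (rule K_eq)
      show "subfield K D" by (rule subfield_K)
      show "discrete_valuation K v" by (rule v)
      show "\<And>a b. a \<in> cent {t} \<Longrightarrow> b \<in> cent {t} \<Longrightarrow> a \<otimes> b = b \<otimes> a" using T_comm cent_t by simp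
      show "cent {t} = fspan K (\<lambda>i. t [^] i) e" using cent_t T_span by simp
      show "dimension e K (cent {t})" using cent_t dim by simp
      show "discrete_valuation (cent {t}) w" using cent_t w(1) by simp
      show "inv a \<otimes> x \<in> carrier D" using ia x by simp
    qed (use tC w tM pr v0 in auto)
    show ?thesis by (rule ex_cyclic_totally_ramified)
  qed
qed

end
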